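(* Let $Q$ be a finite connected quiver without oriented cycles, with a linear form $\Theta\in\mathrm{Hom}_{\mathbb{Z}}(\mathbb{Z}Q_0,\mathbb{Z})$. For every dimension vector $d\in\mathbb{N}Q_0$ there exists an $n\in\mathbb{N}_0$ such that $$M_d^{s}(Q)^{T,n'}\cong\bigcup_{\tilde{d}} M^s_{\tilde{d}}(\tilde{Q})\qquad\text{for all } n'\geq n,$$ where the union is disjoint, $\tilde Q$ is the universal covering quiver of $Q$, $M_d^{s}(Q)^{T,n'}$ is the $n'$-fold iterated torus fixed point set, and $\tilde{d}$ ranges over all equivalence classes of dimension vectors for $\tilde Q$ that are compatible with $d$.
   Context: Everything is over $\mathbb{C}$. $R_d(Q)$ is the space of representations of dimension vector $d$ with base change group $G_d=\prod_q Gl_{d_q}(\mathbb{C})$. The slope is $\mu(d)=\Theta(d)/\sum_q d_q$; a representation $X$ is stable if $\mu(U)<\mu(X)$ for all proper nonzero subrepresentations $U$; $M^s_d(Q)=R^s_d(Q)/G_d$. Only dimension vectors of finite support are considered. Universal abelian covering quiver $\hat Q$ of a quiver $Q$: vertices $Q_0\times\mathbb{Z}Q_1$, arrows $(\alpha,z):(q,z)\to(q',z+e_\alpha)$ for $\alpha:q\to q'$ in $Q_1$, $z\in\mathbb{Z}Q_1$. Iterating, $\hat Q^0=Q$ and $\hat Q^k$ is the universal abelian covering quiver of $\hat Q^{k-1}$. Stability on every covering quiver is induced by giving each vertex over $q\in Q_0$ the weight $\Theta_q$. Iterated fixed points: a torus $T_k=(\mathbb{C}^\ast)^{|\hat Q^{k-1}_1|}$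 acts on representations of $\hat Q^{k-1}$ by scaling the linear maps of the arrows. The fixed point set $M_d^s(Q)^{T_1}$ is identified with the disjoint union of the $M^s_{\hat d}(\hat Q)$ over the dimension vectors $\hat d$ compatible with $d$ (i.e. $d_q=\sum_z\hat d_{(q,z)}$), modulo translation by $\mathbb{Z}Q_1$; on this $T_2$ acts by scaling arrows of $\hat Q$, and so on. $M_d^{s}(Q)^{T,n}=(\ldots(M_d^s(Q)^{T_1})\ldots)^{T_n}$ (with $M_d^s(Q)^{T,0}=M_d^s(Q)$). Universal covering quiver $\tilde Q$: let $W(Q)$ be the group of words in the arrows of $Q$ and their formal inverses, modulo cancellation of $\alpha\alpha^{-1}$ and $\alpha^{-1}\alpha$. Then $\tilde Q_0=Q_0\times W(Q)$ and there is an arrow $\alpha_{(q,w)}:(q,w)\to(q',w\alpha)$ for each $\alpha:q\to q'$ in $Q_1$ and $w\in W(Q)$. $\tilde d$ is compatible with $d$ if $d_q=\sum_w\tilde d_{(q,w)}$ for all $q$. Two dimension vectors are equivalent if they differ by a translation $(q,w)\mapsto(q,vw)$, $v\in W(Q)$. *)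

theory Defs
  imports
    "HOL-Analysis.Sum_Topology"
    "HOL-Algebra.Free_Abelian_Groups"
    "HOL-Library.FSet"
    "Graph_Theory.Digraph_Component"
    "Graph_Theory.Arc_Walk"
    "Jordan_Normal_Form.VS_Connect"
begin

section \<open>Spaces with functions\<close>

text \<open>
  Complex varieties are treated in the classical way, as topological spaces (Zariski topology)
  together with the sheaf of complex-valued regular functions: \<open>regular X U f\<close> says that \<open>f\<close>,
  of which only the values on \<open>U\<close> matter, is a regular function on the open set \<open>U\<close>.
\<close>

record 'p fspace =
  ftop :: "'p topology"
  regular :: "'p set \<Rightarrow> ('p \<Rightarrow> complex) \<Rightarrow> bool"

definition fspace_iso :: "'p fspace \<Rightarrow> 'r fspace \<Rightarrow> bool" (infix "\<cong>\<^sub>f" 50) where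
  "X \<cong>\<^sub>f Y \<longleftrightarrow> (\<exists>\<phi>. homeomorphic_map (ftop X) (ftop Y) \<phi> \<and>
     (\<forall>V f. openin (ftop Y) V \<longrightarrow>
        (regular Y V f \<longleftrightarrow> regular X {x \<in> topspace (ftop X). \<phi> x \<in> V} (f \<circ> \<phi>))))"

text \<open>The induced (reduced) structure on a locally closed subset: regular functions are those
  which locally extend to regular functions of the ambient space.\<close>

definition sub_fspace :: "'p fspace \<Rightarrow> 'p set \<Rightarrow> 'p fspace" where
  "sub_fspace X S = \<lparr> ftop = subtopology (ftop X) S,
     regular = (\<lambda>U f. \<forall>x\<in>U. \<exists>W F. openin (ftop X) W \<and> x \<in> W \<and> regular X W F \<and>
                                  (\<forall>y\<in>W \<inter> U. f y = F y)) \<rparr>"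

text \<open>The quotient structure along \<open>\<pi>\<close>. If \<open>\<pi>\<close> maps a point to its orbit under a group, the
  regular functions are the invariant regular functions on the preimage, as for a geometric
  quotient.\<close>

definition quot_topology :: "'p topology \<Rightarrow> ('p \<Rightarrow> 'r) \<Rightarrow> 'r topology" where
  "quot_topology T \<pi> =
     topology (\<lambda>U. U \<subseteq> \<pi> ` topspace T \<and> openin T {x \<in> topspace T. \<pi> x \<in> U})"

definition quot_fspace :: "'p fspace \<Rightarrow> ('p \<Rightarrow> 'r) \<Rightarrow> 'r fspace" where
  "quot_fspace X \<pi> = \<lparr> ftop = quot_topology (ftop X) \<pi>,
     regular = (\<lambda>U f. regular X {x \<in> topspace (ftop X). \<pi> x \<in> U} (f \<circ> \<pi>)) \<rparr>"

definition sum_fspace :: "('i \<Rightarrow> 'p fspace) \<Rightarrow> 'i set \<Rightarrow> ('i \<times> 'p) fspace" where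
  "sum_fspace X I = \<lparr> ftop = sum_topology (\<lambda>i. ftop (X i)) I,
     regular = (\<lambda>U f. \<forall>i\<in>I. regular (X i) {x. (i, x) \<in> U} (\<lambda>x. f (i, x))) \<rparr>"

lemma openin_quot_topology:
  "openin (quot_topology T \<pi>) U \<longleftrightarrow>
     U \<subseteq> \<pi> ` topspace T \<and> openin T {x \<in> topspace T. \<pi> x \<in> U}"
proof -
  have "istopology (\<lambda>U. U \<subseteq> \<pi> ` topspace T \<and> openin T {x \<in> topspace T. \<pi> x \<in> U})"
    unfolding istopology_def
  proof (intro conjI allI impI)
    fix K assume K: "\<forall>U\<in>K. U \<subseteq> \<pi> ` topspace T \<and> openin T {x \<in> topspace T. \<pi> x \<in> U}"
    have "{x \<in> topspace T. \<pi> x \<in> \<Union>K} = (\<Union>U\<in>K. {x \<in> topspace T. \<pi> x \<in> U})"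
      by blast
    with K show "openin T {x \<in> topspace T. \<pi> x \<in> \<Union>K}"
      by auto
  next
    fix U V
    assume *: "U \<subseteq> \<pi> ` topspace T \<and> openin T {x \<in> topspace T. \<pi> x \<in> U}"
              "V \<subseteq> \<pi> ` topspace T \<and> openin T {x \<in> topspace T. \<pi> x \<in> V}"
    have "{x \<in> topspace T. \<pi> x \<in> U \<inter> V} =
          {x \<in> topspace T. \<pi> x \<in> U} \<inter> {x \<in> topspace T. \<pi> x \<in> V}"
      by blast
    with * show "openin T {x \<in> topspace T. \<pi> x \<in> U \<inter> V}"
      by (auto intro: openin_Int)
  qed auto
  thus ?thesis
    by (simp add: quot_topology_def)
qed


section \<open>Quivers and their stable representations\<close>

type_synonym ('v, 'a) quiver = "('v, 'a) pre_digraph"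

definition dim_vectors :: "('v, 'a) quiver \<Rightarrow> ('v \<Rightarrow> nat) set" where
  "dim_vectors Q = {d. finite {q. d q \<noteq> 0} \<and> {q. d q \<noteq> 0} \<subseteq> verts Q}"

definition reps :: "('v, 'a) quiver \<Rightarrow> ('v \<Rightarrow> nat) \<Rightarrow> ('a \<Rightarrow> complex mat) set" where
  "reps Q d = (\<Pi>\<^sub>E \<alpha>\<in>arcs Q. carrier_mat (d (head Q \<alpha>)) (d (tail Q \<alpha>)))"

abbreviation mat_monoid :: "nat \<Rightarrow> complex mat ring" where
  "mat_monoid n \<equiv> ring_mat TYPE(complex) n ()"

definition base_change :: "('v, 'a) quiver \<Rightarrow> ('v \<Rightarrow> nat) \<Rightarrow> ('v \<Rightarrow> complex mat) set" where
  "base_change Q d = (\<Pi>\<^sub>E q\<in>verts Q. Units (mat_monoid (d q)))"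

definition base_change_act ::
  "('v, 'a) quiver \<Rightarrow> ('v \<Rightarrow> nat) \<Rightarrow> ('v \<Rightarrow> complex mat) \<Rightarrow> ('a \<Rightarrow> complex mat) \<Rightarrow> 'a \<Rightarrow> complex mat"
where
  "base_change_act Q d g X =
     (\<lambda>\<alpha>\<in>arcs Q. g (head Q \<alpha>) * X \<alpha> * inv\<^bsub>mat_monoid (d (tail Q \<alpha>))\<^esub> (g (tail Q \<alpha>)))"

definition orbit ::
  "('v, 'a) quiver \<Rightarrow> ('v \<Rightarrow> nat) \<Rightarrow> ('a \<Rightarrow> complex mat) \<Rightarrow> ('a \<Rightarrow> complex mat) set"
where
  "orbit Q d X = (\<lambda>g. base_change_act Q d g X) ` base_change Q d"

definition subrep ::
  "('v, 'a) quiver \<Rightarrow> ('v \<Rightarrow> nat) \<Rightarrow> ('a \<Rightarrow> complex mat) \<Rightarrow> ('v \<Rightarrow> complex vec set) \<Rightarrow> bool"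
where
  "subrep Q d X U \<longleftrightarrow>
     (\<forall>q\<in>verts Q. subspace class_ring (U q) (module_vec TYPE(complex) (d q))) \<and>
     (\<forall>\<alpha>\<in>arcs Q. \<forall>u\<in>U (tail Q \<alpha>). X \<alpha> *\<^sub>v u \<in> U (head Q \<alpha>))"

definition subrep_dim ::
  "('v, 'a) quiver \<Rightarrow> ('v \<Rightarrow> nat) \<Rightarrow> ('v \<Rightarrow> complex vec set) \<Rightarrow> 'v \<Rightarrow> nat"
where
  "subrep_dim Q d U q =
     (if q \<in> verts Q
      then vectorspace.dim class_ring ((module_vec TYPE(complex) (d q))\<lparr>carrier := U q\<rparr>) else 0)"

definition slope :: "('v \<Rightarrow> int) \<Rightarrow> ('v \<Rightarrow> nat) \<Rightarrow> rat" where
  "slope \<Theta> d = of_int (\<Sum>q | d q \<noteq> 0. \<Theta> q * int (d q)) / of_nat (\<Sum>q | d q \<noteq> 0. d q)"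

definition stable ::
  "('v, 'a) quiver \<Rightarrow> ('v \<Rightarrow> int) \<Rightarrow> ('v \<Rightarrow> nat) \<Rightarrow> ('a \<Rightarrow> complex mat) \<Rightarrow> bool"
where
  "stable Q \<Theta> d X \<longleftrightarrow>
     (\<forall>U. subrep Q d X U \<and>
          (\<exists>q\<in>verts Q. U q \<noteq> {0\<^sub>v (d q)}) \<and> (\<exists>q\<in>verts Q. U q \<noteq> carrier_vec (d q)) \<longrightarrow>
          slope \<Theta> (subrep_dim Q d U) < slope \<Theta> d)"


section \<open>Moduli spaces\<close>

text \<open>The polynomial functions on the affine space \<open>reps Q d\<close>.\<close>

inductive_set poly_funs ::
  "('v, 'a) quiver \<Rightarrow> ('v \<Rightarrow> nat) \<Rightarrow> (('a \<Rightarrow> complex mat) \<Rightarrow> complex) set"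
  for Q :: "('v, 'a) quiver" and d :: "'v \<Rightarrow> nat"
where
  const: "(\<lambda>X. c) \<in> poly_funs Q d"
| coord: "\<alpha> \<in> arcs Q \<Longrightarrow> i < d (head Q \<alpha>) \<Longrightarrow> j < d (tail Q \<alpha>) \<Longrightarrow>
    (\<lambda>X. X \<alpha> $$ (i, j)) \<in> poly_funs Q d"
| add: "f \<in> poly_funs Q d \<Longrightarrow> h \<in> poly_funs Q d \<Longrightarrow> (\<lambda>X. f X + h X) \<in> poly_funs Q d"
| mult: "f \<in> poly_funs Q d \<Longrightarrow> h \<in> poly_funs Q d \<Longrightarrow> (\<lambda>X. f X * h X) \<in> poly_funs Q d"

definition zariski ::
  "('v, 'a) quiver \<Rightarrow> ('v \<Rightarrow> nat) \<Rightarrow> ('a \<Rightarrow> complex mat) topology"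
where
  "zariski Q d = topology_generated_by ((\<lambda>f. {X \<in> reps Q d. f X \<noteq> 0}) ` poly_funs Q d)"

definition rep_space ::
  "('v, 'a) quiver \<Rightarrow> ('v \<Rightarrow> nat) \<Rightarrow> ('a \<Rightarrow> complex mat) fspace"
where
  "rep_space Q d = \<lparr> ftop = zariski Q d,
     regular = (\<lambda>U \<phi>. \<forall>X\<in>U. \<exists>f\<in>poly_funs Q d. \<exists>h\<in>poly_funs Q d. \<exists>W.
        openin (zariski Q d) W \<and> X \<in> W \<and> W \<subseteq> U \<and> (\<forall>Y\<in>W. h Y \<noteq> 0 \<and> \<phi> Y = f Y / h Y)) \<rparr>"

definition stable_moduli ::
  "('v, 'a) quiver \<Rightarrow> ('v \<Rightarrow> int) \<Rightarrow> ('v \<Rightarrow> nat) \<Rightarrow> ('a \<Rightarrow> complex mat) set fspace"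
where
  "stable_moduli Q \<Theta> d =
     quot_fspace (sub_fspace (rep_space Q d) {X \<in> reps Q d. stable Q \<Theta> d X}) (orbit Q d)"

definition torus :: "('v, 'a) quiver \<Rightarrow> ('a \<Rightarrow> complex) set" where
  "torus Q = (\<Pi>\<^sub>E \<alpha>\<in>arcs Q. - {0})"

definition torus_act ::
  "('v, 'a) quiver \<Rightarrow> ('a \<Rightarrow> complex) \<Rightarrow> ('a \<Rightarrow> complex mat) \<Rightarrow> 'a \<Rightarrow> complex mat"
where
  "torus_act Q t X = (\<lambda>\<alpha>\<in>arcs Q. t \<alpha> \<cdot>\<^sub>m X \<alpha>)"


section \<open>Dimension vectors on covering quivers\<close>

definition compatible :: "('w \<Rightarrow> 'v) \<Rightarrow> ('w \<Rightarrow> nat) \<Rightarrow> ('v \<Rightarrow> nat) \<Rightarrow> bool" where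
  "compatible p e d \<longleftrightarrow> (\<forall>q. d q = (\<Sum>x | e x \<noteq> 0 \<and> p x = q. e x))"

text \<open>Equivalence of dimension vectors from \<open>A\<close> for a quiver with vertex set \<open>V\<close> under a set
  (in fact, a group) of translations of \<open>V\<close>, and a set of representatives.\<close>

definition dim_equiv ::
  "'w set \<Rightarrow> ('w \<Rightarrow> 'w) set \<Rightarrow> ('w \<Rightarrow> nat) set \<Rightarrow> (('w \<Rightarrow> nat) \<times> ('w \<Rightarrow> nat)) set"
where
  "dim_equiv V Tr A = {(e, e'). e \<in> A \<and> e' \<in> A \<and> (\<exists>\<tau>\<in>Tr. \<forall>x\<in>V. e' (\<tau> x) = e x)}"

definition class_reps ::
  "'w set \<Rightarrow> ('w \<Rightarrow> 'w) set \<Rightarrow> ('w \<Rightarrow> nat) set \<Rightarrow> ('w \<Rightarrow> nat) set"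
where
  "class_reps V Tr A = (\<lambda>c. SOME e. e \<in> c) ` (A // dim_equiv V Tr A)"


section \<open>Iterated universal abelian covering quivers\<close>

text \<open>
  All \<open>k\<close>-fold iterated covering quivers have to live in one type. A vertex of the \<open>k\<close>-fold one is
  \<open>(q, [z\<^sub>k, \<dots>, z\<^sub>1])\<close> with \<open>q\<close> a vertex of the original quiver and \<open>z\<^sub>i\<close> an element of the free
  abelian group on the arrows of the \<open>(i-1)\<close>-fold covering; similarly for arrows. As the
  coordinates \<open>z\<^sub>i\<close> refer to arrows of the previous covering, they are coded by a recursive
  datatype: \<open>z\<close> is represented by the graph of its (finitely supported) coefficient function.
\<close>

datatype 'a label = Label "(('a \<times> 'a label list) \<times> int) fset"

type_synonym ('x, 'a) cov = "'x \<times> 'a label list"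

definition encode :: "(('a, 'a) cov \<Rightarrow>\<^sub>0 int) \<Rightarrow> 'a label" where
  "encode z = Label (Abs_fset ((\<lambda>x. (x, Poly_Mapping.lookup z x)) ` Poly_Mapping.keys z))"

lemma inj_encode: "inj encode"
proof (rule injI)
  fix z w :: "('a, 'a) cov \<Rightarrow>\<^sub>0 int"
  let ?gr = "\<lambda>z. (\<lambda>x. (x, Poly_Mapping.lookup z x)) ` Poly_Mapping.keys (z :: ('a, 'a) cov \<Rightarrow>\<^sub>0 int)"
  assume "encode z = encode w"
  hence "Abs_fset (?gr z) = Abs_fset (?gr w)"
    by (simp add: encode_def)
  hence gr: "?gr z = ?gr w"
    by (subst (asm) Abs_fset_inject) auto
  show "z = w"
  proof (rule poly_mapping_eqI)
    fix x
    have *: "(x, c) \<in> ?gr u \<longleftrightarrow> c = Poly_Mapping.lookup u x \<and> c \<noteq> 0" for c u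
      by (auto simp: in_keys_iff)
    have "Poly_Mapping.lookup z x = Poly_Mapping.lookup w x"
      if "Poly_Mapping.lookup z x \<noteq> 0" "?gr z = ?gr w" for z w
      using that *[of "Poly_Mapping.lookup z x" z] *[of "Poly_Mapping.lookup z x" w] by simp
    from this[OF _ gr] this[OF _ gr[symmetric]]
    show "Poly_Mapping.lookup z x = Poly_Mapping.lookup w x"
      by argo
  qed
qed

definition cov_lift :: "('x, 'a) cov \<Rightarrow> (('a, 'a) cov \<Rightarrow>\<^sub>0 int) \<Rightarrow> ('x, 'a) cov" where
  "cov_lift x z = (fst x, encode z # snd x)"

definition cov_base :: "('x, 'a) cov \<Rightarrow> ('x, 'a) cov" where
  "cov_base y = (fst y, tl (snd y))"

definition cov_coord :: "('x, 'a) cov \<Rightarrow> (('a, 'a) cov \<Rightarrow>\<^sub>0 int)" where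
  "cov_coord y = the_inv encode (hd (snd y))"

lemma cov_base_lift [simp]: "cov_base (cov_lift x z) = x"
  by (simp add: cov_base_def cov_lift_def)

lemma cov_coord_lift [simp]: "cov_coord (cov_lift x z) = z"
  by (simp add: cov_coord_def cov_lift_def the_inv_f_f inj_encode)

definition abelian_cover ::
  "(('v, 'a) cov, ('a, 'a) cov) quiver \<Rightarrow> (('v, 'a) cov, ('a, 'a) cov) quiver"
where
  "abelian_cover Q =
     \<lparr> verts = {cov_lift q z | q z. q \<in> verts Q \<and> z \<in> carrier (free_Abelian_group (arcs Q))},
       arcs = {cov_lift \<alpha> z | \<alpha> z. \<alpha> \<in> arcs Q \<and> z \<in> carrier (free_Abelian_group (arcs Q))},
       tail = (\<lambda>\<beta>. cov_lift (tail Q (cov_base \<beta>)) (cov_coord \<beta>)),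
       head = (\<lambda>\<beta>. cov_lift (head Q (cov_base \<beta>))
                 (cov_coord \<beta> + Poly_Mapping.single (cov_base \<beta>) 1)) \<rparr>"

primrec iterated_cover :: "('v, 'a) quiver \<Rightarrow> nat \<Rightarrow> (('v, 'a) cov, ('a, 'a) cov) quiver" where
  "iterated_cover Q 0 =
     \<lparr> verts = verts Q \<times> {[]}, arcs = arcs Q \<times> {[]},
       tail = (\<lambda>\<alpha>. (tail Q (fst \<alpha>), [])), head = (\<lambda>\<alpha>. (head Q (fst \<alpha>), [])) \<rparr>"
| "iterated_cover Q (Suc k) = abelian_cover (iterated_cover Q k)"

definition cov_translations ::
  "('v, 'a) quiver \<Rightarrow> nat \<Rightarrow> (('v, 'a) cov \<Rightarrow> ('v, 'a) cov) set"
where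
  "cov_translations Q k =
     {\<lambda>y. cov_lift (cov_base y) (w + cov_coord y) | w.
        w \<in> carrier (free_Abelian_group (arcs (iterated_cover Q k)))}"

text \<open>Representatives of the dimension vectors of the \<open>k\<close>-fold covering which are successively
  compatible with \<open>d\<close>, modulo translation in each step.\<close>

primrec iterated_dims :: "('v, 'a) quiver \<Rightarrow> ('v \<Rightarrow> nat) \<Rightarrow> nat \<Rightarrow> (('v, 'a) cov \<Rightarrow> nat) set" where
  "iterated_dims Q d 0 = {\<lambda>x. if snd x = [] then d (fst x) else 0}"
| "iterated_dims Q d (Suc k) =
     class_reps (verts (iterated_cover Q (Suc k))) (cov_translations Q k)
       {e \<in> dim_vectors (iterated_cover Q (Suc k)).
          \<exists>e'\<in>iterated_dims Q d k. compatible cov_base e e'}"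

definition cover_moduli ::
  "('v, 'a) quiver \<Rightarrow> ('v \<Rightarrow> int) \<Rightarrow> ('v \<Rightarrow> nat) \<Rightarrow> nat \<Rightarrow>
     ((('v, 'a) cov \<Rightarrow> nat) \<times> (('a, 'a) cov \<Rightarrow> complex mat) set) fspace"
where
  "cover_moduli Q \<Theta> d k =
     sum_fspace (stable_moduli (iterated_cover Q k) (\<Theta> \<circ> fst)) (iterated_dims Q d k)"

text \<open>
  The \<open>n\<close>-fold iterated fixed point space. As the localization theorem identifies the \<open>k\<close>-fold
  iterated fixed point space with \<open>cover_moduli Q \<Theta> d k\<close>, and the action of the next torus is
  defined through this identification, the \<open>(k+1)\<close>-fold one consists of the fixed points of the
  torus of the \<open>k\<close>-fold covering on \<open>cover_moduli Q \<Theta> d k\<close>.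
\<close>

primrec iterated_fixed ::
  "('v, 'a) quiver \<Rightarrow> ('v \<Rightarrow> int) \<Rightarrow> ('v \<Rightarrow> nat) \<Rightarrow> nat \<Rightarrow>
     ((('v, 'a) cov \<Rightarrow> nat) \<times> (('a, 'a) cov \<Rightarrow> complex mat) set) fspace"
where
  "iterated_fixed Q \<Theta> d 0 = cover_moduli Q \<Theta> d 0"
| "iterated_fixed Q \<Theta> d (Suc k) =
     sub_fspace (cover_moduli Q \<Theta> d k)
       {(e, m) \<in> topspace (ftop (cover_moduli Q \<Theta> d k)).
          \<forall>t\<in>torus (iterated_cover Q k). torus_act (iterated_cover Q k) t ` m = m}"


section \<open>The universal covering quiver\<close>

text \<open>A letter \<open>(\<alpha>, True)\<close> stands for the arrow \<open>\<alpha>\<close>, and \<open>(\<alpha>, False)\<close> for its formal inverse.\<close>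

type_synonym 'a word = "('a \<times> bool) list"

inductive cancels :: "'a word \<Rightarrow> 'a word \<Rightarrow> bool" where
  "cancels (u @ [(\<alpha>, s), (\<alpha>, \<not> s)] @ v) (u @ v)"

definition word_class :: "'a set \<Rightarrow> 'a word \<Rightarrow> 'a word set" where
  "word_class A w = {w' \<in> lists (A \<times> UNIV). equivclp cancels w w'}"

definition word_group :: "'a set \<Rightarrow> 'a word set monoid" where
  "word_group A = \<lparr> carrier = word_class A ` lists (A \<times> UNIV),
     monoid.mult = (\<lambda>c c'. \<Union>u\<in>c. \<Union>v\<in>c'. word_class A (u @ v)),
     one = word_class A [] \<rparr>"

definition universal_cover ::
  "('v, 'a) quiver \<Rightarrow> ('v \<times> 'a word set, 'a \<times> 'a word set) quiver"
where
  "universal_cover Q =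
     \<lparr> verts = verts Q \<times> carrier (word_group (arcs Q)),
       arcs = arcs Q \<times> carrier (word_group (arcs Q)),
       tail = (\<lambda>(\<alpha>, w). (tail Q \<alpha>, w)),
       head = (\<lambda>(\<alpha>, w). (head Q \<alpha>, w \<otimes>\<^bsub>word_group (arcs Q)\<^esub> word_class (arcs Q) [(\<alpha>, True)])) \<rparr>"

definition universal_translations ::
  "('v, 'a) quiver \<Rightarrow> ('v \<times> 'a word set \<Rightarrow> 'v \<times> 'a word set) set"
where
  "universal_translations Q =
     {\<lambda>(q, w). (q, v \<otimes>\<^bsub>word_group (arcs Q)\<^esub> w) | v. v \<in> carrier (word_group (arcs Q))}"

definition universal_dims ::
  "('v, 'a) quiver \<Rightarrow> ('v \<Rightarrow> nat) \<Rightarrow> ('v \<times> 'a word set \<Rightarrow> nat) set"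
where
  "universal_dims Q d =
     class_reps (verts (universal_cover Q)) (universal_translations Q)
       {e \<in> dim_vectors (universal_cover Q). compatible fst e d}"

definition universal_moduli ::
  "('v, 'a) quiver \<Rightarrow> ('v \<Rightarrow> int) \<Rightarrow> ('v \<Rightarrow> nat) \<Rightarrow>
     (('v \<times> 'a word set \<Rightarrow> nat) \<times> ('a \<times> 'a word set \<Rightarrow> complex mat) set) fspace"
where
  "universal_moduli Q \<Theta> d =
     sum_fspace (stable_moduli (universal_cover Q) (\<Theta> \<circ> fst)) (universal_dims Q d)"

end

theory Submission
  imports Defs
begin

text \<open>
  A representation of a covering quiver lives on the support of its dimension vector, and a stable
  representation has connected support: otherwise it would be a direct sum, and the two summands
  cannot both have smaller slope than the sum. The theorem holds because, from some level on, all
  these supports are trees.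

  Passing from one covering to the next, the support of a compatible dimension vector maps onto the
  previous support. Either this map is not injective, and the number of vertices grows; or it is
  injective, and then, as a closed walk upstairs uses every arrow below as often forwards as
  backwards, it has to backtrack, so that the new support has no cycles. Cycles never reappear, since a
  covering map sends reduced walks to reduced walks, and the number of vertices is at most the total
  dimension of \<open>d\<close>. Hence at every level above the total dimension all supports are forests (lemma \<open>support_forest\<close>).

  On a tree there are potentials with values in any group and prescribed change along each arrow
  (lemma \<open>forest_potential\<close>), and this is used three times. Multiplicative potentials turn the torus action
  into a base change, so that every point is fixed (\<open>torus_act_fixes_orbit\<close>). Potentials with values
  in the free abelian groups lift a tree from the universal covering quiver to the iterated coverings
  (\<open>universal_to_iterated\<close>), and potentials with values in the free group lift a tree from an iterated
  covering to the universal one (\<open>iterated_to_universal\<close>). Lifts are unique up to translation; since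
  the free abelian groups are torsion-free, the representatives chosen at successive levels determine
  the lift completely (\<open>iterated_lift_unique\<close>, \<open>universal_dims_unique\<close>). So the dimension vectors with
  stable representations on both sides correspond bijectively, with isomorphic supports, and the
  moduli space depends only on the support (\<open>support_iso_moduli\<close>).

  All coverings are compared through the ternary relation \<open>arrow_rel\<close> recording which vertices are
  joined by an arrow over a given arrow of \<open>Q\<close>. Walks then become words in the arrows of \<open>Q\<close> and their
  inverses; a covering map leaves the word of a walk unchanged.
\<close>

section \<open>Words, paths and forests\<close>

abbreviation inv_letter :: "'a \<times> bool \<Rightarrow> 'a \<times> bool" where
  "inv_letter l \<equiv> (fst l, \<not> snd l)"

definition inv_word :: "'a word \<Rightarrow> 'a word" where
  "inv_word w = rev (map inv_letter w)"

definition reduced :: "'a word \<Rightarrow> bool" where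
  "reduced w \<longleftrightarrow> (\<nexists>w'. cancels w w')"

lemma cancels_length: "cancels w w' \<Longrightarrow> length w = length w' + 2"
  by (induction rule: cancels.induct) simp

lemma cancels_append: "cancels u u' \<Longrightarrow> cancels (p @ u @ s) (p @ u' @ s)"
  by (induction rule: cancels.induct)
    (metis append.assoc cancels.intros append_Cons append_Nil)

lemma reduced_subword: "reduced (p @ u @ s) \<Longrightarrow> reduced u"
  unfolding reduced_def using cancels_append by blast

lemma reduced_Nil [simp]: "reduced []"
  unfolding reduced_def by (auto dest: cancels_length)

lemma not_reduced_backtrack: "\<not> reduced (u @ [l, inv_letter l] @ v)"
  unfolding reduced_def using cancels.intros[of u "fst l" "snd l" v] by auto

text \<open>
  Graphs are ternary relations whose middle argument is the label of an edge. For a covering of a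
  quiver, labelled by the arrows of the base, unique lifting of arrows says that the target of an
  edge is determined by source and label, and conversely.
\<close>

primrec step :: "('x \<Rightarrow> 'a \<Rightarrow> 'x \<Rightarrow> bool) \<Rightarrow> 'x \<Rightarrow> 'a \<times> bool \<Rightarrow> 'x \<Rightarrow> bool" where
  "step E x (a, s) y = (if s then E x a y else E y a x)"

primrec path :: "('x \<Rightarrow> 'a \<Rightarrow> 'x \<Rightarrow> bool) \<Rightarrow> 'x \<Rightarrow> 'a word \<Rightarrow> 'x \<Rightarrow> bool" where
  "path E x [] y \<longleftrightarrow> x = y"
| "path E x (l # w) y \<longleftrightarrow> (\<exists>z. step E x l z \<and> path E z w y)"

definition restrict_to :: "'x set \<Rightarrow> ('x \<Rightarrow> 'a \<Rightarrow> 'x \<Rightarrow> bool) \<Rightarrow> 'x \<Rightarrow> 'a \<Rightarrow> 'x \<Rightarrow> bool" where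
  "restrict_to S E x a y \<longleftrightarrow> x \<in> S \<and> y \<in> S \<and> E x a y"

definition connected_on :: "'x set \<Rightarrow> ('x \<Rightarrow> 'a \<Rightarrow> 'x \<Rightarrow> bool) \<Rightarrow> bool" where
  "connected_on S E \<longleftrightarrow> (\<forall>x\<in>S. \<forall>y\<in>S. \<exists>w. path (restrict_to S E) x w y)"

definition deterministic :: "('x \<Rightarrow> 'a \<Rightarrow> 'x \<Rightarrow> bool) \<Rightarrow> bool" where
  "deterministic E \<longleftrightarrow> (\<forall>x a y y'. E x a y \<and> E x a y' \<longrightarrow> y = y') \<and>
                       (\<forall>x x' a y. E x a y \<and> E x' a y \<longrightarrow> x = x')"

text \<open>
  A cycle is a nonempty closed walk without backtracking. Backtracking is a property of the word
  alone, by unique lifting, which is what makes the notion compatible with label-preserving maps.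
\<close>

definition is_forest :: "('x \<Rightarrow> 'a \<Rightarrow> 'x \<Rightarrow> bool) \<Rightarrow> bool" where
  "is_forest E \<longleftrightarrow> (\<forall>x w. reduced w \<and> path E x w x \<longrightarrow> w = [])"

lemma path_append: "path E x (u @ v) y \<longleftrightarrow> (\<exists>z. path E x u z \<and> path E z v y)"
  by (induction u arbitrary: x) auto

lemma step_inv: "step E x l y \<longleftrightarrow> step E y (inv_letter l) x"
  by (cases l) auto

lemma path_inv: "path E x w y \<Longrightarrow> path E y (inv_word w) x"
proof (induction w arbitrary: x)
  case (Cons l w)
  then obtain z where "step E x l z" "path E z w y" by auto
  with Cons.IH[of z] show ?case
    using step_inv[of E x l z] by (auto simp: inv_word_def path_append)
qed (simp add: inv_word_def)

lemma step_map:
  assumes "\<And>x a y. E x a y \<Longrightarrow> E' (f x) a (f y)" "step E x l y"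
  shows "step E' (f x) l (f y)"
  using assms by (cases l) (auto split: if_splits)

lemma path_map:
  assumes "\<And>x a y. E x a y \<Longrightarrow> E' (f x) a (f y)" "path E x w y"
  shows "path E' (f x) w (f y)"
  using assms(2) step_map[of E E' f] assms(1)
  by (induction w arbitrary: x) (fastforce)+

lemma forest_map:
  assumes "\<And>x a y. E x a y \<Longrightarrow> E' (f x) a (f y)" "is_forest E'"
  shows "is_forest E"
  using assms path_map[of E E' f] unfolding is_forest_def by blast

lemma forest_restrict: "is_forest E \<Longrightarrow> is_forest (restrict_to S E)"
  by (rule forest_map[where f = id and E' = E]) (auto simp: restrict_to_def)

lemma deterministicD:
  assumes "deterministic E" "step E x l y" "step E x l y'"
  shows "y = y'"
  using assms unfolding deterministic_def by (cases l; cases "snd l") (simp; blast)+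

lemma deterministic_restrict: "deterministic E \<Longrightarrow> deterministic (restrict_to S E)"
  unfolding deterministic_def restrict_to_def by blast

text \<open>
  A walk along a letter and its inverse returns to its starting point, as both steps are unique.
\<close>

lemma path_cancels:
  assumes "deterministic E" "cancels w w'" "path E x w y"
  shows "path E x w' y"
  using assms(2,3)
proof (induction rule: cancels.induct)
  case (1 u a s v)
  then obtain z z1 z2 where z: "path E x u z" "step E z (a, s) z1" "step E z1 (a, \<not> s) z2"
    "path E z2 v y"
    by (auto simp: path_append)
  have "step E z1 (a, \<not> s) z" using z(2) step_inv[of E z "(a,s)" z1] by simp
  hence "z2 = z" using z(3) deterministicD[OF assms(1)] by blast
  with z show ?case by (auto simp: path_append)
qed

lemma path_reduced:
  assumes "deterministic E" "path E x w y"
  shows "\<exists>w'. reduced w' \<and> path E x w' y"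
  using assms(2)
proof (induction w rule: length_induct)
  case (1 w)
  show ?case
  proof (cases "reduced w")
    case False
    then obtain w' where w': "cancels w w'" unfolding reduced_def by blast
    have "path E x w' y" by (rule path_cancels[OF assms(1) w' 1(2)])
    thus ?thesis using 1(1)[rule_format, of w'] cancels_length[OF w'] by simp
  qed (use 1 in blast)
qed

text \<open>
  Two vertices with the same image are joined by a reduced walk, whose image is a closed reduced walk
  with the same word.
\<close>

lemma forest_hom_inj:
  assumes det: "deterministic E" and con: "connected_on S E"
    and hom: "\<And>x a y. restrict_to S E x a y \<Longrightarrow> E' (f x) a (f y)" and for': "is_forest E'"
  shows "inj_on f S"
proof (rule inj_onI)
  fix x y assume xy: "x \<in> S" "y \<in> S" "f x = f y"
  then obtain w where "path (restrict_to S E) x w y" using con unfolding connected_on_def by blast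
  then obtain w where w: "reduced w" "path (restrict_to S E) x w y"
    using path_reduced[OF deterministic_restrict[OF det]] by blast
  have "path E' (f x) w (f y)" using path_map[OF _ w(2), of E' f] hom by blast
  hence "w = []" using for' w(1) xy(3) unfolding is_forest_def by metis
  thus "x = y" using w(2) by simp
qed

text \<open>
  If the images of two vertices are joined by an edge, closing up the image of a reduced walk between
  them with this edge must produce a backtrack, and the only possible place is at the end. Together
  with \<open>forest_hom_inj\<close>: a connected graph mapping to a forest is a full subgraph of it.
\<close>

lemma forest_hom_full:
  assumes det: "deterministic E" and con: "connected_on S E"
    and hom: "\<And>x a y. restrict_to S E x a y \<Longrightarrow> E' (f x) a (f y)"
    and det': "deterministic E'" and for': "is_forest E'"
    and xy: "x \<in> S" "y \<in> S" and E': "E' (f x) a (f y)"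
  shows "E x a y"
proof -
  obtain w where "path (restrict_to S E) x w y"
    using con xy unfolding connected_on_def by blast
  then obtain w where w: "reduced w" "path (restrict_to S E) x w y"
    using path_reduced[OF deterministic_restrict[OF det]] by blast
  have p: "path E' (f x) w (f y)" using path_map[OF _ w(2), of E' f] hom by blast
  have "path E' (f x) (w @ [(a, False)]) (f x)" using p E' by (auto simp: path_append)
  hence "\<not> reduced (w @ [(a, False)])" using for' unfolding is_forest_def by blast
  then obtain u b s v where uv: "w @ [(a, False)] = u @ [(b, s), (b, \<not> s)] @ v"
    unfolding reduced_def by (auto elim!: cancels.cases)
  have "v = []"
  proof (rule ccontr)
    assume "v \<noteq> []"
    then obtain v' l where "v = v' @ [l]" by (cases v rule: rev_cases) auto
    with uv have "w = u @ [(b, s), (b, \<not> s)] @ v'" by simp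
    with w(1) show False using not_reduced_backtrack[of u "(b,s)" v'] by simp
  qed
  with uv have w_eq: "w = u @ [(a, True)]" by auto
  with p obtain z where z: "path E' (f x) u z" "E' z a (f y)" by (auto simp: path_append)
  hence "z = f x" using E' det' unfolding deterministic_def by blast
  moreover have "reduced u" using w(1) w_eq reduced_subword[of "[]" u] by simp
  ultimately have "u = []" using z(1) for' unfolding is_forest_def by metis
  with w(2) w_eq show ?thesis by (auto simp: restrict_to_def)
qed

text \<open>
  In the intended use \<open>E'\<close> is a covering of the forest \<open>E\<close> with fibre a set of values. Closed walks in
  a forest reduce to the trivial walk, and each cancellation is also possible in \<open>E'\<close>.
\<close>

lemma forest_transport_unique:
  assumes fE: "is_forest E"
    and detE': "deterministic E'" and hom: "\<And>p a q. E' p a q \<Longrightarrow> E (fst p) a (fst q)"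
  shows "path E' (x, h) w (x, h') \<Longrightarrow> h = h'"
proof (induction w rule: length_induct)
  case (1 w)
  show ?case
  proof (cases "w = []")
    case False
    have "path E x w x" using path_map[of E' E fst, OF hom 1(2)] by simp
    with fE False have "\<not> reduced w" unfolding is_forest_def by blast
    then obtain w' where w': "cancels w w'" unfolding reduced_def by blast
    have "path E' (x, h) w' (x, h')" by (rule path_cancels[OF detE' w' 1(2)])
    thus ?thesis using 1(1)[rule_format, of w'] cancels_length[OF w'] by simp
  qed (use 1 in auto)
qed

text \<open>
  A function on the vertices of a connected forest whose values change by a prescribed permutation
  along each edge. It is built by transporting one value along walks from a base vertex, that is, by
  lifting these walks to the covering with fibre \<open>H\<close> defined by the permutations.
\<close>

lemma forest_potential:
  fixes E :: "'x \<Rightarrow> 'a \<Rightarrow> 'x \<Rightarrow> bool" and T :: "'x \<Rightarrow> 'a \<Rightarrow> 'x \<Rightarrow> 'h \<Rightarrow> 'h"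
  assumes det: "deterministic E" and con: "connected_on S E" and "is_forest (restrict_to S E)"
    and bij: "\<And>x a y. restrict_to S E x a y \<Longrightarrow> bij_betw (T x a y) H H"
    and H: "h0 \<in> H"
  shows "\<exists>c. (\<forall>x. c x \<in> H) \<and> (\<forall>x a y. restrict_to S E x a y \<longrightarrow> c y = T x a y (c x))"
proof (cases "S = {}")
  case True
  with H show ?thesis by (intro exI[of _ "\<lambda>_. h0"]) (auto simp: restrict_to_def)
next
  case False
  then obtain x0 where x0: "x0 \<in> S" by blast
  let ?E = "restrict_to S E"
  define E' where "E' = (\<lambda>p a q. ?E (fst p) a (fst q) \<and> snd p \<in> H \<and> snd q \<in> H \<and>
                           snd q = T (fst p) a (fst q) (snd p))"
  have detE': "deterministic E'"
    unfolding deterministic_def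
  proof (intro conjI allI impI)
    fix x a y y' assume "E' x a y \<and> E' x a y'"
    moreover from this have "fst y = fst y'"
      using deterministic_restrict[OF det, of S] unfolding E'_def deterministic_def by blast
    ultimately show "y = y'" by (auto simp: E'_def prod_eq_iff)
  next
    fix x x' a y assume *: "E' x a y \<and> E' x' a y"
    moreover from this have "fst x = fst x'"
      using deterministic_restrict[OF det, of S] unfolding E'_def deterministic_def by blast
    moreover have "inj_on (T (fst x) a (fst y)) H" using * bij unfolding E'_def bij_betw_def by blast
    ultimately show "x = x'" by (auto simp: E'_def prod_eq_iff inj_on_def)
  qed
  have lift1: "\<exists>h'\<in>H. step E' (x, h) l (y, h')" if "step ?E x l y" "h \<in> H" for x l y h
  proof (cases l)
    case (Pair a s)
    show ?thesis
    proof (cases s)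
      case True
      with that Pair bij[of x a y] show ?thesis by (auto simp: E'_def bij_betw_def)
    next
      case False
      with that Pair have *: "?E y a x" by simp
      with bij[OF *] that(2) obtain h' where "h' \<in> H" "h = T y a x h'"
        unfolding bij_betw_def by blast
      with * that False Pair show ?thesis by (auto simp: E'_def)
    qed
  qed
  have lift: "\<exists>h'\<in>H. path E' (x, h) w (y, h')" if "path ?E x w y" "h \<in> H" for x w y h
    using that
  proof (induction w arbitrary: x h)
    case (Cons l w)
    then obtain z where z: "step ?E x l z" "path ?E z w y" by auto
    then obtain h1 where "h1 \<in> H" "step E' (x, h) l (z, h1)" using lift1 Cons.prems by blast
    with Cons.IH[OF z(2)] show ?case by fastforce
  qed auto
  have uniq: "h = h'" if "path E' (x0, h0) w (x, h)" "path E' (x0, h0) w' (x, h')" for w w' x h h'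
  proof -
    have "path E' (x, h) (inv_word w @ w') (x, h')"
      using path_inv[OF that(1)] that(2) by (auto simp: path_append)
    thus ?thesis
      using forest_transport_unique[OF assms(3) detE'] unfolding E'_def by blast
  qed
  define c where "c = (\<lambda>x. if x \<in> S then THE h. h \<in> H \<and> (\<exists>w. path E' (x0, h0) w (x, h)) else h0)"
  have ex: "\<exists>h. h \<in> H \<and> (\<exists>w. path E' (x0, h0) w (x, h))" if "x \<in> S" for x
    using con x0 that H lift unfolding connected_on_def by meson
  have c: "c x \<in> H \<and> (\<exists>w. path E' (x0, h0) w (x, c x))" if "x \<in> S" for x
  proof -
    have "\<exists>!h. h \<in> H \<and> (\<exists>w. path E' (x0, h0) w (x, h))" using ex[OF that] uniq by blast
    from theI'[OF this] show ?thesis using that by (simp add: c_def)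
  qed
  show ?thesis
  proof (intro exI[of _ c] conjI allI impI)
    show "c x \<in> H" for x using c[of x] H by (cases "x \<in> S") (auto simp: c_def)
  next
    fix x a y assume E: "?E x a y"
    hence xy: "x \<in> S" "y \<in> S" by (auto simp: restrict_to_def)
    obtain w w' where w: "path E' (x0, h0) w (x, c x)" "path E' (x0, h0) w' (y, c y)"
      using c xy by blast
    have "T x a y (c x) \<in> H" using bij[OF E] c[OF xy(1)] unfolding bij_betw_def by blast
    hence "path E' (x0, h0) (w @ [(a, True)]) (y, T x a y (c x))"
      using w(1) E c[OF xy(1)] by (auto simp: path_append E'_def)
    from uniq[OF w(2) this] show "c y = T x a y (c x)" .
  qed
qed

text \<open>
  The coefficient of a coordinate changes only where the walk uses the corresponding edge. So it can
  only move against the sign of a direction in which that edge is never traversed.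
\<close>

lemma path_coefficient:
  fixes c :: "'x \<Rightarrow> ('e \<Rightarrow>\<^sub>0 int)"
  assumes E: "\<And>x a y. E x a y \<Longrightarrow> c y = c x + Poly_Mapping.single (\<eta> x a) 1"
  shows "path E x w y \<Longrightarrow>
     (\<exists>w1 a w2 p q. w = w1 @ (a, s) # w2 \<and> path E x w1 p \<and> step E p (a, s) q \<and> path E q w2 y \<and>
         \<eta> (if s then p else q) a = i) \<or>
     (if s then Poly_Mapping.lookup (c y) i \<le> Poly_Mapping.lookup (c x) i
      else Poly_Mapping.lookup (c y) i \<ge> Poly_Mapping.lookup (c x) i)"
proof (induction w arbitrary: x)
  case (Cons l w)
  then obtain z where z: "step E x l z" "path E z w y" by auto
  obtain a t where l: "l = (a, t)" by (cases l)
  from Cons.IH[OF z(2)] show ?case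
  proof (elim disjE exE conjE)
    fix w1 b w2 p q
    assume "w = w1 @ (b, s) # w2" "path E z w1 p" "step E p (b, s) q" "path E q w2 y"
      "\<eta> (if s then p else q) b = i"
    with z(1) show ?thesis
      by (intro disjI1 exI[of _ "l # w1"] exI[of _ b] exI[of _ w2] exI[of _ p] exI[of _ q]) auto
  next
    assume *: "if s then Poly_Mapping.lookup (c y) i \<le> Poly_Mapping.lookup (c z) i
      else Poly_Mapping.lookup (c y) i \<ge> Poly_Mapping.lookup (c z) i"
    show ?thesis
    proof (cases "t = s \<and> \<eta> (if s then x else z) a = i")
      case True
      with z l show ?thesis
        by (intro disjI1 exI[of _ "[]"] exI[of _ a] exI[of _ w] exI[of _ x] exI[of _ z]) auto
    next
      case False
      have "if s then Poly_Mapping.lookup (c z) i \<le> Poly_Mapping.lookup (c x) i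
        else Poly_Mapping.lookup (c z) i \<ge> Poly_Mapping.lookup (c x) i"
      proof (cases t)
        case True
        hence "c z = c x + Poly_Mapping.single (\<eta> x a) 1" using E[of x a z] z(1) l by simp
        thus ?thesis using False True by (auto simp: lookup_add lookup_single when_def)
      next
        case nt: False
        hence "c x = c z + Poly_Mapping.single (\<eta> z a) 1" using E[of z a x] z(1) l by simp
        hence "Poly_Mapping.lookup (c x) i =
          Poly_Mapping.lookup (c z) i + Poly_Mapping.lookup (Poly_Mapping.single (\<eta> z a) 1) i"
          by (simp add: lookup_add)
        thus ?thesis using False nt by (auto simp: lookup_single when_def split: if_splits)
      qed
      with * show ?thesis by (auto split: if_splits)
    qed
  qed
qed auto

text \<open>
  The mechanism by which the universal abelian covering unwraps cycles. A closed walk has net change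
  zero in every coordinate, so the first edge of the walk is traversed again, in the opposite
  direction. The part of the walk strictly between the two traversals is closed and shorter, hence
  empty by induction, and the two traversals form a backtrack.
\<close>

lemma forest_if_abelian_coordinates:
  fixes c :: "'x \<Rightarrow> ('e \<Rightarrow>\<^sub>0 int)"
  assumes det: "deterministic E"
    and E: "\<And>x a y. E x a y \<Longrightarrow> c y = c x + Poly_Mapping.single (\<eta> x a) 1"
    and inj: "\<And>x a y x' a' y'. E x a y \<Longrightarrow> E x' a' y' \<Longrightarrow> \<eta> x a = \<eta> x' a' \<Longrightarrow> x = x' \<and> a = a'"
  shows "is_forest E"
proof -
  have "w = []" if "reduced w" "path E x w x" for x w
    using that
  proof (induction w arbitrary: x rule: length_induct)
    case (1 w)
    show ?case
    proof (rule ccontr)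
      assume "w \<noteq> []"
      then obtain a t v where w: "w = (a, t) # v" by (cases w) auto
      with 1 obtain z where z: "step E x (a, t) z" "path E z v x" by auto
      define i where "i = \<eta> (if t then x else z) a"
      have "c z = c x + Poly_Mapping.single i 1" if t
        using E[of x a z] z(1) that by (simp add: i_def)
      moreover have "c x = c z + Poly_Mapping.single i 1" if "\<not> t"
        using E[of z a x] z(1) that by (simp add: i_def)
      ultimately have "\<not> (if \<not> t then Poly_Mapping.lookup (c x) i \<le> Poly_Mapping.lookup (c z) i
        else Poly_Mapping.lookup (c x) i \<ge> Poly_Mapping.lookup (c z) i)"
        by (cases t) (auto simp: lookup_add)
      with path_coefficient[of E c \<eta> z v x "\<not> t" i, OF E z(2)]
      obtain w1 b w2 p q where v: "v = w1 @ (b, \<not> t) # w2" "path E z w1 p" "step E p (b, \<not> t) q"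
        "path E q w2 x" "\<eta> (if \<not> t then p else q) b = i"
        by (auto split: if_splits)
      have "b = a \<and> p = z"
      proof (cases t)
        case True
        with v z have "E q b p" "E x a z" by auto
        moreover from this have "q = x \<and> b = a"
          using inj[of q b p x a z] v(5) True by (simp add: i_def)
        ultimately show ?thesis using det unfolding deterministic_def by blast
      next
        case False
        with v z have "E p b q" "E z a x" by auto
        with inj[of p b q z a x] v(5) False show ?thesis by (simp add: i_def)
      qed
      hence *: "b = a" "p = z" by auto
      have "w1 = []"
        using 1(1)[rule_format, of w1 z] v(1,2) * w 1(2) reduced_subword[of "[(a,t)]" w1 "(b, \<not> t) # w2"]
        by simp
      with v(1) w * have "w = [] @ [(a, t), inv_letter (a, t)] @ w2" by simp
      with 1(2) not_reduced_backtrack show False by metis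
    qed
  qed
  thus ?thesis unfolding is_forest_def by blast
qed

section \<open>Morphisms of spaces with functions\<close>

abbreviation points :: "'p fspace \<Rightarrow> 'p set" where
  "points X \<equiv> topspace (ftop X)"

abbreviation fopen :: "'p fspace \<Rightarrow> 'p set \<Rightarrow> bool" where
  "fopen X \<equiv> openin (ftop X)"

text \<open>
  Isomorphisms of spaces with functions are assembled from pairs of mutually inverse morphisms, as
  morphisms pass to subspaces, quotients and sums.
\<close>

definition fspace_hom :: "'p fspace \<Rightarrow> 'r fspace \<Rightarrow> ('p \<Rightarrow> 'r) \<Rightarrow> bool" where
  "fspace_hom X Y \<phi> \<longleftrightarrow> continuous_map (ftop X) (ftop Y) \<phi> \<and>
     (\<forall>V f. fopen Y V \<and> regular Y V f \<longrightarrow>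
        regular X {x \<in> points X. \<phi> x \<in> V} (f \<circ> \<phi>))"

text \<open>
  The sheaf property of the regular functions: they depend only on the values on the given open set,
  can be restricted, and can be glued. It makes the structure induced on the whole space agree with the original
  one.
\<close>

definition fsheaf :: "'p fspace \<Rightarrow> bool" where
  "fsheaf X \<longleftrightarrow>
     (\<forall>U f f'. fopen X U \<and> regular X U f \<and> (\<forall>x\<in>U. f x = f' x) \<longrightarrow> regular X U f') \<and>
     (\<forall>U W f. fopen X U \<and> fopen X W \<and> W \<subseteq> U \<and> regular X U f \<longrightarrow> regular X W f) \<and>
     (\<forall>U f. fopen X U \<and> (\<forall>x\<in>U. \<exists>W. fopen X W \<and> x \<in> W \<and> W \<subseteq> U \<and> regular X W f) \<longrightarrow>
        regular X U f)"

lemma fsheaf_cong: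
  assumes "fsheaf X" "fopen X U" "regular X U f" "\<And>x. x \<in> U \<Longrightarrow> f x = f' x"
  shows "regular X U f'"
  using assms(1)[unfolded fsheaf_def, THEN conjunct1, rule_format, of U f f'] assms(2-) by simp

lemma fsheaf_restrict:
  assumes "fsheaf X" "fopen X U" "fopen X W" "W \<subseteq> U" "regular X U f"
  shows "regular X W f"
  using assms(1)[unfolded fsheaf_def, THEN conjunct2, THEN conjunct1, rule_format, of U W f] assms(2-)
  by simp

lemma fsheaf_glue:
  assumes "fsheaf X" "fopen X U"
    "\<And>x. x \<in> U \<Longrightarrow> \<exists>W. fopen X W \<and> x \<in> W \<and> W \<subseteq> U \<and> regular X W f"
  shows "regular X U f"
  using assms(1)[unfolded fsheaf_def, THEN conjunct2, THEN conjunct2, rule_format, of U f] assms(2-)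
  by simp

lemma fsheaf_empty: "fsheaf X \<Longrightarrow> regular X {} f"
  by (rule fsheaf_glue) auto

lemma fspace_homD:
  assumes "fspace_hom X Y \<phi>"
  shows "x \<in> points X \<Longrightarrow> \<phi> x \<in> points Y"
    and "fopen Y V \<Longrightarrow> fopen X {x \<in> points X. \<phi> x \<in> V}"
    and "fopen Y V \<Longrightarrow> regular Y V f \<Longrightarrow> regular X {x \<in> points X. \<phi> x \<in> V} (f \<circ> \<phi>)"
  using assms unfolding fspace_hom_def continuous_map_def by (auto simp: Pi_iff)

lemma fspace_homI:
  assumes "\<And>x. x \<in> points X \<Longrightarrow> \<phi> x \<in> points Y"
    and "\<And>V. fopen Y V \<Longrightarrow> fopen X {x \<in> points X. \<phi> x \<in> V}"
    and "\<And>V f. fopen Y V \<Longrightarrow> regular Y V f \<Longrightarrow>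
           regular X {x \<in> points X. \<phi> x \<in> V} (f \<circ> \<phi>)"
  shows "fspace_hom X Y \<phi>"
  using assms unfolding fspace_hom_def continuous_map_def by auto

lemma fspace_hom_nonempty:
  assumes "fspace_hom X Y \<phi>" "points X \<noteq> {}"
  shows "points Y \<noteq> {}"
proof -
  obtain x where "x \<in> points X" using assms(2) by blast
  from fspace_homD(1)[OF assms(1) this] show ?thesis by blast
qed

definition inverse_homs :: "'p fspace \<Rightarrow> 'r fspace \<Rightarrow> ('p \<Rightarrow> 'r) \<Rightarrow> ('r \<Rightarrow> 'p) \<Rightarrow> bool" where
  "inverse_homs X Y \<phi> \<psi> \<longleftrightarrow> fspace_hom X Y \<phi> \<and> fspace_hom Y X \<psi> \<and>
     (\<forall>x\<in>points X. \<psi> (\<phi> x) = x) \<and> (\<forall>y\<in>points Y. \<phi> (\<psi> y) = y)"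

lemma fspace_isoI:
  assumes \<phi>: "fspace_hom X Y \<phi>" and \<psi>: "fspace_hom Y X \<psi>" and Y: "fsheaf Y"
    and inv: "\<And>x. x \<in> points X \<Longrightarrow> \<psi> (\<phi> x) = x" "\<And>y. y \<in> points Y \<Longrightarrow> \<phi> (\<psi> y) = y"
  shows "X \<cong>\<^sub>f Y"
  unfolding fspace_iso_def
proof (intro exI[of _ \<phi>] conjI allI impI iffI)
  show "homeomorphic_map (ftop X) (ftop Y) \<phi>"
    unfolding homeomorphic_map_maps homeomorphic_maps_def
    using \<phi> \<psi> inv unfolding fspace_hom_def by auto
next
  fix V f assume V: "fopen Y V"
  show "regular X {x \<in> points X. \<phi> x \<in> V} (f \<circ> \<phi>)" if "regular Y V f"
    using fspace_homD(3)[OF \<phi> V that] .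
  assume r: "regular X {x \<in> points X. \<phi> x \<in> V} (f \<circ> \<phi>)"
  have "{y \<in> points Y. \<psi> y \<in> {x \<in> points X. \<phi> x \<in> V}} = V"
    using openin_subset[OF V] inv(2) fspace_homD(1)[OF \<psi>] by auto
  with fspace_homD(3)[OF \<psi> fspace_homD(2)[OF \<phi> V] r]
  have "regular Y V (f \<circ> \<phi> \<circ> \<psi>)" by simp
  thus "regular Y V f"
    by (rule fsheaf_cong[OF Y V]) (use openin_subset[OF V] inv(2) in auto)
qed

lemma topspace_quot_topology: "topspace (quot_topology T \<pi>) = \<pi> ` topspace T"
proof
  have "{x \<in> topspace T. \<pi> x \<in> \<pi> ` topspace T} = topspace T" by auto
  hence "openin (quot_topology T \<pi>) (\<pi> ` topspace T)" by (simp add: openin_quot_topology)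
  thus "\<pi> ` topspace T \<subseteq> topspace (quot_topology T \<pi>)" by (rule openin_subset)
  show "topspace (quot_topology T \<pi>) \<subseteq> \<pi> ` topspace T"
    unfolding topspace_def[of "quot_topology T \<pi>"] by (auto simp: openin_quot_topology)
qed

lemma regular_sub_fspace:
  "regular (sub_fspace X S) U f \<longleftrightarrow>
     (\<forall>x\<in>U. \<exists>W F. fopen X W \<and> x \<in> W \<and> regular X W F \<and> (\<forall>y\<in>W \<inter> U. f y = F y))"
  by (simp add: sub_fspace_def)

text \<open>
  Regularity on a subspace is a local condition by definition, so the sheaf property is inherited
  once functions can be restricted to smaller neighbourhoods in the ambient space.
\<close>

lemma fsheaf_sub_fspace:
  assumes "fsheaf X"
  shows "fsheaf (sub_fspace X S)"
  unfolding fsheaf_def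
proof (intro conjI allI impI)
  fix U f f'
  assume *: "fopen (sub_fspace X S) U \<and> regular (sub_fspace X S) U f \<and> (\<forall>x\<in>U. f x = f' x)"
  show "regular (sub_fspace X S) U f'"
    unfolding regular_sub_fspace
  proof
    fix x assume "x \<in> U"
    with * obtain W F where "fopen X W" "x \<in> W" "regular X W F" "\<forall>y\<in>W \<inter> U. f y = F y"
      unfolding regular_sub_fspace by metis
    with * show "\<exists>W F. fopen X W \<and> x \<in> W \<and> regular X W F \<and> (\<forall>y\<in>W \<inter> U. f' y = F y)"
      by (intro exI[of _ W] exI[of _ F]) auto
  qed
next
  fix U W f
  assume *: "fopen (sub_fspace X S) U \<and> fopen (sub_fspace X S) W \<and> W \<subseteq> U \<and>
      regular (sub_fspace X S) U f"
  show "regular (sub_fspace X S) W f"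
    unfolding regular_sub_fspace
  proof
    fix x assume "x \<in> W"
    with * obtain N F where "fopen X N" "x \<in> N" "regular X N F" "\<forall>y\<in>N \<inter> U. f y = F y"
      unfolding regular_sub_fspace by (metis subsetD)
    with * show "\<exists>N F. fopen X N \<and> x \<in> N \<and> regular X N F \<and> (\<forall>y\<in>N \<inter> W. f y = F y)"
      by (intro exI[of _ N] exI[of _ F]) auto
  qed
next
  fix U f
  assume *: "fopen (sub_fspace X S) U \<and> (\<forall>x\<in>U. \<exists>W. fopen (sub_fspace X S) W \<and>
    x \<in> W \<and> W \<subseteq> U \<and> regular (sub_fspace X S) W f)"
  show "regular (sub_fspace X S) U f"
    unfolding regular_sub_fspace
  proof
    fix x assume x: "x \<in> U"
    with * obtain W where W: "openin (subtopology (ftop X) S) W" "x \<in> W" "W \<subseteq> U"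
      "regular (sub_fspace X S) W f" by (auto simp: sub_fspace_def)
    then obtain W' where W': "fopen X W'" "W = W' \<inter> S" by (auto simp: openin_subtopology)
    from W obtain N F where N: "fopen X N" "x \<in> N" "regular X N F" "\<forall>y\<in>N \<inter> W. f y = F y"
      by (auto simp: sub_fspace_def)
    have "U \<subseteq> S" using * by (auto simp: sub_fspace_def openin_subtopology)
    hence "\<forall>y\<in>N \<inter> W' \<inter> U. f y = F y" using N(4) W'(2) by auto
    moreover have "fopen X (N \<inter> W')" using N(1) W'(1) by blast
    moreover have "regular X (N \<inter> W') F" by (rule fsheaf_restrict[OF assms N(1) _ _ N(3)])
      (use N(1) W'(1) in auto)
    ultimately show "\<exists>W F. fopen X W \<and> x \<in> W \<and> regular X W F \<and> (\<forall>y\<in>W \<inter> U. f y = F y)"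
      using N(2) W(2) W'(2) by blast
  qed
qed

lemma fsheaf_quot_fspace:
  assumes "fsheaf X"
  shows "fsheaf (quot_fspace X \<pi>)"
  unfolding fsheaf_def
proof (intro conjI allI impI)
  fix U f f'
  assume *: "fopen (quot_fspace X \<pi>) U \<and> regular (quot_fspace X \<pi>) U f \<and> (\<forall>x\<in>U. f x = f' x)"
  have "regular X {x \<in> points X. \<pi> x \<in> U} (f' \<circ> \<pi>)"
    by (rule fsheaf_cong[OF assms, of _ "f \<circ> \<pi>"])
      (use * in \<open>auto simp: quot_fspace_def openin_quot_topology\<close>)
  thus "regular (quot_fspace X \<pi>) U f'" by (simp add: quot_fspace_def)
next
  fix U W f
  assume *: "fopen (quot_fspace X \<pi>) U \<and> fopen (quot_fspace X \<pi>) W \<and> W \<subseteq> U \<and>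
    regular (quot_fspace X \<pi>) U f"
  have "regular X {x \<in> points X. \<pi> x \<in> W} (f \<circ> \<pi>)"
    by (rule fsheaf_restrict[OF assms, of "{x \<in> points X. \<pi> x \<in> U}"])
      (use * in \<open>auto simp: quot_fspace_def openin_quot_topology\<close>)
  thus "regular (quot_fspace X \<pi>) W f" by (simp add: quot_fspace_def)
next
  fix U f
  assume *: "fopen (quot_fspace X \<pi>) U \<and> (\<forall>x\<in>U. \<exists>W. fopen (quot_fspace X \<pi>) W \<and>
    x \<in> W \<and> W \<subseteq> U \<and> regular (quot_fspace X \<pi>) W f)"
  have "regular X {x \<in> points X. \<pi> x \<in> U} (f \<circ> \<pi>)"
  proof (rule fsheaf_glue[OF assms])
    show "fopen X {x \<in> points X. \<pi> x \<in> U}"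
      using * by (auto simp: quot_fspace_def openin_quot_topology)
    fix x assume x: "x \<in> {x \<in> points X. \<pi> x \<in> U}"
    with * obtain W where "fopen (quot_fspace X \<pi>) W" "\<pi> x \<in> W" "W \<subseteq> U"
      "regular (quot_fspace X \<pi>) W f" by auto
    with x show "\<exists>W. fopen X W \<and> x \<in> W \<and> W \<subseteq> {x \<in> points X. \<pi> x \<in> U} \<and>
      regular X W (f \<circ> \<pi>)"
      by (intro exI[of _ "{x \<in> points X. \<pi> x \<in> W}"])
        (auto simp: quot_fspace_def openin_quot_topology)
  qed
  thus "regular (quot_fspace X \<pi>) U f" by (simp add: quot_fspace_def)
qed

lemma fsheaf_sum_fspace:
  assumes "\<And>i. i \<in> I \<Longrightarrow> fsheaf (X i)"
  shows "fsheaf (sum_fspace X I)"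
  unfolding fsheaf_def
proof (intro conjI allI impI)
  fix U f f'
  assume *: "fopen (sum_fspace X I) U \<and> regular (sum_fspace X I) U f \<and> (\<forall>x\<in>U. f x = f' x)"
  have "regular (X i) {x. (i, x) \<in> U} (\<lambda>x. f' (i, x))" if "i \<in> I" for i
    by (rule fsheaf_cong[OF assms[OF that], of _ "\<lambda>x. f (i, x)"])
      (use * that in \<open>auto simp: sum_fspace_def openin_sum_topology\<close>)
  thus "regular (sum_fspace X I) U f'" by (simp add: sum_fspace_def)
next
  fix U W f
  assume *: "fopen (sum_fspace X I) U \<and> fopen (sum_fspace X I) W \<and> W \<subseteq> U \<and>
    regular (sum_fspace X I) U f"
  have "regular (X i) {x. (i, x) \<in> W} (\<lambda>x. f (i, x))" if "i \<in> I" for i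
    by (rule fsheaf_restrict[OF assms[OF that], of "{x. (i, x) \<in> U}"])
      (use * that in \<open>auto simp: sum_fspace_def openin_sum_topology\<close>)
  thus "regular (sum_fspace X I) W f" by (simp add: sum_fspace_def)
next
  fix U f
  assume *: "fopen (sum_fspace X I) U \<and> (\<forall>x\<in>U. \<exists>W. fopen (sum_fspace X I) W \<and>
    x \<in> W \<and> W \<subseteq> U \<and> regular (sum_fspace X I) W f)"
  have "regular (X i) {x. (i, x) \<in> U} (\<lambda>x. f (i, x))" if i: "i \<in> I" for i
  proof (rule fsheaf_glue[OF assms[OF i]])
    show "fopen (X i) {x. (i, x) \<in> U}"
      using * i by (auto simp: sum_fspace_def openin_sum_topology)
    fix x assume x: "x \<in> {x. (i, x) \<in> U}"
    with * obtain W where "fopen (sum_fspace X I) W" "(i, x) \<in> W" "W \<subseteq> U"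
      "regular (sum_fspace X I) W f" by auto
    with i show "\<exists>W. fopen (X i) W \<and> x \<in> W \<and> W \<subseteq> {x. (i, x) \<in> U} \<and>
      regular (X i) W (\<lambda>x. f (i, x))"
      by (intro exI[of _ "{x. (i, x) \<in> W}"])
        (auto simp: sum_fspace_def openin_sum_topology)
  qed
  thus "regular (sum_fspace X I) U f" by (simp add: sum_fspace_def)
qed

lemma fspace_hom_sub:
  assumes \<phi>: "fspace_hom X Y \<phi>" and ST: "\<And>x. x \<in> points X \<Longrightarrow> x \<in> S \<Longrightarrow> \<phi> x \<in> T"
  shows "fspace_hom (sub_fspace X S) (sub_fspace Y T) \<phi>"
proof (rule fspace_homI)
  fix x assume "x \<in> points (sub_fspace X S)"
  thus "\<phi> x \<in> points (sub_fspace Y T)"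
    using fspace_homD(1)[OF \<phi>] ST by (auto simp: sub_fspace_def)
next
  fix V assume "fopen (sub_fspace Y T) V"
  then obtain W where W: "fopen Y W" "V = W \<inter> T"
    by (auto simp: sub_fspace_def openin_subtopology)
  have "{x \<in> points (sub_fspace X S). \<phi> x \<in> V} = {x \<in> points X. \<phi> x \<in> W} \<inter> S"
    using ST W by (auto simp: sub_fspace_def)
  thus "fopen (sub_fspace X S) {x \<in> points (sub_fspace X S). \<phi> x \<in> V}"
    using fspace_homD(2)[OF \<phi> W(1)] by (auto simp: sub_fspace_def openin_subtopology)
next
  fix V f assume r: "regular (sub_fspace Y T) V f"
  show "regular (sub_fspace X S) {x \<in> points (sub_fspace X S). \<phi> x \<in> V} (f \<circ> \<phi>)"
    unfolding sub_fspace_def select_convs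
  proof
    fix x assume x: "x \<in> {x \<in> topspace (subtopology (ftop X) S). \<phi> x \<in> V}"
    with r obtain W F where W: "fopen Y W" "\<phi> x \<in> W" "regular Y W F"
      "\<forall>y\<in>W \<inter> V. f y = F y" by (auto simp: sub_fspace_def)
    show "\<exists>W F. fopen X W \<and> x \<in> W \<and> regular X W F \<and>
        (\<forall>y\<in>W \<inter> {x \<in> topspace (subtopology (ftop X) S). \<phi> x \<in> V}. (f \<circ> \<phi>) y = F y)"
      using x W fspace_homD(2)[OF \<phi> W(1)] fspace_homD(3)[OF \<phi> W(1,3)]
      by (intro exI[of _ "{x \<in> points X. \<phi> x \<in> W}"] exI[of _ "F \<circ> \<phi>"]) auto
  qed
qed

lemma fspace_hom_quot:
  assumes \<phi>: "fspace_hom X Y \<phi>" and X: "fsheaf X"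
    and comm: "\<And>x. x \<in> points X \<Longrightarrow> \<phi>' (\<pi> x) = \<rho> (\<phi> x)"
  shows "fspace_hom (quot_fspace X \<pi>) (quot_fspace Y \<rho>) \<phi>'"
proof -
  have pre: "{x \<in> points X. \<pi> x \<in> {m \<in> points (quot_fspace X \<pi>). \<phi>' m \<in> V}} =
     {x \<in> points X. \<phi> x \<in> {y \<in> points Y. \<rho> y \<in> V}}" for V
    by (rule Collect_cong, rule conj_cong)
      (use comm fspace_homD(1)[OF \<phi>] in \<open>simp_all add: quot_fspace_def topspace_quot_topology\<close>)
  show ?thesis
  proof (rule fspace_homI)
    fix m assume "m \<in> points (quot_fspace X \<pi>)"
    thus "\<phi>' m \<in> points (quot_fspace Y \<rho>)"
      using comm fspace_homD(1)[OF \<phi>] by (auto simp: quot_fspace_def topspace_quot_topology)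
  next
    fix V f assume V: "fopen (quot_fspace Y \<rho>) V"
    hence V': "fopen Y {y \<in> points Y. \<rho> y \<in> V}"
      by (auto simp: quot_fspace_def openin_quot_topology)
    show V'': "fopen (quot_fspace X \<pi>) {m \<in> points (quot_fspace X \<pi>). \<phi>' m \<in> V}"
      using fspace_homD(2)[OF \<phi> V'] pre[of V]
      by (auto simp: quot_fspace_def openin_quot_topology topspace_quot_topology)
    assume "regular (quot_fspace Y \<rho>) V f"
    hence "regular Y {y \<in> points Y. \<rho> y \<in> V} (f \<circ> \<rho>)" by (simp add: quot_fspace_def)
    note r = fspace_homD(3)[OF \<phi> V' this]
    have "regular X {x \<in> points X. \<phi> x \<in> {y \<in> points Y. \<rho> y \<in> V}} (f \<circ> \<phi>' \<circ> \<pi>)"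
      by (rule fsheaf_cong[OF X fspace_homD(2)[OF \<phi> V'] r]) (use comm in auto)
    thus "regular (quot_fspace X \<pi>) {m \<in> points (quot_fspace X \<pi>). \<phi>' m \<in> V} (f \<circ> \<phi>')"
      unfolding pre[of V, symmetric] by (simp add: quot_fspace_def)
  qed
qed

lemma openin_sum_fspaceI:
  assumes "\<And>i. i \<in> I \<Longrightarrow> fopen (X i) {x. (i, x) \<in> U}"
    and "U \<subseteq> Sigma I (\<lambda>i. points (X i))"
  shows "fopen (sum_fspace X I) U"
  using assms by (simp add: sum_fspace_def openin_sum_topology comp_def)

lemma fspace_hom_sum:
  assumes "\<And>i. i \<in> I \<Longrightarrow> points (X i) \<noteq> {} \<Longrightarrow> \<sigma> i \<in> J \<and> fspace_hom (X i) (Y (\<sigma> i)) (\<phi> i)"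
    and X: "\<And>i. i \<in> I \<Longrightarrow> fsheaf (X i)"
  shows "fspace_hom (sum_fspace X I) (sum_fspace Y J) (\<lambda>(i, x). (\<sigma> i, \<phi> i x))"
proof -
  let ?\<phi> = "\<lambda>(i, x). (\<sigma> i, \<phi> i x)"
  let ?pre = "\<lambda>V. {p \<in> points (sum_fspace X I). ?\<phi> p \<in> V}"
  have pre: "{x. (i, x) \<in> ?pre V} = {x \<in> points (X i). \<phi> i x \<in> {y. (\<sigma> i, y) \<in> V}}"
    if "i \<in> I" for i V
    using that by (auto simp: sum_fspace_def)
  show ?thesis
  proof (rule fspace_homI)
    fix p assume "p \<in> points (sum_fspace X I)"
    then obtain i x where p: "p = (i, x)" "i \<in> I" "x \<in> points (X i)"
      by (auto simp: sum_fspace_def)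
    hence "points (X i) \<noteq> {}" by blast
    with assms(1) p have "\<sigma> i \<in> J" "fspace_hom (X i) (Y (\<sigma> i)) (\<phi> i)" by blast+
    with p fspace_homD(1)[of "X i" "Y (\<sigma> i)" "\<phi> i" x] show "?\<phi> p \<in> points (sum_fspace Y J)"
      by (simp add: sum_fspace_def)
  next
    fix V f assume V: "fopen (sum_fspace Y J) V"
    have Vi: "fopen (Y (\<sigma> i)) {y. (\<sigma> i, y) \<in> V}" if "\<sigma> i \<in> J" for i
      using V that by (auto simp: sum_fspace_def openin_sum_topology)
    have "fopen (X i) {x. (i, x) \<in> ?pre V}" if "i \<in> I" for i
    proof (cases "points (X i) = {}")
      case False
      from assms(1)[OF that False] have *: "\<sigma> i \<in> J" "fspace_hom (X i) (Y (\<sigma> i)) (\<phi> i)" by blast+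
      show ?thesis unfolding pre[OF that] using fspace_homD(2)[OF *(2) Vi[OF *(1)]] .
    next
      case True
      hence "{x. (i, x) \<in> ?pre V} = {}" unfolding pre[OF that] by blast
      thus ?thesis by (simp only: openin_empty)
    qed
    moreover have "?pre V \<subseteq> Sigma I (\<lambda>i. points (X i))"
      by (auto simp: sum_fspace_def)
    ultimately show "fopen (sum_fspace X I) (?pre V)"
      by (intro openin_sum_fspaceI)
    assume r: "regular (sum_fspace Y J) V f"
    have "regular (X i) {x. (i, x) \<in> ?pre V} (\<lambda>x. (f \<circ> ?\<phi>) (i, x))" if "i \<in> I" for i
    proof (cases "points (X i) = {}")
      case False
      from assms(1)[OF that False] have *: "\<sigma> i \<in> J" "fspace_hom (X i) (Y (\<sigma> i)) (\<phi> i)" by blast+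
      have "regular (Y (\<sigma> i)) {y. (\<sigma> i, y) \<in> V} (\<lambda>y. f (\<sigma> i, y))"
        using r *(1) by (simp add: sum_fspace_def)
      from fspace_homD(3)[OF *(2) Vi[OF *(1)] this]
      show ?thesis unfolding pre[OF that] by (simp add: comp_def)
    next
      case True
      hence "{x. (i, x) \<in> ?pre V} = {}" unfolding pre[OF that] by blast
      thus ?thesis using fsheaf_empty[OF X[OF that]] by (simp only:)
    qed
    thus "regular (sum_fspace X I) (?pre V) (f \<circ> ?\<phi>)" by (simp add: sum_fspace_def)
  qed
qed

text \<open>
  Empty summands are irrelevant, so only the nonempty ones have to be matched.
\<close>

lemma sum_fspace_iso:
  assumes bij: "bij_betw \<sigma> {i \<in> I. points (X i) \<noteq> {}} {j \<in> J. points (Y j) \<noteq> {}}"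
    and X: "\<And>i. i \<in> I \<Longrightarrow> fsheaf (X i)" and Y: "\<And>j. j \<in> J \<Longrightarrow> fsheaf (Y j)"
    and hom: "\<And>i. i \<in> I \<Longrightarrow> points (X i) \<noteq> {} \<Longrightarrow>
        \<exists>\<phi> \<psi>. inverse_homs (X i) (Y (\<sigma> i)) \<phi> \<psi>"
  shows "sum_fspace X I \<cong>\<^sub>f sum_fspace Y J"
proof -
  let ?I = "{i \<in> I. points (X i) \<noteq> {}}" and ?J = "{j \<in> J. points (Y j) \<noteq> {}}"
  define \<tau> where "\<tau> = inv_into ?I \<sigma>"
  have st: "\<sigma> i \<in> ?J" "\<tau> (\<sigma> i) = i" if "i \<in> ?I" for i
    unfolding \<tau>_def by (rule bij_betw_apply[OF bij that], rule bij_betw_inv_into_left[OF bij that])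
  have ts: "\<tau> j \<in> ?I" "\<sigma> (\<tau> j) = j" if "j \<in> ?J" for j
    unfolding \<tau>_def
    by (rule bij_betw_apply[OF bij_betw_inv_into[OF bij] that], rule bij_betw_inv_into_right[OF bij that])
  have "\<forall>i\<in>?I. \<exists>\<phi> \<psi>. inverse_homs (X i) (Y (\<sigma> i)) \<phi> \<psi>" using hom by blast
  then obtain \<phi> \<psi> where "\<forall>i\<in>?I. inverse_homs (X i) (Y (\<sigma> i)) (\<phi> i) (\<psi> i)" by metis
  hence h: "\<And>i. i \<in> ?I \<Longrightarrow> fspace_hom (X i) (Y (\<sigma> i)) (\<phi> i)"
    "\<And>i. i \<in> ?I \<Longrightarrow> fspace_hom (Y (\<sigma> i)) (X i) (\<psi> i)"
    "\<And>i x. i \<in> ?I \<Longrightarrow> x \<in> points (X i) \<Longrightarrow> \<psi> i (\<phi> i x) = x"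
    "\<And>i y. i \<in> ?I \<Longrightarrow> y \<in> points (Y (\<sigma> i)) \<Longrightarrow> \<phi> i (\<psi> i y) = y"
    unfolding inverse_homs_def by blast+
  show ?thesis
  proof (rule fspace_isoI)
    show "fspace_hom (sum_fspace X I) (sum_fspace Y J) (\<lambda>(i, x). (\<sigma> i, \<phi> i x))"
    proof (rule fspace_hom_sum)
      fix i assume "i \<in> I" "points (X i) \<noteq> {}"
      hence "i \<in> ?I" by blast
      from st(1)[OF this] h(1)[OF this] show "\<sigma> i \<in> J \<and> fspace_hom (X i) (Y (\<sigma> i)) (\<phi> i)" by blast
    qed (use X in auto)
    show "fspace_hom (sum_fspace Y J) (sum_fspace X I) (\<lambda>(j, y). (\<tau> j, \<psi> (\<tau> j) y))"
    proof (rule fspace_hom_sum)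
      fix j assume "j \<in> J" "points (Y j) \<noteq> {}"
      hence j: "j \<in> ?J" by blast
      show "\<tau> j \<in> I \<and> fspace_hom (Y j) (X (\<tau> j)) (\<psi> (\<tau> j))"
        using ts(1)[OF j] h(2)[OF ts(1)[OF j]] ts(2)[OF j] by simp
    qed (use Y in auto)
    show "fsheaf (sum_fspace Y J)" using Y by (rule fsheaf_sum_fspace)
  next
    fix p assume "p \<in> points (sum_fspace X I)"
    then obtain i x where p: "p = (i, x)" "i \<in> I" "x \<in> points (X i)"
      by (auto simp: sum_fspace_def)
    hence i: "i \<in> ?I" by blast
    from p st(2)[OF i] h(3)[OF i]
    show "(case case p of (i, x) \<Rightarrow> (\<sigma> i, \<phi> i x) of (j, y) \<Rightarrow> (\<tau> j, \<psi> (\<tau> j) y)) = p"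
      by simp
  next
    fix p assume "p \<in> points (sum_fspace Y J)"
    then obtain j y where p: "p = (j, y)" "j \<in> J" "y \<in> points (Y j)"
      by (auto simp: sum_fspace_def)
    hence j: "j \<in> ?J" by blast
    from p ts(2)[OF j] h(4)[OF ts(1)[OF j]]
    show "(case case p of (j, y) \<Rightarrow> (\<tau> j, \<psi> (\<tau> j) y) of (i, x) \<Rightarrow> (\<sigma> i, \<phi> i x)) = p"
      by simp
  qed
qed

text \<open>
  The induced structure on the whole space consists of the functions that are locally regular, and
  these are regular by gluing.
\<close>

lemma sub_fspace_topspace_hom:
  assumes "fsheaf X"
  shows "fspace_hom (sub_fspace X (points X)) X id"
    and "fspace_hom X (sub_fspace X (points X)) id"
proof -
  show "fspace_hom (sub_fspace X (points X)) X id"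
  proof (rule fspace_homI)
    fix V f assume V: "fopen X V"
    have [simp]: "{x \<in> points X. x \<in> V} = V" using openin_subset[OF V] by auto
    show "fopen (sub_fspace X (points X))
      {x \<in> points (sub_fspace X (topspace (ftop X))). id x \<in> V}"
      using V by (simp add: sub_fspace_def)
    assume "regular X V f"
    with V show "regular (sub_fspace X (points X))
      {x \<in> points (sub_fspace X (topspace (ftop X))). id x \<in> V} (f \<circ> id)"
      by (auto simp: sub_fspace_def)
  qed (simp add: sub_fspace_def)
  show "fspace_hom X (sub_fspace X (points X)) id"
  proof (rule fspace_homI)
    fix V f assume V: "fopen (sub_fspace X (points X)) V"
    hence V': "fopen X V" by (simp add: sub_fspace_def)
    have [simp]: "{x \<in> points X. x \<in> V} = V" using openin_subset[OF V'] by auto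
    show "fopen X {x \<in> points X. id x \<in> V}" using V' by simp
    assume r: "regular (sub_fspace X (points X)) V f"
    have "regular X V f"
    proof (rule fsheaf_glue[OF assms V'])
      fix x assume x: "x \<in> V"
      with r obtain W F where W: "fopen X W" "x \<in> W" "regular X W F" "\<forall>y\<in>W \<inter> V. f y = F y"
        by (auto simp: sub_fspace_def)
      have o: "fopen X (W \<inter> V)" using W(1) V' by blast
      have "regular X (W \<inter> V) F" by (rule fsheaf_restrict[OF assms W(1) o _ W(3)]) auto
      hence "regular X (W \<inter> V) f" by (rule fsheaf_cong[OF assms o]) (use W(4) in auto)
      with o W x show "\<exists>W. fopen X W \<and> x \<in> W \<and> W \<subseteq> V \<and> regular X W f" by blast
    qed
    thus "regular X {x \<in> points X. id x \<in> V} (f \<circ> id)" by simp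
  qed (simp add: sub_fspace_def)
qed

lemma fspace_iso_trans:
  assumes "X \<cong>\<^sub>f Y" "Y \<cong>\<^sub>f Z"
  shows "X \<cong>\<^sub>f Z"
proof -
  obtain \<phi> where \<phi>: "homeomorphic_map (ftop X) (ftop Y) \<phi>"
    "\<And>V f. fopen Y V \<Longrightarrow> regular Y V f \<longleftrightarrow> regular X {x \<in> points X. \<phi> x \<in> V} (f \<circ> \<phi>)"
    using assms(1) unfolding fspace_iso_def by blast
  obtain \<psi> where \<psi>: "homeomorphic_map (ftop Y) (ftop Z) \<psi>"
    "\<And>V f. fopen Z V \<Longrightarrow> regular Z V f \<longleftrightarrow> regular Y {x \<in> points Y. \<psi> x \<in> V} (f \<circ> \<psi>)"
    using assms(2) unfolding fspace_iso_def by blast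
  have cont: "continuous_map (ftop X) (ftop Y) \<phi>" "continuous_map (ftop Y) (ftop Z) \<psi>"
    using \<phi>(1) \<psi>(1) homeomorphic_imp_continuous_map by blast+
  show ?thesis
    unfolding fspace_iso_def
  proof (intro exI[of _ "\<psi> \<circ> \<phi>"] conjI allI impI)
    show "homeomorphic_map (ftop X) (ftop Z) (\<psi> \<circ> \<phi>)"
      using \<phi>(1) \<psi>(1) homeomorphic_map_compose by blast
    fix V f assume V: "fopen Z V"
    have W: "fopen Y {y \<in> points Y. \<psi> y \<in> V}"
      using cont(2) V by (auto simp: continuous_map_def)
    have "{x \<in> points X. \<phi> x \<in> {y \<in> points Y. \<psi> y \<in> V}} =
        {x \<in> points X. (\<psi> \<circ> \<phi>) x \<in> V}"
      using cont(1) by (auto simp: continuous_map_def)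
    with \<psi>(2)[OF V, of f] \<phi>(2)[OF W, of "f \<circ> \<psi>"]
    show "regular Z V f \<longleftrightarrow> regular X {x \<in> points X. (\<psi> \<circ> \<phi>) x \<in> V} (f \<circ> (\<psi> \<circ> \<phi>))"
      by (simp add: comp_assoc)
  qed
qed

lemma sub_fspace_topspace_iso: "fsheaf X \<Longrightarrow> sub_fspace X (points X) \<cong>\<^sub>f X"
  by (rule fspace_isoI[OF sub_fspace_topspace_hom]) auto

section \<open>Representations, stability and base change\<close>

abbreviation csubspace :: "nat \<Rightarrow> complex vec set \<Rightarrow> bool" where
  "csubspace n W \<equiv> subspace class_ring W (module_vec TYPE(complex) n)"

lemma csubspace_iff:
  "csubspace n W \<longleftrightarrow> W \<subseteq> carrier_vec n \<and> 0\<^sub>v n \<in> W \<and> (\<forall>v\<in>W. \<forall>w\<in>W. v + w \<in> W) \<and>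
     (\<forall>c. \<forall>v\<in>W. c \<cdot>\<^sub>v v \<in> W)"
proof -
  interpret vec_space "TYPE(complex)" n .
  show ?thesis
    unfolding subspace_def submodule_def using vectorspace_axioms module_axioms
    by (auto simp: module_vec_simps)
qed

lemma csubspace_zero: "csubspace n {0\<^sub>v n}"
  by (auto simp: csubspace_iff)

lemma csubspace_carrier: "csubspace n (carrier_vec n)"
  by (auto simp: csubspace_iff)

lemma carrier_vec_0: "carrier_vec 0 = {0\<^sub>v 0}"
  by (auto intro!: eq_vecI)

lemma csubspace_0: "csubspace 0 W \<longleftrightarrow> W = {0\<^sub>v 0}"
  using csubspace_zero[of 0] by (auto simp: csubspace_iff carrier_vec_0)

abbreviation cdim :: "nat \<Rightarrow> complex vec set \<Rightarrow> nat" where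
  "cdim n W \<equiv> vectorspace.dim class_ring ((module_vec TYPE(complex) n)\<lparr>carrier := W\<rparr>)"

lemma cdim_carrier: "cdim n (carrier_vec n) = n"
proof -
  interpret vec_space "TYPE(complex)" n .
  have eq: "(module_vec TYPE(complex) n)\<lparr>carrier := carrier_vec n\<rparr> = module_vec TYPE(complex) n"
    by (simp add: module_vec_def)
  show ?thesis unfolding eq by (rule dim_is_n)
qed

lemma cdim_zero: "cdim n {0\<^sub>v n} = 0"
proof -
  interpret V: vec_space "TYPE(complex)" n .
  let ?V = "(module_vec TYPE(complex) n)\<lparr>carrier := {0\<^sub>v n}\<rparr>"
  interpret W: vectorspace class_ring ?V
    using V.subspace_is_vs[OF csubspace_zero] .
  have "W.span {0\<^sub>v n} \<subseteq> {0\<^sub>v n}" using W.span_is_subset2[of "{0\<^sub>v n}"] by simp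
  moreover have "{0\<^sub>v n} \<subseteq> W.span {0\<^sub>v n}" using W.in_own_span[of "{0\<^sub>v n}"] by simp
  ultimately have "W.gen_set {\<zero>\<^bsub>?V\<^esub>}" by (simp add: module_vec_simps)
  thus ?thesis by (rule W.dim0I)
qed

text \<open>
  Arrows that leave the support of the dimension vector carry matrices without entries, for which
  every equation holds.
\<close>

lemma mat_empty_eq:
  assumes "A \<in> carrier_mat m n" "B \<in> carrier_mat m n" "m = 0 \<or> n = 0"
  shows "A = B"
  using assms by (intro eq_matI) auto

lemma mat_monoid_simps:
  "carrier (mat_monoid n) = carrier_mat n n" "x \<otimes>\<^bsub>mat_monoid n\<^esub> y = x * y" "\<one>\<^bsub>mat_monoid n\<^esub> = 1\<^sub>m n"
  by (simp_all add: ring_mat_def)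

lemma monoid_mat_monoid: "Group.monoid (mat_monoid n)"
proof -
  interpret ring "mat_monoid n" by (rule ring_mat)
  show ?thesis by (rule monoid_axioms)
qed

lemma one_Units_mat_monoid: "1\<^sub>m n \<in> Units (mat_monoid n)"
  using monoid.Units_one_closed[OF monoid_mat_monoid[of n]] by (simp add: mat_monoid_simps)

lemma Units_mat_monoidD:
  assumes "g \<in> Units (mat_monoid n)"
  shows "g \<in> carrier_mat n n" "inv\<^bsub>mat_monoid n\<^esub> g \<in> carrier_mat n n"
  using monoid.Units_closed[OF monoid_mat_monoid assms]
    monoid.Units_inv_closed[OF monoid_mat_monoid assms] by (auto simp: mat_monoid_simps)

lemma repsD: "X \<in> reps G e \<Longrightarrow> b \<in> arcs G \<Longrightarrow> X b \<in> carrier_mat (e (head G b)) (e (tail G b))"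
  by (auto simp: reps_def PiE_iff)

lemma base_change_act_reps:
  assumes "wf_digraph G" "h \<in> base_change G e" "X \<in> reps G e"
  shows "base_change_act G e h X \<in> reps G e"
proof -
  have "h (head G b) * X b * inv\<^bsub>mat_monoid (e (tail G b))\<^esub> h (tail G b)
      \<in> carrier_mat (e (head G b)) (e (tail G b))" if b: "b \<in> arcs G" for b
  proof -
    have "head G b \<in> verts G" "tail G b \<in> verts G"
      using b assms(1) by (auto simp: wf_digraph_def)
    hence "h (head G b) \<in> Units (mat_monoid (e (head G b)))"
      "h (tail G b) \<in> Units (mat_monoid (e (tail G b)))"
      using assms(2) by (auto simp: base_change_def PiE_iff)
    with Units_mat_monoidD repsD[OF assms(3) b] show ?thesis by (meson mult_carrier_mat)
  qed
  thus ?thesis by (auto simp: base_change_act_def reps_def)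
qed

text \<open>
  The map between representation spaces along a bijection \<open>\<gamma>\<close> from the arrows of the full subquiver
  on the support of \<open>e\<close> to those of another one. All other arrows get the unique matrix without
  entries.
\<close>

definition transport ::
  "('w, 'b) quiver \<Rightarrow> ('w \<Rightarrow> nat) \<Rightarrow> ('b \<Rightarrow> 'a) \<Rightarrow> ('a \<Rightarrow> complex mat) \<Rightarrow> 'b \<Rightarrow> complex mat"
where
  "transport G e \<gamma> X = (\<lambda>b\<in>arcs G. if e (tail G b) \<noteq> 0 \<and> e (head G b) \<noteq> 0 then X (\<gamma> b)
                         else 0\<^sub>m (e (head G b)) (e (tail G b)))"

definition transport_base_change ::
  "('w, 'b) quiver \<Rightarrow> ('w \<Rightarrow> nat) \<Rightarrow> ('w \<Rightarrow> 'v) \<Rightarrow> ('v \<Rightarrow> complex mat) \<Rightarrow> 'w \<Rightarrow> complex mat"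
where
  "transport_base_change G e g h = (\<lambda>y\<in>verts G. if e y \<noteq> 0 then h (g y) else 1\<^sub>m 0)"

text \<open>
  Isomorphic full subquivers on the supports of two dimension vectors, with mutually inverse maps on
  vertices (\<open>f\<close>, \<open>g\<close>), preserving weights, and on arrows (\<open>\<phi>\<close>, \<open>\<gamma>\<close>). The setting is symmetric, so one half of each bijection
  is proved and the other follows by exchanging the two sides.
\<close>

locale support_iso =
  fixes G1 :: "('v, 'a) quiver" and e1 :: "'v \<Rightarrow> nat" and \<Theta>1 :: "'v \<Rightarrow> int"
    and G2 :: "('w, 'b) quiver" and e2 :: "'w \<Rightarrow> nat" and \<Theta>2 :: "'w \<Rightarrow> int"
    and f :: "'v \<Rightarrow> 'w" and g :: "'w \<Rightarrow> 'v" and \<phi> :: "'a \<Rightarrow> 'b" and \<gamma> :: "'b \<Rightarrow> 'a"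
  assumes wf1: "wf_digraph G1" and wf2: "wf_digraph G2"
    and supp1: "\<And>x. e1 x \<noteq> 0 \<Longrightarrow> x \<in> verts G1" and supp2: "\<And>y. e2 y \<noteq> 0 \<Longrightarrow> y \<in> verts G2"
    and f: "\<And>x. e1 x \<noteq> 0 \<Longrightarrow> e2 (f x) = e1 x \<and> g (f x) = x \<and> \<Theta>2 (f x) = \<Theta>1 x"
    and g: "\<And>y. e2 y \<noteq> 0 \<Longrightarrow> e1 (g y) = e2 y \<and> f (g y) = y \<and> \<Theta>1 (g y) = \<Theta>2 y"
    and \<phi>: "\<And>b. b \<in> arcs G1 \<Longrightarrow> e1 (tail G1 b) \<noteq> 0 \<Longrightarrow> e1 (head G1 b) \<noteq> 0 \<Longrightarrow>
       \<phi> b \<in> arcs G2 \<and> tail G2 (\<phi> b) = f (tail G1 b) \<and> head G2 (\<phi> b) = f (head G1 b) \<and> \<gamma> (\<phi> b) = b"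
    and \<gamma>: "\<And>b. b \<in> arcs G2 \<Longrightarrow> e2 (tail G2 b) \<noteq> 0 \<Longrightarrow> e2 (head G2 b) \<noteq> 0 \<Longrightarrow>
       \<gamma> b \<in> arcs G1 \<and> tail G1 (\<gamma> b) = g (tail G2 b) \<and> head G1 (\<gamma> b) = g (head G2 b) \<and> \<phi> (\<gamma> b) = b"

lemma support_iso_sym:
  assumes "support_iso G1 e1 \<Theta>1 G2 e2 \<Theta>2 f g \<phi> \<gamma>"
  shows "support_iso G2 e2 \<Theta>2 G1 e1 \<Theta>1 g f \<gamma> \<phi>"
proof -
  interpret support_iso G1 e1 \<Theta>1 G2 e2 \<Theta>2 f g \<phi> \<gamma> by fact
  show ?thesis
    by unfold_locales (use wf1 wf2 supp1 supp2 f g \<phi> \<gamma> in \<open>auto simp: wf_digraph_def\<close>)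
qed

context support_iso
begin

lemma transport_reps:
  assumes "X \<in> reps G1 e1"
  shows "transport G2 e2 \<gamma> X \<in> reps G2 e2"
proof -
  have "X (\<gamma> b) \<in> carrier_mat (e2 (head G2 b)) (e2 (tail G2 b))"
    if "b \<in> arcs G2" "e2 (tail G2 b) \<noteq> 0" "e2 (head G2 b) \<noteq> 0" for b
    using repsD[OF assms, of "\<gamma> b"] \<gamma>[OF that] g[OF that(2)] g[OF that(3)] by simp
  thus ?thesis by (auto simp: transport_def reps_def)
qed

lemma transport_inverse:
  assumes X: "X \<in> reps G1 e1"
  shows "transport G1 e1 \<phi> (transport G2 e2 \<gamma> X) = X"
proof
  fix b
  show "transport G1 e1 \<phi> (transport G2 e2 \<gamma> X) b = X b"
  proof (cases "b \<in> arcs G1")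
    case b: True
    show ?thesis
    proof (cases "e1 (tail G1 b) \<noteq> 0 \<and> e1 (head G1 b) \<noteq> 0")
      case True
      with b \<phi>[of b] f[of "tail G1 b"] f[of "head G1 b"] show ?thesis by (simp add: transport_def)
    next
      case False
      with b have "transport G1 e1 \<phi> Y b = 0\<^sub>m (e1 (head G1 b)) (e1 (tail G1 b))" for Y
        unfolding transport_def by (simp only: restrict_apply if_False if_True)
      moreover have "0\<^sub>m (e1 (head G1 b)) (e1 (tail G1 b)) = X b"
        by (rule mat_empty_eq[OF _ repsD[OF X b]]) (use False in auto)
      ultimately show ?thesis by metis
    qed
  next
    case False
    with X show ?thesis by (auto simp: transport_def reps_def PiE_iff extensional_def)
  qed
qed

lemma transport_base_change_in:
  assumes h: "h \<in> base_change G1 e1"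
  shows "transport_base_change G2 e2 g h \<in> base_change G2 e2"
proof -
  have "h (g y) \<in> Units (mat_monoid (e2 y))" if "e2 y \<noteq> 0" for y
  proof -
    have "g y \<in> verts G1" using supp1[of "g y"] g[OF that] that by simp
    with h have "h (g y) \<in> Units (mat_monoid (e1 (g y)))" by (auto simp: base_change_def PiE_iff)
    thus ?thesis using g[OF that] by simp
  qed
  thus ?thesis using one_Units_mat_monoid[of 0]
    by (auto simp: transport_base_change_def base_change_def)
qed

lemma transport_act:
  assumes h: "h \<in> base_change G1 e1" and X: "X \<in> reps G1 e1"
  shows "transport G2 e2 \<gamma> (base_change_act G1 e1 h X) =
    base_change_act G2 e2 (transport_base_change G2 e2 g h) (transport G2 e2 \<gamma> X)"
    (is "?L = ?R")
proof
  fix b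
  have L: "?L \<in> reps G2 e2" by (rule transport_reps[OF base_change_act_reps[OF wf1 h X]])
  have R: "?R \<in> reps G2 e2"
    by (rule base_change_act_reps[OF wf2 transport_base_change_in[OF h] transport_reps[OF X]])
  show "?L b = ?R b"
  proof (cases "b \<in> arcs G2")
    case b: True
    show ?thesis
    proof (cases "e2 (tail G2 b) \<noteq> 0 \<and> e2 (head G2 b) \<noteq> 0")
      case True
      hence "tail G2 b \<in> verts G2" "head G2 b \<in> verts G2" using supp2 by auto
      with True b \<gamma>[OF b] g[of "tail G2 b"] g[of "head G2 b"] show ?thesis
        by (simp add: transport_def base_change_act_def transport_base_change_def)
    next
      case False
      show ?thesis by (rule mat_empty_eq[OF repsD[OF L b] repsD[OF R b]]) (use False in auto)
    qed
  next
    case False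
    with L R show ?thesis by (auto simp: reps_def PiE_iff extensional_def)
  qed
qed

lemma transport_orbit_subset:
  assumes X: "X \<in> reps G1 e1"
  shows "transport G2 e2 \<gamma> ` orbit G1 e1 X \<subseteq> orbit G2 e2 (transport G2 e2 \<gamma> X)"
  using transport_act[OF _ X] transport_base_change_in unfolding orbit_def by fastforce

end

lemma (in support_iso) transport_orbit:
  assumes X: "X \<in> reps G1 e1"
  shows "transport G2 e2 \<gamma> ` orbit G1 e1 X = orbit G2 e2 (transport G2 e2 \<gamma> X)"
proof
  interpret flip: support_iso G2 e2 \<Theta>2 G1 e1 \<Theta>1 g f \<gamma> \<phi>
    by (rule support_iso_sym) unfold_locales
  show "orbit G2 e2 (transport G2 e2 \<gamma> X) \<subseteq> transport G2 e2 \<gamma> ` orbit G1 e1 X"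
  proof
    fix Y assume Y: "Y \<in> orbit G2 e2 (transport G2 e2 \<gamma> X)"
    hence "Y \<in> reps G2 e2"
      using base_change_act_reps[OF wf2 _ transport_reps[OF X]] unfolding orbit_def by auto
    hence "Y = transport G2 e2 \<gamma> (transport G1 e1 \<phi> Y)" by (simp add: flip.transport_inverse)
    moreover have "transport G1 e1 \<phi> Y \<in> orbit G1 e1 X"
      using flip.transport_orbit_subset[OF transport_reps[OF X]] Y transport_inverse[OF X] by auto
    ultimately show "Y \<in> transport G2 e2 \<gamma> ` orbit G1 e1 X" by blast
  qed
qed (rule transport_orbit_subset[OF X])

lemma slope_cong_bij:
  assumes bij: "bij_betw f {x. d1 x \<noteq> 0} {y. d2 y \<noteq> 0}"
    and d: "\<And>x. d1 x \<noteq> 0 \<Longrightarrow> d2 (f x) = d1 x" and \<Theta>: "\<And>x. d1 x \<noteq> 0 \<Longrightarrow> \<Theta>2 (f x) = \<Theta>1 x"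
  shows "slope \<Theta>1 d1 = slope \<Theta>2 d2"
proof -
  have "(\<Sum>y | d2 y \<noteq> 0. \<Theta>2 y * int (d2 y)) = (\<Sum>x | d1 x \<noteq> 0. \<Theta>1 x * int (d1 x))"
    by (subst sum.reindex_bij_betw[OF bij, symmetric]) (intro sum.cong, use d \<Theta> in auto)
  moreover have "(\<Sum>y | d2 y \<noteq> 0. d2 y) = (\<Sum>x | d1 x \<noteq> 0. d1 x)"
    by (subst sum.reindex_bij_betw[OF bij, symmetric]) (intro sum.cong, use d in auto)
  ultimately show ?thesis unfolding slope_def by simp
qed

lemma subrep_outside_support:
  assumes "subrep G e X U" "q \<in> verts G" "e q = 0"
  shows "U q = {0\<^sub>v (e q)}" "U q = carrier_vec (e q)"
  using assms csubspace_0[of "U q"] by (auto simp: subrep_def carrier_vec_0)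

context support_iso
begin

lemma slope_support_iso:
  assumes "\<And>x. d1 x \<noteq> 0 \<Longrightarrow> e1 x \<noteq> 0" "\<And>y. d2 y \<noteq> 0 \<Longrightarrow> e2 y \<noteq> 0"
    and "\<And>x. e1 x \<noteq> 0 \<Longrightarrow> d2 (f x) = d1 x"
  shows "slope \<Theta>1 d1 = slope \<Theta>2 d2"
proof (rule slope_cong_bij)
  show "bij_betw f {x. d1 x \<noteq> 0} {y. d2 y \<noteq> 0}"
  proof (rule bij_betw_byWitness[where f' = g])
    show "g ` {y. d2 y \<noteq> 0} \<subseteq> {x. d1 x \<noteq> 0}"
    proof
      fix x assume "x \<in> g ` {y. d2 y \<noteq> 0}"
      then obtain y where y: "x = g y" "d2 y \<noteq> 0" by blast
      hence "e2 y \<noteq> 0" using assms(2) by simp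
      thus "x \<in> {x. d1 x \<noteq> 0}" using g[of y] assms(3)[of "g y"] y by simp
    qed
  qed (use assms f g in auto)
qed (use assms f in auto)

text \<open>
  A subrepresentation of the transported representation is pulled back to the support of \<open>e1\<close> and
  extended by zero. This changes neither slopes nor properness, since at a vertex outside the support
  the only subspace is zero and equals the whole space.
\<close>

lemma transport_stable:
  assumes X: "X \<in> reps G1 e1" and st: "stable G1 \<Theta>1 e1 X"
  shows "stable G2 \<Theta>2 e2 (transport G2 e2 \<gamma> X)"
  unfolding stable_def
proof (intro allI impI)
  fix U
  assume U: "subrep G2 e2 (transport G2 e2 \<gamma> X) U \<and> (\<exists>q\<in>verts G2. U q \<noteq> {0\<^sub>v (e2 q)}) \<and>
    (\<exists>q\<in>verts G2. U q \<noteq> carrier_vec (e2 q))"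
  define U' where "U' x = (if e1 x \<noteq> 0 then U (f x) else {0\<^sub>v (e1 x)})" for x
  have fv: "f x \<in> verts G2" if "e1 x \<noteq> 0" for x using f[OF that] supp2[of "f x"] that by simp
  have sub: "csubspace (e1 x) (U' x)" for x
  proof (cases "e1 x = 0")
    case False
    have "csubspace (e2 (f x)) (U (f x))" using U fv[OF False] unfolding subrep_def by blast
    with False f[OF False] show ?thesis by (simp add: U'_def)
  qed (use csubspace_zero[of "e1 x"] in \<open>simp add: U'_def\<close>)
  have "X b *\<^sub>v u \<in> U' (head G1 b)" if b: "b \<in> arcs G1" and u: "u \<in> U' (tail G1 b)" for b u
  proof -
    note Xb = repsD[OF X b]
    have uc: "u \<in> carrier_vec (e1 (tail G1 b))" using sub u unfolding csubspace_iff by blast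
    consider "e1 (tail G1 b) = 0" | "e1 (head G1 b) = 0" | "e1 (tail G1 b) \<noteq> 0" "e1 (head G1 b) \<noteq> 0"
      by blast
    thus ?thesis
    proof cases
      case 1
      with u have "u = 0\<^sub>v (e1 (tail G1 b))" by (simp add: U'_def)
      with Xb have "X b *\<^sub>v u = 0\<^sub>v (e1 (head G1 b))" by (simp add: 1)
        (rule eq_vecI, auto simp: scalar_prod_def)
      thus ?thesis using sub[of "head G1 b"] unfolding csubspace_iff by simp
    next
      case 2
      have "X b *\<^sub>v u \<in> carrier_vec (e1 (head G1 b))" using Xb uc by (rule mult_mat_vec_carrier)
      with 2 show ?thesis by (simp add: U'_def carrier_vec_0)
    next
      case 3
      note p = \<phi>[OF b 3]
      have "transport G2 e2 \<gamma> X (\<phi> b) = X b"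
        using p f[OF 3(1)] f[OF 3(2)] 3 by (simp add: transport_def)
      moreover have "u \<in> U (tail G2 (\<phi> b))" using u 3 p by (simp add: U'_def)
      ultimately have "X b *\<^sub>v u \<in> U (head G2 (\<phi> b))" using U p unfolding subrep_def by metis
      thus ?thesis using 3 p by (simp add: U'_def)
    qed
  qed
  with sub have subrep: "subrep G1 e1 X U'" by (auto simp: subrep_def)
  have nz: "\<exists>q\<in>verts G1. U' q \<noteq> W (e1 q)"
    if ex: "\<exists>q\<in>verts G2. U q \<noteq> W (e2 q)"
      and W: "\<And>q. q \<in> verts G2 \<Longrightarrow> e2 q = 0 \<Longrightarrow> U q = W (e2 q)"
    for W :: "nat \<Rightarrow> complex vec set"
  proof -
    from ex obtain q where q: "q \<in> verts G2" "U q \<noteq> W (e2 q)" by blast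
    with W have "e2 q \<noteq> 0" by blast
    with q g[OF this] have "U' (g q) \<noteq> W (e1 (g q))" "g q \<in> verts G1"
      using supp1[of "g q"] by (auto simp: U'_def)
    thus ?thesis by blast
  qed
  have "\<exists>q\<in>verts G1. U' q \<noteq> {0\<^sub>v (e1 q)}"
    by (rule nz[OF U[THEN conjunct2, THEN conjunct1]])
      (rule subrep_outside_support(1)[OF U[THEN conjunct1]])
  moreover have "\<exists>q\<in>verts G1. U' q \<noteq> carrier_vec (e1 q)"
    by (rule nz[OF U[THEN conjunct2, THEN conjunct2]])
      (rule subrep_outside_support(2)[OF U[THEN conjunct1]])
  ultimately have "slope \<Theta>1 (subrep_dim G1 e1 U') < slope \<Theta>1 e1"
    using st subrep unfolding stable_def by blast
  moreover have "slope \<Theta>1 e1 = slope \<Theta>2 e2"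
    by (rule slope_support_iso) (use f in auto)
  moreover have "slope \<Theta>1 (subrep_dim G1 e1 U') = slope \<Theta>2 (subrep_dim G2 e2 U)"
  proof (rule slope_support_iso)
    fix x assume x: "subrep_dim G1 e1 U' x \<noteq> 0"
    show "e1 x \<noteq> 0"
    proof
      assume "e1 x = 0"
      with x show False using cdim_zero[of 0] by (simp add: subrep_dim_def U'_def split: if_splits)
    qed
  next
    fix y assume y: "subrep_dim G2 e2 U y \<noteq> 0"
    show "e2 y \<noteq> 0"
    proof
      assume e: "e2 y = 0"
      from y have "y \<in> verts G2" by (auto simp: subrep_dim_def split: if_splits)
      with subrep_outside_support(1)[OF U[THEN conjunct1], of y] e y show False
        using cdim_zero[of 0] by (simp add: subrep_dim_def split: if_splits)
    qed
  next
    fix x assume x: "e1 x \<noteq> 0"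
    with fv[OF x] supp1[OF x] f[OF x] show "subrep_dim G2 e2 U (f x) = subrep_dim G1 e1 U' x"
      by (simp add: subrep_dim_def U'_def)
  qed
  ultimately show "slope \<Theta>2 (subrep_dim G2 e2 U) < slope \<Theta>2 e2" by simp
qed

text \<open>
  Every coordinate function belongs to an arrow inside the support, because an arrow leaving it has
  no matrix entries.
\<close>

lemma transport_poly_funs:
  "p \<in> poly_funs G2 e2 \<Longrightarrow> (\<lambda>X. p (transport G2 e2 \<gamma> X)) \<in> poly_funs G1 e1"
proof (induction rule: poly_funs.induct)
  case (coord b i j)
  hence *: "e2 (tail G2 b) \<noteq> 0" "e2 (head G2 b) \<noteq> 0" by auto
  have "(\<lambda>X. X (\<gamma> b) $$ (i, j)) \<in> poly_funs G1 e1"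
    by (rule poly_funs.coord) (use coord \<gamma>[OF coord(1) *] g[OF *(1)] g[OF *(2)] in auto)
  thus ?case using coord * by (simp add: transport_def)
qed (auto intro: poly_funs.intros)

end

section \<open>Moduli spaces depend only on the support\<close>

lemma topspace_zariski: "topspace (zariski G e) = reps G e"
proof -
  have "reps G e \<in> (\<lambda>f. {X \<in> reps G e. f X \<noteq> 0}) ` poly_funs G e"
    by (rule image_eqI[of _ _ "\<lambda>X. 1"]) (simp, rule poly_funs.const)
  thus ?thesis unfolding zariski_def topology_generated_by_topspace by blast
qed

text \<open>
  The condition on a single neighbourhood in the definition of regular functions, kept opaque so that
  the sheaf property becomes a statement about neighbourhoods only.
\<close>

definition locally_fraction ::
  "('v, 'a) quiver \<Rightarrow> ('v \<Rightarrow> nat) \<Rightarrow> (('a \<Rightarrow> complex mat) \<Rightarrow> complex) \<Rightarrow> ('a \<Rightarrow> complex mat) set \<Rightarrow> bool"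
where
  "locally_fraction G e \<phi> W \<longleftrightarrow>
     (\<exists>f\<in>poly_funs G e. \<exists>h\<in>poly_funs G e. \<forall>Y\<in>W. h Y \<noteq> 0 \<and> \<phi> Y = f Y / h Y)"

lemma regular_rep_space:
  "regular (rep_space G e) U \<phi> \<longleftrightarrow>
     (\<forall>X\<in>U. \<exists>W. openin (zariski G e) W \<and> X \<in> W \<and> W \<subseteq> U \<and> locally_fraction G e \<phi> W)"
  unfolding rep_space_def select_convs locally_fraction_def by (rule ball_cong[OF refl]) blast

lemma fsheaf_rep_space: "fsheaf (rep_space G e)"
  unfolding fsheaf_def
proof (intro conjI allI impI)
  fix U f f'
  assume *: "fopen (rep_space G e) U \<and> regular (rep_space G e) U f \<and> (\<forall>x\<in>U. f x = f' x)"
  have "locally_fraction G e f' W" if "locally_fraction G e f W" "W \<subseteq> U" for W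
  proof -
    have "\<forall>x\<in>W. f x = f' x" using * that(2) by auto
    with that(1) show ?thesis unfolding locally_fraction_def by (simp cong: ball_cong)
  qed
  with * show "regular (rep_space G e) U f'"
    unfolding regular_rep_space by meson
next
  fix U N f
  assume *: "fopen (rep_space G e) U \<and> fopen (rep_space G e) N \<and> N \<subseteq> U \<and>
    regular (rep_space G e) U f"
  have N: "openin (zariski G e) N" using * by (simp add: rep_space_def)
  show "regular (rep_space G e) N f"
    unfolding regular_rep_space
  proof
    fix X assume X: "X \<in> N"
    with * obtain W where W: "openin (zariski G e) W" "X \<in> W" "locally_fraction G e f W"
      unfolding regular_rep_space by blast
    have "locally_fraction G e f (W \<inter> N)" using W(3) unfolding locally_fraction_def by blast
    with W X N show "\<exists>W. openin (zariski G e) W \<and> X \<in> W \<and> W \<subseteq> N \<and> locally_fraction G e f W"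
      by (intro exI[of _ "W \<inter> N"]) auto
  qed
next
  fix U f
  assume *: "fopen (rep_space G e) U \<and> (\<forall>x\<in>U. \<exists>W. fopen (rep_space G e) W \<and>
    x \<in> W \<and> W \<subseteq> U \<and> regular (rep_space G e) W f)"
  show "regular (rep_space G e) U f"
    unfolding regular_rep_space
  proof
    fix X assume "X \<in> U"
    with * obtain N where N: "X \<in> N" "N \<subseteq> U" "regular (rep_space G e) N f" by blast
    then obtain W where "openin (zariski G e) W" "X \<in> W" "W \<subseteq> N" "locally_fraction G e f W"
      unfolding regular_rep_space by blast
    with N(2) show "\<exists>W. openin (zariski G e) W \<and> X \<in> W \<and> W \<subseteq> U \<and> locally_fraction G e f W"
      by blast
  qed
qed

lemma fsheaf_stable_moduli: "fsheaf (stable_moduli G \<Theta> e)"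
  unfolding stable_moduli_def by (intro fsheaf_quot_fspace fsheaf_sub_fspace fsheaf_rep_space)

lemma topspace_stable_moduli:
  "points (stable_moduli G \<Theta> e) = orbit G e ` {X \<in> reps G e. stable G \<Theta> e X}"
proof -
  have "topspace (zariski G e) \<inter> {X \<in> reps G e. stable G \<Theta> e X} = {X \<in> reps G e. stable G \<Theta> e X}"
    by (auto simp: topspace_zariski)
  thus ?thesis
    unfolding stable_moduli_def quot_fspace_def sub_fspace_def rep_space_def select_convs
      topspace_quot_topology topspace_subtopology by simp
qed

context support_iso
begin

lemma transport_hom_rep_space:
  "fspace_hom (rep_space G1 e1) (rep_space G2 e2) (transport G2 e2 \<gamma>)"
proof -
  have cont: "continuous_map (zariski G1 e1) (zariski G2 e2) (transport G2 e2 \<gamma>)"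
    unfolding zariski_def[of G2]
  proof (rule continuous_on_generated_topo)
    fix U assume "U \<in> (\<lambda>f. {X \<in> reps G2 e2. f X \<noteq> 0}) ` poly_funs G2 e2"
    then obtain p where p: "p \<in> poly_funs G2 e2" "U = {X \<in> reps G2 e2. p X \<noteq> 0}" by blast
    have "transport G2 e2 \<gamma> -` U \<inter> topspace (zariski G1 e1) =
        {X \<in> reps G1 e1. (\<lambda>X. p (transport G2 e2 \<gamma> X)) X \<noteq> 0}"
      using p(2) transport_reps by (auto simp: topspace_zariski)
    moreover have "openin (zariski G1 e1) {X \<in> reps G1 e1. (\<lambda>X. p (transport G2 e2 \<gamma> X)) X \<noteq> 0}"
      unfolding zariski_def
      by (rule topology_generated_by_Basis, rule imageI, rule transport_poly_funs[OF p(1)])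
    ultimately show "openin (zariski G1 e1) (transport G2 e2 \<gamma> -` U \<inter> topspace (zariski G1 e1))"
      by (simp only:)
  next
    have "\<Union> ((\<lambda>f. {X \<in> reps G2 e2. f X \<noteq> 0}) ` poly_funs G2 e2) = reps G2 e2"
      using topspace_zariski[of G2 e2] unfolding zariski_def topology_generated_by_topspace .
    thus "transport G2 e2 \<gamma> ` topspace (zariski G1 e1) \<subseteq>
        \<Union> ((\<lambda>f. {X \<in> reps G2 e2. f X \<noteq> 0}) ` poly_funs G2 e2)"
      using transport_reps by (simp only: topspace_zariski) blast
  qed
  show ?thesis
  proof (rule fspace_homI)
    fix V \<psi> assume V: "fopen (rep_space G2 e2) V"
    let ?pre = "\<lambda>V. {X \<in> points (rep_space G1 e1). transport G2 e2 \<gamma> X \<in> V}"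
    have o: "openin (zariski G1 e1) (?pre V)" if "openin (zariski G2 e2) V" for V
      using cont that by (simp add: continuous_map_def rep_space_def)
    with V show "fopen (rep_space G1 e1) (?pre V)" by (simp add: rep_space_def)
    assume r: "regular (rep_space G2 e2) V \<psi>"
    show "regular (rep_space G1 e1) (?pre V) (\<psi> \<circ> transport G2 e2 \<gamma>)"
      unfolding regular_rep_space
    proof
      fix X assume X: "X \<in> ?pre V"
      with r obtain W where W: "openin (zariski G2 e2) W" "transport G2 e2 \<gamma> X \<in> W" "W \<subseteq> V"
        "locally_fraction G2 e2 \<psi> W"
        unfolding regular_rep_space by blast
      then obtain p h where ph: "p \<in> poly_funs G2 e2" "h \<in> poly_funs G2 e2"
        "\<forall>Y\<in>W. h Y \<noteq> 0 \<and> \<psi> Y = p Y / h Y" unfolding locally_fraction_def by blast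
      have "locally_fraction G1 e1 (\<psi> \<circ> transport G2 e2 \<gamma>) (?pre W)"
        unfolding locally_fraction_def
        by (intro bexI[OF _ transport_poly_funs[OF ph(1)]] bexI[OF _ transport_poly_funs[OF ph(2)]])
          (use ph(3) in auto)
      with X W o[OF W(1)] show "\<exists>W. openin (zariski G1 e1) W \<and> X \<in> W \<and> W \<subseteq> ?pre V \<and>
          locally_fraction G1 e1 (\<psi> \<circ> transport G2 e2 \<gamma>) W"
        by (intro exI[of _ "?pre W"]) auto
    qed
  qed (use cont in \<open>auto simp: rep_space_def continuous_map_def\<close>)
qed

lemma transport_hom_stable_moduli:
  "fspace_hom (stable_moduli G1 \<Theta>1 e1) (stable_moduli G2 \<Theta>2 e2) ((`) (transport G2 e2 \<gamma>))"
  unfolding stable_moduli_def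
proof (rule fspace_hom_quot)
  show "fspace_hom (sub_fspace (rep_space G1 e1) {X \<in> reps G1 e1. stable G1 \<Theta>1 e1 X})
     (sub_fspace (rep_space G2 e2) {X \<in> reps G2 e2. stable G2 \<Theta>2 e2 X}) (transport G2 e2 \<gamma>)"
    by (rule fspace_hom_sub[OF transport_hom_rep_space]) (auto simp: transport_reps transport_stable)
  fix X assume "X \<in> points (sub_fspace (rep_space G1 e1) {X \<in> reps G1 e1. stable G1 \<Theta>1 e1 X})"
  hence "X \<in> reps G1 e1" by (auto simp: sub_fspace_def)
  thus "transport G2 e2 \<gamma> ` orbit G1 e1 X = orbit G2 e2 (transport G2 e2 \<gamma> X)"
    by (rule transport_orbit)
qed (intro fsheaf_sub_fspace fsheaf_rep_space)

lemma transport_moduli_inverse: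
  assumes "m \<in> points (stable_moduli G1 \<Theta>1 e1)"
  shows "transport G1 e1 \<phi> ` transport G2 e2 \<gamma> ` m = m"
proof -
  from assms obtain X where X: "X \<in> reps G1 e1" "m = orbit G1 e1 X"
    by (auto simp: topspace_stable_moduli)
  hence "m \<subseteq> reps G1 e1" using base_change_act_reps[OF wf1 _ X(1)] by (auto simp: orbit_def)
  hence "(\<lambda>Y. transport G1 e1 \<phi> (transport G2 e2 \<gamma> Y)) ` m = (\<lambda>Y. Y) ` m"
    by (intro image_cong refl transport_inverse) blast
  thus ?thesis by (simp add: image_image)
qed

end

lemma support_iso_moduli:
  assumes "support_iso G1 e1 \<Theta>1 G2 e2 \<Theta>2 f g \<phi> \<gamma>"
  shows "\<exists>\<Phi> \<Psi>. inverse_homs (stable_moduli G1 \<Theta>1 e1) (stable_moduli G2 \<Theta>2 e2) \<Phi> \<Psi>"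
proof -
  interpret support_iso G1 e1 \<Theta>1 G2 e2 \<Theta>2 f g \<phi> \<gamma> by fact
  interpret flip: support_iso G2 e2 \<Theta>2 G1 e1 \<Theta>1 g f \<gamma> \<phi> by (rule support_iso_sym[OF assms])
  show ?thesis
    unfolding inverse_homs_def
    by (intro exI[of _ "(`) (transport G2 e2 \<gamma>)"] exI[of _ "(`) (transport G1 e1 \<phi>)"] conjI ballI
        transport_hom_stable_moduli flip.transport_hom_stable_moduli
        transport_moduli_inverse flip.transport_moduli_inverse)
qed

section \<open>Supports of stable representations and torus fixed points\<close>

text \<open>
  Arrows of the coverings are pairs whose first component is the arrow of the base quiver below, so
  this relation presents a covering as a graph labelled by the arrows of the base.
\<close>

definition arrow_rel ::
  "('v, 'a \<times> 'l) quiver \<Rightarrow> 'v \<Rightarrow> 'a \<Rightarrow> 'v \<Rightarrow> bool"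
where
  "arrow_rel G x a y \<longleftrightarrow> (\<exists>b\<in>arcs G. fst b = a \<and> tail G b = x \<and> head G b = y)"

definition support :: "('v \<Rightarrow> nat) \<Rightarrow> 'v set" where
  "support e = {x. e x \<noteq> 0}"

text \<open>
  If no arrow joins \<open>C\<close> to the rest of the support, the representation is the direct sum of its
  restrictions to \<open>C\<close> and to the complement. Both have smaller slope by stability, but the slope of
  the sum is a weighted mean of the two.
\<close>

lemma stable_support_closed_subset:
  fixes G :: "('v, 'a) quiver"
  assumes fin: "finite (support e)" and sub: "support e \<subseteq> verts G"
    and X: "X \<in> reps G e" and st: "stable G \<Theta> e X"
    and C: "C \<subseteq> support e" "C \<noteq> {}"
    and closed: "\<And>b. b \<in> arcs G \<Longrightarrow> tail G b \<in> support e \<Longrightarrow> head G b \<in> support e \<Longrightarrow>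
      tail G b \<in> C \<longleftrightarrow> head G b \<in> C"
  shows "C = support e"
proof (rule ccontr)
  let ?S = "support e"
  assume ne: "C \<noteq> ?S"
  define \<theta> n where "\<theta> D = (\<Sum>q\<in>D. \<Theta> q * int (e q))" and "n D = (\<Sum>q\<in>D. e q)" for D
  \<comment> \<open>The inequality of slopes with denominators cleared, so that it can be added
    for \<open>C\<close> and its complement.\<close>
  have key: "of_int (\<theta> D) * rat_of_nat (n ?S) < of_int (\<theta> ?S) * rat_of_nat (n D) \<and> n D > 0"
    if D: "D \<subseteq> ?S" "D \<noteq> {}" "D \<noteq> ?S"
      and cl: "\<And>b. b \<in> arcs G \<Longrightarrow> tail G b \<in> ?S \<Longrightarrow> head G b \<in> ?S \<Longrightarrow> tail G b \<in> D \<longleftrightarrow> head G b \<in> D"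
    for D
  proof -
    define U :: "'v \<Rightarrow> complex vec set"
      where "U q = (if q \<in> D then carrier_vec (e q) else {0\<^sub>v (e q)})" for q
    have "X b *\<^sub>v u \<in> U (head G b)" if b: "b \<in> arcs G" and u: "u \<in> U (tail G b)" for b u
    proof (cases "tail G b \<in> D")
      case True
      with u have "X b *\<^sub>v u \<in> carrier_vec (e (head G b))"
        using repsD[OF X b] by (auto simp: U_def)
      moreover have "carrier_vec (e (head G b)) \<subseteq> U (head G b)"
      proof (cases "head G b \<in> ?S")
        case False
        thus ?thesis by (simp add: U_def support_def carrier_vec_0)
      qed (use cl[OF b] True D in \<open>auto simp: U_def\<close>)
      ultimately show ?thesis by blast
    next
      case False
      with u have "X b *\<^sub>v u = 0\<^sub>v (e (head G b))"
        using repsD[OF X b] by (auto simp: U_def)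
      thus ?thesis by (simp add: U_def)
    qed
    hence "subrep G e X U"
      using csubspace_zero csubspace_carrier by (auto simp: subrep_def U_def)
    moreover have nz: "{0\<^sub>v (e q) :: complex vec} \<noteq> carrier_vec (e q)" if "q \<in> ?S" for q
    proof
      assume "{0\<^sub>v (e q) :: complex vec} = carrier_vec (e q)"
      hence "cdim (e q) {0\<^sub>v (e q)} = cdim (e q) (carrier_vec (e q))" by (rule arg_cong)
      hence "e q = 0" by (simp only: cdim_zero cdim_carrier)
      with that show False by (simp add: support_def)
    qed
    moreover obtain q where "q \<in> D" using D(2) by blast
    with nz[of q] D(1) sub have "\<exists>q\<in>verts G. U q \<noteq> {0\<^sub>v (e q)}"
      by (intro bexI[of _ q]) (auto simp: U_def)
    moreover obtain q' where "q' \<in> ?S" "q' \<notin> D" using D by blast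
    with nz[of q'] D(1) sub have "\<exists>q\<in>verts G. U q \<noteq> carrier_vec (e q)"
      by (intro bexI[of _ q']) (auto simp: U_def)
    ultimately have "slope \<Theta> (subrep_dim G e U) < slope \<Theta> e"
      using st unfolding stable_def by blast
    moreover have dim: "subrep_dim G e U q = (if q \<in> D then e q else 0)" for q
      using D(1) sub by (auto simp: subrep_dim_def U_def cdim_zero cdim_carrier)
    have "{q. subrep_dim G e U q \<noteq> 0} = D"
      using D(1) by (auto simp: dim support_def)
    hence "slope \<Theta> (subrep_dim G e U) = of_int (\<theta> D) / of_nat (n D)"
      unfolding slope_def \<theta>_def n_def by (simp add: dim)
    moreover have "slope \<Theta> e = of_int (\<theta> ?S) / of_nat (n ?S)"
      unfolding slope_def \<theta>_def n_def support_def by simp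
    moreover have "n D > 0"
      using D(1,2) finite_subset[OF D(1) fin] unfolding n_def by (auto simp: support_def sum_eq_0_iff)
    moreover have "n ?S \<ge> n D"
      unfolding n_def by (rule sum_mono2[OF fin D(1)]) auto
    ultimately show ?thesis by (simp add: divide_simps mult.commute split: if_splits)
  qed
  have C': "C \<noteq> ?S" "?S - C \<noteq> {}" "?S - C \<noteq> ?S" using C ne by auto
  have *: "of_int (\<theta> C) * rat_of_nat (n ?S) < of_int (\<theta> ?S) * rat_of_nat (n C)"
    using key[of C] C C' closed by blast
  have **: "of_int (\<theta> (?S - C)) * rat_of_nat (n ?S) < of_int (\<theta> ?S) * rat_of_nat (n (?S - C))"
    using key[of "?S - C"] C' closed by blast
  have "\<theta> ?S = \<theta> C + \<theta> (?S - C)" "n ?S = n C + n (?S - C)"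
    unfolding \<theta>_def n_def using sum.subset_diff[OF C(1) fin] by (simp_all add: add.commute)
  with * ** show False by (simp add: algebra_simps)
qed

lemma stable_support_connected:
  fixes G :: "('v, 'a \<times> 'l) quiver"
  assumes fin: "finite (support e)" and sub: "support e \<subseteq> verts G"
    and X: "X \<in> reps G e" and st: "stable G \<Theta> e X"
  shows "connected_on (support e) (arrow_rel G)"
  unfolding connected_on_def
proof (intro ballI)
  fix x y assume xy: "x \<in> support e" "y \<in> support e"
  let ?E = "restrict_to (support e) (arrow_rel G)"
  define C where "C = {y \<in> support e. \<exists>w. path ?E x w y}"
  have ext: "v \<in> C" if "u \<in> C" "step ?E u l v" for u v l
  proof -
    from that obtain w where "path ?E x w u" by (auto simp: C_def)
    with that have "path ?E x (w @ [l]) v" by (auto simp: path_append)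
    moreover have "v \<in> support e" using that(2) by (cases l) (auto simp: restrict_to_def split: if_splits)
    ultimately show ?thesis unfolding C_def by blast
  qed
  have "path ?E x [] x" by simp
  hence "x \<in> C" unfolding C_def using xy(1) by blast
  have "C = support e"
  proof (rule stable_support_closed_subset[OF fin sub X st])
    fix b assume b: "b \<in> arcs G" "tail G b \<in> support e" "head G b \<in> support e"
    hence "step ?E (tail G b) (fst b, True) (head G b)" "step ?E (head G b) (fst b, False) (tail G b)"
      by (auto simp: restrict_to_def arrow_rel_def)
    thus "tail G b \<in> C \<longleftrightarrow> head G b \<in> C" using ext by blast
  qed (use \<open>x \<in> C\<close> in \<open>auto simp: C_def\<close>)
  with xy(2) show "\<exists>w. path ?E x w y" unfolding C_def by blast
qed

lemma smult_smult_mat: "a \<cdot>\<^sub>m (b \<cdot>\<^sub>m A) = (a * b :: complex) \<cdot>\<^sub>m A"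
  by (rule eq_matI) auto

lemma smult_one_Units:
  assumes "(c::complex) \<noteq> 0"
  shows "c \<cdot>\<^sub>m 1\<^sub>m n \<in> Units (mat_monoid n)" "inv\<^bsub>mat_monoid n\<^esub> (c \<cdot>\<^sub>m 1\<^sub>m n) = inverse c \<cdot>\<^sub>m 1\<^sub>m n"
proof -
  interpret Group.monoid "mat_monoid n" by (rule monoid_mat_monoid)
  have 1: "(a \<cdot>\<^sub>m 1\<^sub>m n) * (b \<cdot>\<^sub>m 1\<^sub>m n) = (a * b) \<cdot>\<^sub>m (1\<^sub>m n :: complex mat)" for a b
  proof -
    have "(a \<cdot>\<^sub>m 1\<^sub>m n) * (b \<cdot>\<^sub>m 1\<^sub>m n) = a \<cdot>\<^sub>m (1\<^sub>m n * (b \<cdot>\<^sub>m (1\<^sub>m n :: complex mat)))"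
      by (rule mult_smult_assoc_mat[of _ n n _ n]) auto
    thus ?thesis by (simp add: mult.commute smult_smult_mat)
  qed
  have 2: "(inverse c * c) \<cdot>\<^sub>m 1\<^sub>m n = (1\<^sub>m n :: complex mat)" "(c * inverse c) \<cdot>\<^sub>m 1\<^sub>m n = (1\<^sub>m n :: complex mat)"
    using assms by (auto intro!: eq_matI)
  show "c \<cdot>\<^sub>m 1\<^sub>m n \<in> Units (mat_monoid n)"
    unfolding Units_def using 1 2
    by (auto simp: mat_monoid_simps intro!: bexI[of _ "inverse c \<cdot>\<^sub>m 1\<^sub>m n"])
  show "inv\<^bsub>mat_monoid n\<^esub> (c \<cdot>\<^sub>m 1\<^sub>m n) = inverse c \<cdot>\<^sub>m 1\<^sub>m n"
    by (rule inv_char) (auto simp: mat_monoid_simps 1 2)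
qed

lemma torus_act_reps: "X \<in> reps G e \<Longrightarrow> torus_act G t X \<in> reps G e"
  by (auto simp: torus_act_def reps_def PiE_iff)

lemma orbit_base_change_image:
  assumes wf: "wf_digraph G" and h: "h \<in> base_change G e" and X: "X \<in> reps G e"
  shows "base_change_act G e h ` orbit G e X \<subseteq> orbit G e X"
proof
  fix Y assume "Y \<in> base_change_act G e h ` orbit G e X"
  then obtain k where k: "k \<in> base_change G e" "Y = base_change_act G e h (base_change_act G e k X)"
    unfolding orbit_def by blast
  define hk where "hk = (\<lambda>q\<in>verts G. h q * k q)"
  have U: "h q \<in> Units (mat_monoid (e q))" "k q \<in> Units (mat_monoid (e q))" if "q \<in> verts G" for q
    using h k(1) that by (auto simp: base_change_def PiE_iff)
  have "hk \<in> base_change G e"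
    using U monoid.Units_m_closed[OF monoid_mat_monoid]
    by (auto simp: base_change_def hk_def mat_monoid_simps)
  moreover have "Y = base_change_act G e hk X"
  proof
    fix b
    show "Y b = base_change_act G e hk X b"
    proof (cases "b \<in> arcs G")
      case b: True
      let ?s = "tail G b" and ?t = "head G b"
      have v: "?s \<in> verts G" "?t \<in> verts G" using b wf by (auto simp: wf_digraph_def)
      note Ut = U[OF v(2)] and Us = U[OF v(1)]
      have inv: "inv\<^bsub>mat_monoid (e ?s)\<^esub> (h ?s * k ?s) =
          inv\<^bsub>mat_monoid (e ?s)\<^esub> k ?s * inv\<^bsub>mat_monoid (e ?s)\<^esub> h ?s"
        using group.inv_mult_group[OF monoid.units_group[OF monoid_mat_monoid[of "e ?s"]], of "h ?s" "k ?s"]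
          Us monoid.units_of_inv[OF monoid_mat_monoid[of "e ?s"]]
          monoid.Units_m_closed[OF monoid_mat_monoid[of "e ?s"]]
        by (simp add: units_of_carrier units_of_mult mat_monoid_simps)
      note c = Units_mat_monoidD[OF Ut(1)] Units_mat_monoidD[OF Ut(2)] Units_mat_monoidD[OF Us(1)]
        Units_mat_monoidD[OF Us(2)] repsD[OF X b]
      let ?ki = "inv\<^bsub>mat_monoid (e ?s)\<^esub> k ?s" and ?hi = "inv\<^bsub>mat_monoid (e ?s)\<^esub> h ?s"
      have "h ?t * (k ?t * X b * ?ki) * ?hi = h ?t * k ?t * X b * (?ki * ?hi)"
        using c by (smt (verit) assoc_mult_mat mult_carrier_mat)
      with b v inv show ?thesis by (simp add: k(2) base_change_act_def hk_def)
    qed (simp add: k(2) base_change_act_def)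
  qed
  ultimately show "Y \<in> orbit G e X" unfolding orbit_def by blast
qed

text \<open>
  A multiplicative potential \<open>c\<close> with \<open>c(head) = t * c(tail)\<close> along each arrow, with \<open>t\<close> the torus
  coordinate of the arrow, exists as the support is a tree. Base change by the scalar matrices \<open>c\<close>
  then has the same effect as the torus element.
\<close>

lemma torus_act_fixes_orbit:
  fixes G :: "('v, 'a \<times> 'l) quiver"
  assumes wf: "wf_digraph G" and det: "deterministic (arrow_rel G)"
    and inj: "\<And>b b'. b \<in> arcs G \<Longrightarrow> b' \<in> arcs G \<Longrightarrow> fst b = fst b' \<Longrightarrow> tail G b = tail G b' \<Longrightarrow> b = b'"
    and con: "connected_on (support e) (arrow_rel G)"
    and tree: "is_forest (restrict_to (support e) (arrow_rel G))"
    and X: "X \<in> reps G e" and t: "t \<in> torus G"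
  shows "torus_act G t ` orbit G e X = orbit G e X"
proof -
  have sub: "torus_act G t ` orbit G e X \<subseteq> orbit G e X" if t: "t \<in> torus G" for t
  proof -
    define arc where "arc x a = (THE b. b \<in> arcs G \<and> fst b = a \<and> tail G b = x)" for x a
    have arc: "arc (tail G b) (fst b) = b" if "b \<in> arcs G" for b
      unfolding arc_def using that inj by (intro the_equality) auto
    have tnz: "t b \<noteq> 0" if "b \<in> arcs G" for b using t that by (auto simp: torus_def PiE_iff)
    define T where "T x a (y :: 'v) z = t (arc x a) * z" for x a y z
    have bij: "bij_betw (T x a y) (- {0}) (- {0})" if "restrict_to (support e) (arrow_rel G) x a y" for x a y
    proof -
      from that arc tnz have "t (arc x a) \<noteq> 0" by (auto simp: restrict_to_def arrow_rel_def)
      thus ?thesis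
        by (intro bij_betw_byWitness[where f' = "\<lambda>z. z / t (arc x a)"]) (auto simp: T_def)
    qed
    from forest_potential[OF det con tree, of T "- {0}" 1] bij
    obtain c where c: "\<forall>x. c x \<in> - {0}"
      "\<forall>x a y. restrict_to (support e) (arrow_rel G) x a y \<longrightarrow> c y = t (arc x a) * c x"
      unfolding T_def by auto
    define h where "h = (\<lambda>q\<in>verts G. c q \<cdot>\<^sub>m 1\<^sub>m (e q))"
    have h: "h \<in> base_change G e"
      using smult_one_Units(1) c(1) by (auto simp: base_change_def h_def)
    have "torus_act G t Y = base_change_act G e h Y" if Y: "Y \<in> reps G e" for Y
    proof
      fix b
      show "torus_act G t Y b = base_change_act G e h Y b"
      proof (cases "b \<in> arcs G")
        case b: True
        let ?s = "tail G b" and ?t = "head G b"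
        have v: "?s \<in> verts G" "?t \<in> verts G" 
          using wf_digraph.tail_in_verts[OF wf b] wf_digraph.head_in_verts[OF wf b] .
        show ?thesis
        proof (cases "?s \<in> support e \<and> ?t \<in> support e")
          case True
          hence "c ?t = t (arc ?s (fst b)) * c ?s"
            using c(2) b by (auto simp: restrict_to_def arrow_rel_def)
          hence ct: "c ?t * inverse (c ?s) = t b" using arc[OF b] c(1) by simp
          note Yb = repsD[OF Y b]
          have "c ?t \<cdot>\<^sub>m 1\<^sub>m (e ?t) * Y b * (inverse (c ?s) \<cdot>\<^sub>m 1\<^sub>m (e ?s)) = (c ?t * inverse (c ?s)) \<cdot>\<^sub>m Y b"
          proof -
            have 1: "c ?t \<cdot>\<^sub>m 1\<^sub>m (e ?t) * Y b = c ?t \<cdot>\<^sub>m Y b"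
              using mult_smult_assoc_mat[of "1\<^sub>m (e ?t)" "e ?t" "e ?t" "Y b" "e ?s" "c ?t"] Yb by simp
            have "c ?t \<cdot>\<^sub>m Y b * (inverse (c ?s) \<cdot>\<^sub>m 1\<^sub>m (e ?s)) = inverse (c ?s) \<cdot>\<^sub>m (c ?t \<cdot>\<^sub>m Y b * 1\<^sub>m (e ?s))"
              by (rule mult_smult_distrib[of _ "e ?t" "e ?s"]) (use Yb in auto)
            thus ?thesis unfolding 1 using Yb by (simp add: smult_smult_mat mult.commute)
          qed
          moreover have "inv\<^bsub>mat_monoid (e ?s)\<^esub> (h ?s) = inverse (c ?s) \<cdot>\<^sub>m 1\<^sub>m (e ?s)"
            using smult_one_Units(2) c(1) v by (simp add: h_def)
          ultimately show ?thesis
            using b v ct by (simp add: torus_act_def base_change_act_def h_def)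
        next
          case False
          show ?thesis
            by (rule mat_empty_eq[OF repsD[OF torus_act_reps[OF Y] b]
                  repsD[OF base_change_act_reps[OF wf h Y] b]])
              (use False in \<open>auto simp: support_def\<close>)
        qed
      qed (simp add: torus_act_def base_change_act_def)
    qed
    moreover have "orbit G e X \<subseteq> reps G e"
      using base_change_act_reps[OF wf _ X] by (auto simp: orbit_def)
    ultimately have "torus_act G t ` orbit G e X = base_change_act G e h ` orbit G e X"
      by (intro image_cong) auto
    thus ?thesis using orbit_base_change_image[OF wf h X] by simp
  qed
  define t' where "t' = (\<lambda>b\<in>arcs G. inverse (t b))"
  have t': "t' \<in> torus G" using t by (auto simp: torus_def t'_def PiE_iff)
  have "orbit G e X \<subseteq> torus_act G t ` orbit G e X"
  proof
    fix Y assume Y: "Y \<in> orbit G e X"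
    hence "Y \<in> reps G e" using base_change_act_reps[OF wf _ X] by (auto simp: orbit_def)
    hence "Y b = torus_act G t (torus_act G t' Y) b" for b
      using t by (cases b; cases "b \<in> arcs G")
        (auto simp: torus_act_def t'_def torus_def PiE_iff smult_smult_mat reps_def extensional_def)
    hence "Y = torus_act G t (torus_act G t' Y)" by blast
    with sub[OF t'] Y show "Y \<in> torus_act G t ` orbit G e X" by blast
  qed
  with sub[OF t] show ?thesis by blast
qed

section \<open>The free group and the universal covering quiver\<close>

lemma equivclp_cancels_append:
  assumes "equivclp cancels u u'"
  shows "equivclp cancels (p @ u @ s) (p @ u' @ s)"
  using assms
proof (induction rule: equivclp_induct)
  case (step v w)
  hence "cancels (p @ v @ s) (p @ w @ s) \<or> cancels (p @ w @ s) (p @ v @ s)"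
    using cancels_append by blast
  with step.IH show ?case by (meson equivclp_into_equivclp)
qed simp

lemma word_class_eq_iff:
  assumes "u \<in> lists (A \<times> UNIV)" "v \<in> lists (A \<times> UNIV)"
  shows "word_class A u = word_class A v \<longleftrightarrow> equivclp cancels u v"
proof
  assume "word_class A u = word_class A v"
  moreover have "v \<in> word_class A v" using assms by (simp add: word_class_def)
  ultimately show "equivclp cancels u v" by (auto simp: word_class_def)
next
  assume *: "equivclp cancels u v"
  hence "equivclp cancels v u" by (rule equivclp_sym)
  with * show "word_class A u = word_class A v"
    unfolding word_class_def using equivclp_trans by metis
qed

lemma mult_word_class:
  assumes "u \<in> lists (A \<times> UNIV)" "v \<in> lists (A \<times> UNIV)"
  shows "word_class A u \<otimes>\<^bsub>word_group A\<^esub> word_class A v = word_class A (u @ v)"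
proof -
  have "word_class A (u' @ v') = word_class A (u @ v)"
    if "u' \<in> word_class A u" "v' \<in> word_class A v" for u' v'
  proof -
    from that have *: "equivclp cancels u u'" "equivclp cancels v v'" "u' \<in> lists (A \<times> UNIV)"
      "v' \<in> lists (A \<times> UNIV)" by (auto simp: word_class_def)
    from equivclp_cancels_append[OF *(1), of "[]" v] equivclp_cancels_append[OF *(2), of u' "[]"]
    have "equivclp cancels (u @ v) (u' @ v')" using equivclp_trans by fastforce
    thus ?thesis using word_class_eq_iff[of "u @ v" A "u' @ v'"] assms *(3,4) by simp
  qed
  moreover have "u \<in> word_class A u" "v \<in> word_class A v" using assms by (auto simp: word_class_def)
  ultimately have "(\<Union>u'\<in>word_class A u. \<Union>v'\<in>word_class A v. word_class A (u' @ v')) = word_class A (u @ v)"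
    by blast
  thus ?thesis by (simp add: word_group_def)
qed

lemma carrier_word_group: "c \<in> carrier (word_group A) \<longleftrightarrow> (\<exists>w\<in>lists (A \<times> UNIV). c = word_class A w)"
  by (auto simp: word_group_def)

lemma one_word_group: "\<one>\<^bsub>word_group A\<^esub> = word_class A []"
  by (simp add: word_group_def)

lemma inv_word_cancels: "equivclp cancels (inv_word w @ w) []"
proof (induction w)
  case (Cons l w)
  have "inv_word (l # w) @ l # w = inv_word w @ [inv_letter l, inv_letter (inv_letter l)] @ w"
    by (simp add: inv_word_def)
  hence "cancels (inv_word (l # w) @ l # w) (inv_word w @ w)"
    using cancels.intros[of "inv_word w" "fst l" "\<not> snd l" w] by simp
  with Cons.IH show ?case by (meson r_into_equivclp equivclp_trans)
qed (simp add: inv_word_def)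

lemma group_word_group: "Group.group (word_group A)"
proof (rule groupI)
  fix x y z
  assume "x \<in> carrier (word_group A)"
  then obtain u where u: "u \<in> lists (A \<times> UNIV)" "x = word_class A u" by (auto simp: carrier_word_group)
  show "\<one>\<^bsub>word_group A\<^esub> \<otimes>\<^bsub>word_group A\<^esub> x = x"
    using u mult_word_class[of "[]" A u] by (simp add: one_word_group)
  have "inv_word u \<in> lists (A \<times> UNIV)" using u(1) by (auto simp: inv_word_def in_lists_conv_set mem_Times_iff)
  thus "\<exists>y\<in>carrier (word_group A). y \<otimes>\<^bsub>word_group A\<^esub> x = \<one>\<^bsub>word_group A\<^esub>"
    using u inv_word_cancels[of u] word_class_eq_iff[of "inv_word u @ u" A "[]"]
    by (intro bexI[of _ "word_class A (inv_word u)"])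
      (auto simp: mult_word_class one_word_group carrier_word_group)
  assume "y \<in> carrier (word_group A)"
  then obtain v where v: "v \<in> lists (A \<times> UNIV)" "y = word_class A v" by (auto simp: carrier_word_group)
  show "x \<otimes>\<^bsub>word_group A\<^esub> y \<in> carrier (word_group A)"
    using u v unfolding carrier_word_group by (intro bexI[of _ "u @ v"]) (auto simp: mult_word_class)
  assume "z \<in> carrier (word_group A)"
  then obtain w where w: "w \<in> lists (A \<times> UNIV)" "z = word_class A w" by (auto simp: carrier_word_group)
  show "x \<otimes>\<^bsub>word_group A\<^esub> y \<otimes>\<^bsub>word_group A\<^esub> z = x \<otimes>\<^bsub>word_group A\<^esub> (y \<otimes>\<^bsub>word_group A\<^esub> z)"
    using u v w by (simp add: mult_word_class)
qed (auto simp: carrier_word_group one_word_group)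

text \<open>
  Reduced words represent the elements of the free group uniquely. This is shown by letting the
  letters act on reduced words: a letter and its inverse act as mutually inverse maps, so the
  word obtained from the empty word does not change under cancellation.
\<close>

fun push_letter :: "'a \<times> bool \<Rightarrow> 'a word \<Rightarrow> 'a word" where
  "push_letter l [] = [l]"
| "push_letter l (m # w) = (if m = inv_letter l then w else l # m # w)"

definition normal_form :: "'a word \<Rightarrow> 'a word" where
  "normal_form w = foldr push_letter w []"

lemma reduced_ConsD: "reduced (l # w) \<Longrightarrow> reduced w"
  using reduced_subword[of "[l]" w "[]"] by simp

lemma reduced_Cons_ConsD: "reduced (l # m # w) \<Longrightarrow> m \<noteq> inv_letter l"
  using not_reduced_backtrack[of "[]" l w] by auto

lemma reduced_Cons_ConsI:
  assumes "m \<noteq> inv_letter l" "reduced (m # w)"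
  shows "reduced (l # m # w)"
  unfolding reduced_def
proof
  assume "\<exists>w'. cancels (l # m # w) w'"
  then obtain u a s v where *: "l # m # w = u @ [(a, s), (a, \<not> s)] @ v" by (auto elim!: cancels.cases)
  show False
  proof (cases u)
    case Nil
    with * assms(1) show False by auto
  next
    case (Cons k u')
    with * have "m # w = u' @ [(a, s), inv_letter (a, s)] @ v" by simp
    with assms(2) not_reduced_backtrack show False by metis
  qed
qed

lemma reduced_single: "reduced [l]"
  unfolding reduced_def by (auto dest: cancels_length)

lemma reduced_push_letter: "reduced w \<Longrightarrow> reduced (push_letter l w)"
  by (cases w) (auto intro: reduced_single reduced_Cons_ConsI dest: reduced_ConsD)

lemma push_letter_inverse: "reduced w \<Longrightarrow> push_letter l (push_letter (inv_letter l) w) = w"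
  by (cases l; cases w; cases "tl w") (auto dest: reduced_Cons_ConsD)

lemma reduced_normal_form: "reduced (normal_form w)"
  by (induction w) (auto simp: normal_form_def reduced_push_letter)

lemma normal_form_reduced: "reduced w \<Longrightarrow> normal_form w = w"
proof (induction w)
  case (Cons l w)
  have "normal_form w = w" using Cons.IH reduced_ConsD[OF Cons.prems] by blast
  hence "normal_form (l # w) = push_letter l w" by (simp add: normal_form_def)
  also have "\<dots> = l # w"
  proof (cases w)
    case (Cons m w')
    with Cons.prems have "m \<noteq> inv_letter l" using reduced_Cons_ConsD by blast
    with Cons show ?thesis by simp
  qed simp
  finally show ?case .
qed (simp add: normal_form_def)

lemma normal_form_cancels: "cancels u v \<Longrightarrow> normal_form u = normal_form v"
proof (induction rule: cancels.induct)
  case (1 u a s v)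
  show ?case
    using push_letter_inverse[OF reduced_normal_form[of v], of "(a, s)"] by (simp add: normal_form_def)
qed

lemma normal_form_equiv: "equivclp cancels u v \<Longrightarrow> normal_form u = normal_form v"
  by (induction rule: equivclp_induct) (auto dest: normal_form_cancels)

lemma reduced_trivial_word:
  assumes "reduced w" "equivclp cancels w []"
  shows "w = []"
  using normal_form_equiv[OF assms(2)] normal_form_reduced[OF assms(1)] by (simp add: normal_form_def)


lemma arrow_rel_universal_cover:
  "arrow_rel (universal_cover Q) x a y \<longleftrightarrow> a \<in> arcs Q \<and> snd x \<in> carrier (word_group (arcs Q)) \<and>
     fst x = tail Q a \<and> y = (head Q a, snd x \<otimes>\<^bsub>word_group (arcs Q)\<^esub> word_class (arcs Q) [(a, True)])"
  by (cases x) (auto simp: arrow_rel_def universal_cover_def)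

lemma letter_carrier: "a \<in> A \<Longrightarrow> word_class A [(a, s)] \<in> carrier (word_group A)"
  unfolding carrier_word_group by (intro bexI[of _ "[(a, s)]"]) auto

lemma wf_universal_cover:
  assumes "wf_digraph Q"
  shows "wf_digraph (universal_cover Q)"
proof -
  interpret Group.group "word_group (arcs Q)" by (rule group_word_group)
  show ?thesis
    using assms letter_carrier[of _ "arcs Q"]
    by (auto simp: wf_digraph_def universal_cover_def intro!: m_closed)
qed

lemma universal_cover_arcs_inj:
  assumes "b \<in> arcs (universal_cover Q)" "b' \<in> arcs (universal_cover Q)" "fst b = fst b'"
    "tail (universal_cover Q) b = tail (universal_cover Q) b'"
  shows "b = b'"
  using assms by (cases b; cases b') (auto simp: universal_cover_def)

lemma deterministic_universal_cover: "deterministic (arrow_rel (universal_cover Q))"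
proof -
  interpret Group.group "word_group (arcs Q)" by (rule group_word_group)
  show ?thesis
    unfolding deterministic_def arrow_rel_universal_cover
    using letter_carrier[of _ "arcs Q"] right_cancel by (auto simp: prod_eq_iff)
qed

lemma path_universal_cover:
  assumes "snd x \<in> carrier (word_group (arcs Q))" "path (arrow_rel (universal_cover Q)) x w y"
  shows "w \<in> lists (arcs Q \<times> UNIV) \<and>
    snd y = snd x \<otimes>\<^bsub>word_group (arcs Q)\<^esub> word_class (arcs Q) w"
  using assms
proof (induction w arbitrary: x)
  interpret Group.group "word_group (arcs Q)" by (rule group_word_group)
  case Nil
  thus ?case by (simp flip: one_word_group)
next
  interpret Group.group "word_group (arcs Q)" by (rule group_word_group)
  let ?W = "word_group (arcs Q)"
  case (Cons l w)
  obtain a s where l: "l = (a, s)" by (cases l)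
  from Cons.prems obtain z where z: "step (arrow_rel (universal_cover Q)) x l z"
    "path (arrow_rel (universal_cover Q)) z w y" by auto
  have *: "a \<in> arcs Q \<and> snd z \<in> carrier ?W \<and> snd z = snd x \<otimes>\<^bsub>?W\<^esub> word_class (arcs Q) [l]"
  proof (cases s)
    case True
    with z(1) l Cons.prems(1) letter_carrier[of a "arcs Q"] show ?thesis
      by (auto simp: arrow_rel_universal_cover)
  next
    case False
    with z(1) l have az: "a \<in> arcs Q" "snd z \<in> carrier ?W" "snd x = snd z \<otimes>\<^bsub>?W\<^esub> word_class (arcs Q) [(a, True)]"
      by (auto simp: arrow_rel_universal_cover)
    have "equivclp cancels [(a, True), (a, False)] []"
      using cancels.intros[of "[]" a True "[]"] by (simp add: r_into_equivclp)
    hence "word_class (arcs Q) [(a, True)] \<otimes>\<^bsub>?W\<^esub> word_class (arcs Q) [(a, False)] = \<one>\<^bsub>?W\<^esub>"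
      using az(1) by (simp add: mult_word_class one_word_group word_class_eq_iff)
    with az l False show ?thesis
      using letter_carrier[of a "arcs Q"] by (simp add: m_assoc)
  qed
  with Cons.IH[OF _ z(2)] have IH: "w \<in> lists (arcs Q \<times> UNIV)"
    "snd y = snd z \<otimes>\<^bsub>?W\<^esub> word_class (arcs Q) w" by auto
  have "word_class (arcs Q) w \<in> carrier ?W" using IH(1) by (auto simp: carrier_word_group)
  with * IH l letter_carrier[of a "arcs Q" s] Cons.prems(1)
  have "snd y = snd x \<otimes>\<^bsub>?W\<^esub> (word_class (arcs Q) [l] \<otimes>\<^bsub>?W\<^esub> word_class (arcs Q) w)"
    by (simp add: m_assoc)
  with IH(1) * l show ?case by (simp add: mult_word_class)
qed

text \<open>
  The word of a closed walk is trivial in the free group, and a reduced word that is trivial is empty.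
\<close>

lemma forest_universal_cover: "is_forest (arrow_rel (universal_cover Q))"
  unfolding is_forest_def
proof (intro allI impI)
  interpret Group.group "word_group (arcs Q)" by (rule group_word_group)
  let ?W = "word_group (arcs Q)"
  fix x w assume *: "reduced w \<and> path (arrow_rel (universal_cover Q)) x w x"
  show "w = []"
  proof (cases w)
    case (Cons l w')
    with * obtain z where "step (arrow_rel (universal_cover Q)) x l z" by auto
    hence x: "snd x \<in> carrier ?W"
      using letter_carrier[of _ "arcs Q"] by (cases l) (auto simp: arrow_rel_universal_cover split: if_splits)
    from path_universal_cover[OF x] *
    have w: "w \<in> lists (arcs Q \<times> UNIV)" "snd x = snd x \<otimes>\<^bsub>?W\<^esub> word_class (arcs Q) w" by blast+
    have "word_class (arcs Q) w \<in> carrier ?W" using w(1) by (auto simp: carrier_word_group)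
    with w(2) x have "word_class (arcs Q) w = word_class (arcs Q) []"
      using r_cancel_one'[of "snd x" "word_class (arcs Q) w"] l_cancel_one' by (auto simp: one_word_group)
    with w(1) have "equivclp cancels w []" by (simp add: word_class_eq_iff)
    with * reduced_trivial_word show ?thesis by blast
  qed
qed

section \<open>Push-forward of dimension vectors\<close>

text \<open>
  Compatibility of \<open>e\<close> with \<open>d\<close> along \<open>p\<close> says that \<open>d\<close> is the push-forward of \<open>e\<close>. It is used below for
  arbitrary maps on vertices, in particular for lifts and translations.
\<close>

lemma compatible_unique: "compatible p e d \<Longrightarrow> compatible p e d' \<Longrightarrow> d = d'"
  by (auto simp: compatible_def)

lemma ex_compatible: "\<exists>d. compatible p e d"
  by (auto simp: compatible_def)

lemma compatible_support:
  assumes "finite (support e)" "compatible p e d"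
  shows "support d = p ` support e"
proof -
  have fin: "finite {x. e x \<noteq> 0 \<and> p x = q}" for q
    by (rule finite_subset[OF _ assms(1)]) (auto simp: support_def)
  have "d q \<noteq> 0 \<longleftrightarrow> q \<in> p ` support e" for q
    using assms(2) sum_eq_0_iff[OF fin, of e q] by (auto simp: compatible_def support_def)
  thus ?thesis by (auto simp: support_def)
qed

lemma sum_fibres:
  assumes "finite S" "\<And>x. x \<in> S \<Longrightarrow> x \<in> support e" "\<And>x. x \<in> support e \<Longrightarrow> p x \<in> T \<Longrightarrow> x \<in> S"
    and "finite T" "p ` S \<subseteq> T" "compatible p e d"
  shows "(\<Sum>q\<in>T. d q) = (\<Sum>x\<in>S. e x)"
proof -
  have "d q = (\<Sum>x\<in>{x \<in> S. p x = q}. e x)" if "q \<in> T" for q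
  proof -
    have "{x. e x \<noteq> 0 \<and> p x = q} = {x \<in> S. p x = q}"
      using assms(2,3) that by (auto simp: support_def)
    thus ?thesis using assms(6) by (simp add: compatible_def)
  qed
  hence "(\<Sum>q\<in>T. d q) = (\<Sum>q\<in>T. \<Sum>x\<in>{x \<in> S. p x = q}. e x)" by simp
  also have "\<dots> = (\<Sum>x\<in>S. e x)" by (rule sum.group) (use assms in auto)
  finally show ?thesis .
qed

lemma compatible_comp:
  assumes "finite (support e)" "compatible f e e'" "compatible g e' e''"
  shows "compatible (g \<circ> f) e e''"
  unfolding compatible_def
proof
  fix q
  let ?T = "{y. e' y \<noteq> 0 \<and> g y = q}" and ?S = "{x. e x \<noteq> 0 \<and> (g \<circ> f) x = q}"
  have s': "support e' = f ` support e" by (rule compatible_support[OF assms(1,2)])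
  have "finite ?T" "finite ?S"
    by (rule finite_subset[OF _ finite_imageI[OF assms(1), of f]], use s' in \<open>auto simp: support_def\<close>)
      (rule finite_subset[OF _ assms(1)], auto simp: support_def)
  moreover have "f ` ?S \<subseteq> ?T"
    using s' by (auto simp: support_def set_eq_iff)
  ultimately have "(\<Sum>y\<in>?T. e' y) = (\<Sum>x\<in>?S. e x)"
    by (intro sum_fibres[OF _ _ _ _ _ assms(2)]) (auto simp: support_def)
  thus "e'' q = (\<Sum>x\<in>?S. e x)" using assms(3) by (simp add: compatible_def)
qed

lemma compatible_factor:
  assumes "finite (support e)" "compatible f e e'" "compatible (g \<circ> f) e e''"
  shows "compatible g e' e''"
  using ex_compatible[of g e'] compatible_comp[OF assms(1,2)] compatible_unique[OF assms(3)] by metis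

lemma compatible_inj:
  assumes "inj_on p (support e)" "compatible p e d" "x \<in> support e"
  shows "d (p x) = e x"
proof -
  have "{y. e y \<noteq> 0 \<and> p y = p x} = {x}"
    using assms(1,3) by (auto simp: support_def inj_on_def)
  thus ?thesis using assms(2) by (simp add: compatible_def)
qed

lemma compatible_cong:
  assumes "compatible p e d" "\<And>x. x \<in> support e \<Longrightarrow> p x = p' x"
  shows "compatible p' e d"
  unfolding compatible_def
proof
  fix q
  have "{x. e x \<noteq> 0 \<and> p x = q} = {x. e x \<noteq> 0 \<and> p' x = q}" using assms(2) by (auto simp: support_def)
  thus "d q = (\<Sum>x | e x \<noteq> 0 \<and> p' x = q. e x)" using assms(1) by (simp add: compatible_def)
qed

lemma compatible_total:
  assumes "finite (support e)" "compatible p e d"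
  shows "sum d (support d) = sum e (support e)"
  by (rule sum_fibres[OF _ _ _ _ _ assms(2)])
    (use assms compatible_support[OF assms] in auto)

lemma card_support_le_total:
  assumes "finite (support e)"
  shows "card (support e) \<le> sum e (support e)"
proof -
  have "(\<Sum>x\<in>support e. 1) \<le> (\<Sum>x\<in>support e. e x)" by (rule sum_mono) (auto simp: support_def)
  thus ?thesis by simp
qed

section \<open>Representatives of equivalence classes\<close>

lemma dim_equiv_iff:
  "(e, e') \<in> dim_equiv V Tr A \<longleftrightarrow> e \<in> A \<and> e' \<in> A \<and> (\<exists>\<tau>\<in>Tr. \<forall>x\<in>V. e' (\<tau> x) = e x)"
  by (simp add: dim_equiv_def)

text \<open>
  It suffices that the translations behave like a group of permutations on \<open>V\<close>; outside of \<open>V\<close> the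
  given formulas need not be invertible.
\<close>

lemma equiv_dim_equiv:
  assumes "\<exists>\<tau>\<in>Tr. \<forall>x\<in>V. \<tau> x = x"
    and closed: "\<And>\<tau> x. \<tau> \<in> Tr \<Longrightarrow> x \<in> V \<Longrightarrow> \<tau> x \<in> V"
    and inv: "\<And>\<tau>. \<tau> \<in> Tr \<Longrightarrow> \<exists>\<tau>'\<in>Tr. \<forall>x\<in>V. \<tau> (\<tau>' x) = x"
    and comp: "\<And>\<tau> \<tau>'. \<tau> \<in> Tr \<Longrightarrow> \<tau>' \<in> Tr \<Longrightarrow> \<exists>\<sigma>\<in>Tr. \<forall>x\<in>V. \<sigma> x = \<tau>' (\<tau> x)"
  shows "equiv A (dim_equiv V Tr A)"
proof (rule equivI)
  show "dim_equiv V Tr A \<subseteq> A \<times> A" by (auto simp: dim_equiv_def)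
  show "refl_on A (dim_equiv V Tr A)"
    unfolding refl_on_def
  proof
    fix e assume "e \<in> A"
    moreover obtain \<tau> where "\<tau> \<in> Tr" "\<forall>x\<in>V. \<tau> x = x" using assms(1) by blast
    ultimately show "(e, e) \<in> dim_equiv V Tr A"
      by (auto simp: dim_equiv_def intro!: bexI[of _ \<tau>])
  qed
  show "sym (dim_equiv V Tr A)"
  proof (rule symI)
    fix e e' assume "(e, e') \<in> dim_equiv V Tr A"
    then obtain \<tau> where t: "e \<in> A" "e' \<in> A" "\<tau> \<in> Tr" "\<forall>x\<in>V. e' (\<tau> x) = e x" by (auto simp: dim_equiv_def)
    obtain \<tau>' where t': "\<tau>' \<in> Tr" "\<forall>x\<in>V. \<tau> (\<tau>' x) = x" using inv[OF t(3)] by blast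
    have "\<forall>x\<in>V. e (\<tau>' x) = e' x" using t(4) t' closed[OF t'(1)] by metis
    with t t' show "(e', e) \<in> dim_equiv V Tr A" by (auto simp: dim_equiv_def)
  qed
  show "trans (dim_equiv V Tr A)"
  proof (rule transI)
    fix e e' e'' assume "(e, e') \<in> dim_equiv V Tr A" "(e', e'') \<in> dim_equiv V Tr A"
    then obtain \<tau> \<tau>' where t: "e \<in> A" "e'' \<in> A" "\<tau> \<in> Tr" "\<tau>' \<in> Tr"
      "\<forall>x\<in>V. e' (\<tau> x) = e x" "\<forall>x\<in>V. e'' (\<tau>' x) = e' x" by (auto simp: dim_equiv_def)
    obtain \<sigma> where "\<sigma> \<in> Tr" "\<forall>x\<in>V. \<sigma> x = \<tau>' (\<tau> x)" using comp[OF t(3,4)] by blast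
    with t closed[OF t(3)] show "(e, e'') \<in> dim_equiv V Tr A"
      by (auto simp: dim_equiv_def intro!: bexI[of _ \<sigma>])
  qed
qed

lemma class_reps_some:
  assumes "equiv A (dim_equiv V Tr A)" "c \<in> A // dim_equiv V Tr A"
  shows "(SOME e. e \<in> c) \<in> c"
  using in_quotient_imp_non_empty[OF assms] some_in_eq by blast

lemma class_reps_subset:
  assumes "equiv A (dim_equiv V Tr A)"
  shows "class_reps V Tr A \<subseteq> A"
  using class_reps_some[OF assms] in_quotient_imp_subset[OF assms] unfolding class_reps_def by blast

lemma class_reps_ex:
  assumes eq: "equiv A (dim_equiv V Tr A)" and e: "e \<in> A"
  shows "\<exists>e'\<in>class_reps V Tr A. (e, e') \<in> dim_equiv V Tr A"
proof -
  let ?c = "dim_equiv V Tr A `` {e}"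
  have c: "?c \<in> A // dim_equiv V Tr A" using e by (rule quotientI)
  from class_reps_some[OF eq c] have "(e, SOME e. e \<in> ?c) \<in> dim_equiv V Tr A" by simp
  with c show ?thesis unfolding class_reps_def by blast
qed

lemma class_reps_unique:
  assumes eq: "equiv A (dim_equiv V Tr A)"
    and "e \<in> class_reps V Tr A" "e' \<in> class_reps V Tr A" "(e, e') \<in> dim_equiv V Tr A"
  shows "e = e'"
proof -
  from assms(2,3) obtain c c' where c: "c \<in> A // dim_equiv V Tr A" "e = (SOME e. e \<in> c)"
    "c' \<in> A // dim_equiv V Tr A" "e' = (SOME e. e \<in> c')" unfolding class_reps_def by blast
  hence "e \<in> c" "e' \<in> c'" using class_reps_some[OF eq] by auto
  with c assms(4) have "c = c'" using quotient_eqI[OF eq c(1,3)] by blast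
  with c show ?thesis by simp
qed

section \<open>Iterated universal abelian covering quivers\<close>

lemma carrier_free_Abelian_group_iff:
  "z \<in> carrier (free_Abelian_group S) \<longleftrightarrow> Poly_Mapping.keys z \<subseteq> S"
  by (simp add: carrier_free_Abelian_group_iff)

lemma cov_lift_inject: "cov_lift x z = cov_lift x' z' \<longleftrightarrow> x = x' \<and> z = z'"
  by (metis cov_base_lift cov_coord_lift)

lemma fst_cov_lift [simp]: "fst (cov_lift x z) = fst x"
  by (simp add: cov_lift_def)

lemma fst_cov_base [simp]: "fst (cov_base x) = fst x"
  by (simp add: cov_base_def)

lemma verts_abelian_cover:
  "y \<in> verts (abelian_cover G) \<longleftrightarrow> (\<exists>x z. y = cov_lift x z \<and> x \<in> verts G \<and> z \<in> carrier (free_Abelian_group (arcs G)))"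
  by (auto simp: abelian_cover_def)

lemma arcs_abelian_cover:
  "b \<in> arcs (abelian_cover G) \<longleftrightarrow> (\<exists>\<beta> z. b = cov_lift \<beta> z \<and> \<beta> \<in> arcs G \<and> z \<in> carrier (free_Abelian_group (arcs G)))"
  by (auto simp: abelian_cover_def)

lemma tail_abelian_cover [simp]: "tail (abelian_cover G) (cov_lift \<beta> z) = cov_lift (tail G \<beta>) z"
  by (simp add: abelian_cover_def)

lemma head_abelian_cover [simp]:
  "head (abelian_cover G) (cov_lift \<beta> z) = cov_lift (head G \<beta>) (z + Poly_Mapping.single \<beta> 1)"
  by (simp add: abelian_cover_def)

lemma add_carrier:
  "z \<in> carrier (free_Abelian_group S) \<Longrightarrow> w \<in> carrier (free_Abelian_group S) \<Longrightarrow>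
    z + w \<in> carrier (free_Abelian_group S)"
  using keys_add[of z w] by (auto simp: carrier_free_Abelian_group_iff)

lemma single_carrier: "\<beta> \<in> S \<Longrightarrow> Poly_Mapping.single \<beta> 1 \<in> carrier (free_Abelian_group S)"
  by (simp add: carrier_free_Abelian_group_iff)

lemma uminus_carrier:
  "z \<in> carrier (free_Abelian_group S) \<Longrightarrow> - z \<in> carrier (free_Abelian_group S)"
  by (simp add: carrier_free_Abelian_group_iff)

lemma zero_carrier: "0 \<in> carrier (free_Abelian_group S)"
  by (simp add: carrier_free_Abelian_group_iff)

lemma wf_iterated_cover:
  assumes "wf_digraph Q"
  shows "wf_digraph (iterated_cover Q k)"
proof (induction k)
  case 0
  thus ?case using assms by (auto simp: wf_digraph_def)
next
  case (Suc k)
  let ?G = "iterated_cover Q k"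
  show ?case
    unfolding wf_digraph_def
  proof (intro allI impI conjI)
    fix b assume "b \<in> arcs (iterated_cover Q (Suc k))"
    then obtain \<beta> z where b: "b = cov_lift \<beta> z" "\<beta> \<in> arcs ?G" "z \<in> carrier (free_Abelian_group (arcs ?G))"
      by (auto simp: arcs_abelian_cover)
    note wf = wf_digraph.tail_in_verts[OF Suc b(2)] wf_digraph.head_in_verts[OF Suc b(2)]
    show "tail (iterated_cover Q (Suc k)) b \<in> verts (iterated_cover Q (Suc k))"
      unfolding iterated_cover.simps b(1) tail_abelian_cover verts_abelian_cover using b(3) wf by blast
    show "head (iterated_cover Q (Suc k)) b \<in> verts (iterated_cover Q (Suc k))"
      unfolding iterated_cover.simps b(1) head_abelian_cover verts_abelian_cover
      using add_carrier[OF b(3) single_carrier[OF b(2)]] wf by blast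
  qed
qed

text \<open>
  The list of labels of an arrow agrees with that of its tail. Hence an arrow is determined by its tail
  and the arrow of \<open>Q\<close> below it.
\<close>

lemma iterated_cover_over_Q:
  "b \<in> arcs (iterated_cover Q k) \<Longrightarrow> fst b \<in> arcs Q \<and>
     tail (iterated_cover Q k) b = (tail Q (fst b), snd b) \<and>
     fst (head (iterated_cover Q k) b) = head Q (fst b)"
proof (induction k arbitrary: b)
  case 0
  thus ?case by auto
next
  case (Suc k)
  then obtain \<beta> z where b: "b = cov_lift \<beta> z" "\<beta> \<in> arcs (iterated_cover Q k)"
    by (auto simp: arcs_abelian_cover)
  with Suc.IH[OF b(2)] show ?case by (simp add: cov_lift_def[of "tail _ _"]) (simp add: cov_lift_def)
qed

lemma iterated_cover_arcs_inj:
  assumes "b \<in> arcs (iterated_cover Q k)" "b' \<in> arcs (iterated_cover Q k)" "fst b = fst b'"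
    "tail (iterated_cover Q k) b = tail (iterated_cover Q k) b'"
  shows "b = b'"
  using iterated_cover_over_Q[OF assms(1)] iterated_cover_over_Q[OF assms(2)] assms(3,4)
  by (simp add: prod_eq_iff)

lemma arrow_rel_iterated_cover:
  "arrow_rel (iterated_cover Q k) x a y \<longleftrightarrow> (a, snd x) \<in> arcs (iterated_cover Q k) \<and>
     x = (tail Q a, snd x) \<and> y = head (iterated_cover Q k) (a, snd x)"
proof
  assume "arrow_rel (iterated_cover Q k) x a y"
  then obtain b where b: "b \<in> arcs (iterated_cover Q k)" "fst b = a" "tail (iterated_cover Q k) b = x"
    "head (iterated_cover Q k) b = y" by (auto simp: arrow_rel_def)
  hence "x = (tail Q a, snd b)" "b = (a, snd x)" using iterated_cover_over_Q[OF b(1)] by (auto simp: prod_eq_iff)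
  with b show "(a, snd x) \<in> arcs (iterated_cover Q k) \<and>
     x = (tail Q a, snd x) \<and> y = head (iterated_cover Q k) (a, snd x)" by (metis snd_conv)
next
  assume *: "(a, snd x) \<in> arcs (iterated_cover Q k) \<and>
     x = (tail Q a, snd x) \<and> y = head (iterated_cover Q k) (a, snd x)"
  hence "tail (iterated_cover Q k) (a, snd x) = x"
    using iterated_cover_over_Q[of "(a, snd x)"] by (metis fst_conv snd_conv)
  with * show "arrow_rel (iterated_cover Q k) x a y"
    unfolding arrow_rel_def by (intro bexI[of _ "(a, snd x)"] conjI) (simp_all only: fst_conv)
qed

lemma arrow_rel_0:
  "arrow_rel (iterated_cover Q 0) x a y \<longleftrightarrow> a \<in> arcs Q \<and> x = (tail Q a, []) \<and> y = (head Q a, [])"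
  by (auto simp: arrow_rel_def)

text \<open>
  Along an edge with label \<open>a\<close> starting over \<open>x0\<close>, the coordinate increases by the generator of the
  arrow \<open>(a, snd x0)\<close> of the previous covering.
\<close>

lemma arrow_rel_Suc:
  "arrow_rel (iterated_cover Q (Suc k)) x a y \<longleftrightarrow>
     (\<exists>x0 y0 z. arrow_rel (iterated_cover Q k) x0 a y0 \<and>
        z \<in> carrier (free_Abelian_group (arcs (iterated_cover Q k))) \<and>
        x = cov_lift x0 z \<and> y = cov_lift y0 (z + Poly_Mapping.single (a, snd x0) 1))"
    (is "?L \<longleftrightarrow> ?R")
proof
  assume ?L
  then obtain b where b: "b \<in> arcs (iterated_cover Q (Suc k))" "fst b = a"
    "tail (iterated_cover Q (Suc k)) b = x" "head (iterated_cover Q (Suc k)) b = y"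
    by (auto simp: arrow_rel_def)
  then obtain \<beta> z where \<beta>: "b = cov_lift \<beta> z" "\<beta> \<in> arcs (iterated_cover Q k)"
    "z \<in> carrier (free_Abelian_group (arcs (iterated_cover Q k)))" by (auto simp: arcs_abelian_cover)
  moreover from this iterated_cover_over_Q[OF \<beta>(2)] b(2)
  have "\<beta> = (a, snd (tail (iterated_cover Q k) \<beta>))" by (simp add: prod_eq_iff)
  moreover have "arrow_rel (iterated_cover Q k) (tail (iterated_cover Q k) \<beta>) a (head (iterated_cover Q k) \<beta>)"
    using \<beta> b(2) by (auto simp: arrow_rel_def)
  ultimately show ?R using b
    by (intro exI[of _ "tail (iterated_cover Q k) \<beta>"] exI[of _ "head (iterated_cover Q k) \<beta>"] exI[of _ z]) auto
next
  assume ?R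
  then obtain x0 y0 z where *: "arrow_rel (iterated_cover Q k) x0 a y0"
    "z \<in> carrier (free_Abelian_group (arcs (iterated_cover Q k)))"
    "x = cov_lift x0 z" "y = cov_lift y0 (z + Poly_Mapping.single (a, snd x0) 1)" by blast
  then obtain \<beta> where \<beta>: "\<beta> \<in> arcs (iterated_cover Q k)" "fst \<beta> = a" "tail (iterated_cover Q k) \<beta> = x0"
    "head (iterated_cover Q k) \<beta> = y0" by (auto simp: arrow_rel_def)
  with iterated_cover_over_Q[OF \<beta>(1)] have "\<beta> = (a, snd x0)" by (auto simp: prod_eq_iff)
  with * \<beta> show ?L
    unfolding arrow_rel_def by (intro bexI[of _ "cov_lift \<beta> z"]) (auto simp: arcs_abelian_cover)
qed

lemma deterministic_iterated_cover: "deterministic (arrow_rel (iterated_cover Q k))"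
proof (induction k)
  case 0
  show ?case unfolding deterministic_def arrow_rel_0 by auto
next
  case (Suc k)
  show ?case
    unfolding deterministic_def
  proof (intro conjI allI impI)
    fix x a y y'
    assume "arrow_rel (iterated_cover Q (Suc k)) x a y \<and> arrow_rel (iterated_cover Q (Suc k)) x a y'"
    thus "y = y'" by (metis arrow_rel_iterated_cover)
  next
    fix x x' a y
    assume "arrow_rel (iterated_cover Q (Suc k)) x a y \<and> arrow_rel (iterated_cover Q (Suc k)) x' a y"
    then obtain x0 y0 z x0' y0' z' where *: "arrow_rel (iterated_cover Q k) x0 a y0"
      "arrow_rel (iterated_cover Q k) x0' a y0'" "x = cov_lift x0 z" "x' = cov_lift x0' z'"
      "y = cov_lift y0 (z + Poly_Mapping.single (a, snd x0) 1)"
      "y = cov_lift y0' (z' + Poly_Mapping.single (a, snd x0') 1)"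
      unfolding arrow_rel_Suc by blast
    from *(5,6) have "y0 = y0'" by (simp add: cov_lift_inject)
    with *(1,2) Suc have "x0 = x0'" unfolding deterministic_def by blast
    with * show "x = x'" by (simp add: cov_lift_inject)
  qed
qed

section \<open>Supports on high iterated coverings\<close>

lemma in_dim_vectors: "e \<in> dim_vectors G \<longleftrightarrow> finite (support e) \<and> support e \<subseteq> verts G"
  by (simp add: dim_vectors_def support_def)

lemma equiv_cov_translations:
  "equiv A (dim_equiv (verts (iterated_cover Q (Suc k))) (cov_translations Q k) A)"
proof (rule equiv_dim_equiv)
  let ?V = "verts (iterated_cover Q (Suc k))" and ?F = "carrier (free_Abelian_group (arcs (iterated_cover Q k)))"
  let ?\<tau> = "\<lambda>w y. cov_lift (cov_base y) (w + cov_coord y)"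
  have Tr: "\<tau> \<in> cov_translations Q k \<longleftrightarrow> (\<exists>w\<in>?F. \<tau> = ?\<tau> w)" for \<tau>
    unfolding cov_translations_def by blast
  have V: "y \<in> ?V \<longleftrightarrow> (\<exists>x z. y = cov_lift x z \<and> x \<in> verts (iterated_cover Q k) \<and> z \<in> ?F)" for y
    by (simp add: verts_abelian_cover)
  show "\<exists>\<tau>\<in>cov_translations Q k. \<forall>x\<in>?V. \<tau> x = x"
  proof (intro bexI[of _ "?\<tau> 0"] ballI)
    fix x assume "x \<in> ?V"
    then obtain x0 z where "x = cov_lift x0 z" unfolding V by blast
    thus "?\<tau> 0 x = x" by simp
  next
    show "?\<tau> 0 \<in> cov_translations Q k" unfolding Tr using zero_carrier by blast
  qed
  show "\<tau> x \<in> ?V" if "\<tau> \<in> cov_translations Q k" "x \<in> ?V" for \<tau> x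
  proof -
    from that obtain w x0 z where *: "w \<in> ?F" "\<tau> = ?\<tau> w" "x = cov_lift x0 z"
      "x0 \<in> verts (iterated_cover Q k)" "z \<in> ?F" unfolding Tr V by blast
    show ?thesis
      unfolding V using * add_carrier[OF *(1,5)] by (intro exI[of _ x0] exI[of _ "w + z"]) simp
  qed
  show "\<exists>\<tau>'\<in>cov_translations Q k. \<forall>x\<in>?V. \<tau> (\<tau>' x) = x" if t: "\<tau> \<in> cov_translations Q k" for \<tau>
  proof -
    from t obtain w where w: "w \<in> ?F" "\<tau> = ?\<tau> w" unfolding Tr by blast
    show ?thesis
    proof (intro bexI[of _ "?\<tau> (- w)"] ballI)
      fix x assume "x \<in> ?V"
      then obtain x0 z where "x = cov_lift x0 z" unfolding V by blast
      thus "\<tau> (?\<tau> (- w) x) = x" by (simp add: w(2))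
    next
      show "?\<tau> (- w) \<in> cov_translations Q k" unfolding Tr using uminus_carrier[OF w(1)] by blast
    qed
  qed
  show "\<exists>\<sigma>\<in>cov_translations Q k. \<forall>x\<in>?V. \<sigma> x = \<tau>' (\<tau> x)"
    if t: "\<tau> \<in> cov_translations Q k" "\<tau>' \<in> cov_translations Q k" for \<tau> \<tau>'
  proof -
    from t obtain w w' where w: "w \<in> ?F" "\<tau> = ?\<tau> w" "w' \<in> ?F" "\<tau>' = ?\<tau> w'" unfolding Tr by blast
    show ?thesis
    proof (intro bexI[of _ "?\<tau> (w' + w)"] ballI)
      fix x assume "x \<in> ?V"
      show "?\<tau> (w' + w) x = \<tau>' (\<tau> x)" by (simp add: w(2,4) add.assoc)
    next
      show "?\<tau> (w' + w) \<in> cov_translations Q k" unfolding Tr using add_carrier[OF w(3,1)] by blast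
    qed
  qed
qed

lemma iterated_dims_SucD:
  assumes "e \<in> iterated_dims Q d (Suc k)"
  shows "e \<in> dim_vectors (iterated_cover Q (Suc k)) \<and> (\<exists>e'\<in>iterated_dims Q d k. compatible cov_base e e')"
proof -
  have "e \<in> {e \<in> dim_vectors (iterated_cover Q (Suc k)). \<exists>e'\<in>iterated_dims Q d k. compatible cov_base e e'}"
    using assms class_reps_subset[OF equiv_cov_translations] unfolding iterated_dims.simps by blast
  thus ?thesis by blast
qed

lemma iterated_dims_in_dim_vectors:
  assumes "d \<in> dim_vectors Q" "e \<in> iterated_dims Q d k"
  shows "e \<in> dim_vectors (iterated_cover Q k)"
proof (cases k)
  case 0
  have "support e = support d \<times> {[]}" using assms(2) 0 by (auto simp: support_def)
  with assms(1) 0 show ?thesis by (auto simp: in_dim_vectors)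
qed (use iterated_dims_SucD assms in blast)

lemma iterated_dims_compatible:
  assumes "d \<in> dim_vectors Q"
  shows "e \<in> iterated_dims Q d k \<Longrightarrow> compatible fst e d"
proof (induction k arbitrary: e)
  case 0
  hence e: "e = (\<lambda>x. if snd x = [] then d (fst x) else 0)" by simp
  show ?case
    unfolding compatible_def
  proof
    fix q
    have "{x. e x \<noteq> 0 \<and> fst x = q} = (if d q \<noteq> 0 then {(q, [])} else {})"
      unfolding e by (auto split: if_splits)
    thus "d q = (\<Sum>x | e x \<noteq> 0 \<and> fst x = q. e x)" by (simp add: e)
  qed
next
  case (Suc k)
  then obtain e' where e': "e \<in> dim_vectors (iterated_cover Q (Suc k))" "e' \<in> iterated_dims Q d k"
    "compatible cov_base e e'" using iterated_dims_SucD by blast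
  have "compatible (fst \<circ> cov_base) e d"
    by (rule compatible_comp[OF _ e'(3) Suc.IH[OF e'(2)]]) (use e'(1) in \<open>simp add: in_dim_vectors\<close>)
  thus ?case by (rule compatible_cong) simp
qed

text \<open>
  Induction over the levels. If the support below is a forest, so is the one above, as covering maps
  preserve words. Otherwise either two vertices of the support above have the same image, and there
  is at least one more vertex, or the vertices are separated by their images and the coordinates rule
  out cycles.
\<close>

lemma support_forest_or_large:
  "e \<in> iterated_dims Q d k \<Longrightarrow>
     is_forest (restrict_to (support e) (arrow_rel (iterated_cover Q k))) \<or> k \<le> card (support e)"
proof (induction k arbitrary: e)
  case (Suc k)
  then obtain e' where e': "e \<in> dim_vectors (iterated_cover Q (Suc k))" "e' \<in> iterated_dims Q d k"
    "compatible cov_base e e'" using iterated_dims_SucD by blast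
  let ?E = "restrict_to (support e) (arrow_rel (iterated_cover Q (Suc k)))"
    and ?E' = "restrict_to (support e') (arrow_rel (iterated_cover Q k))"
  have fin: "finite (support e)" using e'(1) by (simp add: in_dim_vectors)
  have supp: "support e' = cov_base ` support e" by (rule compatible_support[OF fin e'(3)])
  have hom: "?E' (cov_base x) a (cov_base y) \<and>
      cov_coord y = cov_coord x + Poly_Mapping.single (a, snd (cov_base x)) 1" if "?E x a y" for x a y
    using that unfolding restrict_to_def arrow_rel_Suc supp by auto
  from Suc.IH[OF e'(2)] show ?case
  proof
    assume "is_forest ?E'"
    hence "is_forest ?E" by (rule forest_map[where f = cov_base and E' = ?E', rotated]) (use hom in blast)
    thus ?thesis ..
  next
    assume k: "k \<le> card (support e')"
    show ?thesis
    proof (cases "inj_on cov_base (support e)")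
      case True
      have "is_forest ?E"
      proof (rule forest_if_abelian_coordinates[where c = cov_coord and \<eta> = "\<lambda>x a. (a, snd (cov_base x))"])
        show "deterministic ?E" by (intro deterministic_restrict deterministic_iterated_cover)
        fix x a y x' a' y' assume E: "?E x a y" "?E x' a' y'"
          "(a, snd (cov_base x)) = (a', snd (cov_base x'))"
        with hom[OF E(1)] hom[OF E(2)] have "cov_base x = cov_base x'"
          unfolding restrict_to_def arrow_rel_iterated_cover by (metis prod.inject)
        with True E show "x = x' \<and> a = a'" by (auto simp: restrict_to_def inj_on_def)
      qed (use hom in blast)
      thus ?thesis ..
    next
      case False
      hence "card (support e') \<noteq> card (support e)" using eq_card_imp_inj_on[OF fin] supp by metis
      moreover have "card (support e') \<le> card (support e)" unfolding supp by (rule card_image_le[OF fin])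
      ultimately show ?thesis using k by linarith
    qed
  qed
qed simp

lemma support_forest:
  assumes d: "d \<in> dim_vectors Q" and e: "e \<in> iterated_dims Q d k" and k: "k > sum d (support d)"
  shows "is_forest (restrict_to (support e) (arrow_rel (iterated_cover Q k)))"
proof -
  have fin: "finite (support e)"
    using iterated_dims_in_dim_vectors[OF d e] by (simp add: in_dim_vectors)
  have "card (support e) \<le> sum d (support d)"
    using card_support_le_total[OF fin] compatible_total[OF fin iterated_dims_compatible[OF d e]] by simp
  with support_forest_or_large[OF e] k show ?thesis by linarith
qed

section \<open>Isomorphic supports\<close>

text \<open>
  An isomorphism over the base quiver between the full subgraphs on the supports of two dimension
  vectors, possibly on different coverings.
\<close>

definition support_corr ::
  "('q \<times> 'l \<Rightarrow> 'a \<Rightarrow> 'q \<times> 'l \<Rightarrow> bool) \<Rightarrow> ('q \<times> 'l \<Rightarrow> nat) \<Rightarrow>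
   ('q \<times> 'm \<Rightarrow> 'a \<Rightarrow> 'q \<times> 'm \<Rightarrow> bool) \<Rightarrow> ('q \<times> 'm \<Rightarrow> nat) \<Rightarrow> ('q \<times> 'l \<Rightarrow> 'q \<times> 'm) \<Rightarrow> bool"
where
  "support_corr E1 e1 E2 e2 f \<longleftrightarrow> bij_betw f (support e1) (support e2) \<and>
     (\<forall>x\<in>support e1. e2 (f x) = e1 x \<and> fst (f x) = fst x) \<and>
     (\<forall>x\<in>support e1. \<forall>y\<in>support e1. \<forall>a. E1 x a y \<longleftrightarrow> E2 (f x) a (f y))"

lemma support_corr_sym:
  assumes "support_corr E1 e1 E2 e2 f"
  shows "support_corr E2 e2 E1 e1 (inv_into (support e1) f)"
proof -
  let ?g = "inv_into (support e1) f"
  have bij: "bij_betw f (support e1) (support e2)" using assms by (simp add: support_corr_def)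
  have g: "?g y \<in> support e1" "f (?g y) = y" if "y \<in> support e2" for y
    using bij_betw_apply[OF bij_betw_inv_into[OF bij] that] bij_betw_inv_into_right[OF bij that] .
  have "e1 (?g y) = e2 y \<and> fst (?g y) = fst y" if "y \<in> support e2" for y
    using assms g[OF that] unfolding support_corr_def by metis
  moreover have "E2 y a y' \<longleftrightarrow> E1 (?g y) a (?g y')" if "y \<in> support e2" "y' \<in> support e2" for y y' a
    using assms g[OF that(1)] g[OF that(2)] unfolding support_corr_def by metis
  ultimately show ?thesis
    using bij_betw_inv_into[OF bij] unfolding support_corr_def by blast
qed

lemma support_corr_trans:
  assumes "support_corr E1 e1 E2 e2 f" "support_corr E2 e2 E3 e3 g"
  shows "support_corr E1 e1 E3 e3 (g \<circ> f)"
proof -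
  have f: "f x \<in> support e2" if "x \<in> support e1" for x
    using assms(1) that unfolding support_corr_def by (meson bij_betw_apply)
  have "bij_betw (g \<circ> f) (support e1) (support e3)"
    using assms unfolding support_corr_def by (meson bij_betw_trans)
  with assms f show ?thesis unfolding support_corr_def by simp
qed

lemma support_corr_compatible:
  assumes "support_corr E1 e1 E2 e2 f"
  shows "compatible f e1 e2"
  unfolding compatible_def
proof
  fix q
  show "e2 q = (\<Sum>x | e1 x \<noteq> 0 \<and> f x = q. e1 x)"
  proof (cases "q \<in> support e2")
    case True
    with assms obtain x where x: "x \<in> support e1" "q = f x"
      unfolding support_corr_def bij_betw_def by blast
    have "inj_on f (support e1)" using assms by (simp add: support_corr_def bij_betw_def)
    hence "{z \<in> support e1. f z = f x} = {x}" using x(1) unfolding inj_on_def by blast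
    hence "{z. e1 z \<noteq> 0 \<and> f z = q} = {x}" by (simp add: support_def x(2))
    with assms x show ?thesis by (simp add: support_corr_def)
  next
    case False
    with assms have "{z. e1 z \<noteq> 0 \<and> f z = q} = {}"
      by (auto simp: support_corr_def bij_betw_def support_def)
    hence "(\<Sum>x | e1 x \<noteq> 0 \<and> f x = q. e1 x) = 0" by (metis sum.empty)
    with False show ?thesis by (simp add: support_def)
  qed
qed

text \<open>
  A label-preserving map from a connected support onto a forest is an isomorphism of supports. This is
  how the lifts constructed below are recognised as isomorphisms.
\<close>

lemma support_corr_of_hom:
  assumes fin: "finite (support e1)" and det: "deterministic E1" and con: "connected_on (support e1) E1"
    and det': "deterministic E2" and tree: "is_forest (restrict_to (support e2) E2)"
    and comp: "compatible f e1 e2"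
    and hom: "\<And>x a y. restrict_to (support e1) E1 x a y \<Longrightarrow> E2 (f x) a (f y)"
    and fst: "\<And>x. x \<in> support e1 \<Longrightarrow> fst (f x) = fst x"
  shows "support_corr E1 e1 E2 e2 f"
proof -
  let ?E = "restrict_to (support e2) E2"
  have supp: "support e2 = f ` support e1" by (rule compatible_support[OF fin comp])
  have hom': "?E (f x) a (f y)" if "restrict_to (support e1) E1 x a y" for x a y
    using hom[OF that] that supp by (auto simp: restrict_to_def)
  have inj: "inj_on f (support e1)" by (rule forest_hom_inj[OF det con hom' tree])
  have "E1 x a y" if "x \<in> support e1" "y \<in> support e1" "E2 (f x) a (f y)" for x y a
    by (rule forest_hom_full[OF det con hom' deterministic_restrict[OF det'] tree that(1,2)])
      (use that supp in \<open>auto simp: restrict_to_def\<close>)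
  moreover have "E2 (f x) a (f y)" if "x \<in> support e1" "y \<in> support e1" "E1 x a y" for x y a
    using hom that by (auto simp: restrict_to_def)
  ultimately show ?thesis
    using inj supp fst compatible_inj[OF inj comp]
    unfolding support_corr_def bij_betw_def by blast
qed

text \<open>
  Arrows are recovered from their tail and their label, which turns an isomorphism of labelled graphs
  into one of quivers.
\<close>

definition arc_at :: "('v, 'a \<times> 'l) quiver \<Rightarrow> 'v \<Rightarrow> 'a \<Rightarrow> 'a \<times> 'l" where
  "arc_at G x a = (THE b. b \<in> arcs G \<and> fst b = a \<and> tail G b = x)"

definition arcs_determined :: "('v, 'a \<times> 'l) quiver \<Rightarrow> bool" where
  "arcs_determined G \<longleftrightarrow>
     (\<forall>b\<in>arcs G. \<forall>b'\<in>arcs G. fst b = fst b' \<and> tail G b = tail G b' \<longrightarrow> b = b')"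

lemma arc_at:
  assumes "arcs_determined G" "b \<in> arcs G"
  shows "arc_at G (tail G b) (fst b) = b"
  unfolding arc_at_def using assms unfolding arcs_determined_def by (intro the_equality) blast+

lemma support_corr_arc:
  assumes G2: "arcs_determined G2"
    and corr: "support_corr (arrow_rel G1) e1 (arrow_rel G2) e2 f"
    and b: "b \<in> arcs G1" "tail G1 b \<in> support e1" "head G1 b \<in> support e1"
  defines "b' \<equiv> arc_at G2 (f (tail G1 b)) (fst b)"
  shows "b' \<in> arcs G2 \<and> fst b' = fst b \<and> tail G2 b' = f (tail G1 b) \<and> head G2 b' = f (head G1 b)"
proof -
  have "arrow_rel G1 (tail G1 b) (fst b) (head G1 b)" using b(1) by (auto simp: arrow_rel_def)
  with corr b have "arrow_rel G2 (f (tail G1 b)) (fst b) (f (head G1 b))"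
    unfolding support_corr_def by blast
  then obtain c where c: "c \<in> arcs G2" "fst c = fst b" "tail G2 c = f (tail G1 b)" "head G2 c = f (head G1 b)"
    unfolding arrow_rel_def by blast
  with arc_at[OF G2 c(1)] show ?thesis by (simp add: b'_def)
qed

lemma support_corr_moduli:
  fixes G1 :: "('q \<times> 'l, 'a \<times> 'l1) quiver" and G2 :: "('q \<times> 'm, 'a \<times> 'm1) quiver"
  assumes wf: "wf_digraph G1" "wf_digraph G2"
    and det: "arcs_determined G1" "arcs_determined G2"
    and supp: "support e1 \<subseteq> verts G1" "support e2 \<subseteq> verts G2"
    and corr: "support_corr (arrow_rel G1) e1 (arrow_rel G2) e2 f"
  shows "\<exists>\<Phi> \<Psi>. inverse_homs (stable_moduli G1 (\<Theta> \<circ> fst) e1) (stable_moduli G2 (\<Theta> \<circ> fst) e2) \<Phi> \<Psi>"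
proof (rule support_iso_moduli)
  let ?g = "inv_into (support e1) f"
  have corr': "support_corr (arrow_rel G2) e2 (arrow_rel G1) e1 ?g" by (rule support_corr_sym[OF corr])
  have bij: "bij_betw f (support e1) (support e2)" using corr by (simp add: support_corr_def)
  have gf: "?g (f x) = x" if "x \<in> support e1" for x using bij_betw_inv_into_left[OF bij that] .
  have fg: "f (?g y) = y" if "y \<in> support e2" for y using bij_betw_inv_into_right[OF bij that] .
  show "support_iso G1 e1 (\<Theta> \<circ> fst) G2 e2 (\<Theta> \<circ> fst) f ?g
     (\<lambda>b. arc_at G2 (f (tail G1 b)) (fst b)) (\<lambda>b. arc_at G1 (?g (tail G2 b)) (fst b))"
  proof (rule support_iso.intro[OF wf], goal_cases)
    case (1 x) thus ?case using supp(1) by (auto simp: support_def)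
  next
    case (2 y) thus ?case using supp(2) by (auto simp: support_def)
  next
    case (3 x)
    hence x: "x \<in> support e1" by (simp add: support_def)
    with corr gf[OF x] show ?case by (simp add: support_corr_def)
  next
    case (4 y)
    hence y: "y \<in> support e2" by (simp add: support_def)
    with corr' fg[OF y] show ?case by (simp add: support_corr_def)
  next
    case (5 b)
    hence t: "tail G1 b \<in> support e1" "head G1 b \<in> support e1" by (simp_all add: support_def)
    from support_corr_arc[OF det(2) corr 5(1) t] gf[OF t(1)] arc_at[OF det(1) 5(1)]
    show ?case by simp
  next
    case (6 b)
    hence t: "tail G2 b \<in> support e2" "head G2 b \<in> support e2" by (simp_all add: support_def)
    from support_corr_arc[OF det(1) corr' 6(1) t] fg[OF t(1)] arc_at[OF det(2) 6(1)]
    show ?case by simp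
  qed
qed

section \<open>Translations\<close>

lemma path_invariant:
  assumes "\<And>x a y. E x a y \<Longrightarrow> P x \<longleftrightarrow> P y" "path E x w y"
  shows "P x \<longleftrightarrow> P y"
  using assms(2)
proof (induction w arbitrary: x)
  case (Cons l w)
  then obtain z where z: "step E x l z" "path E z w y" by auto
  have "P x \<longleftrightarrow> P z" using z(1) assms(1) by (cases l) (auto split: if_splits)
  with Cons.IH[OF z(2)] show ?case by simp
qed simp

text \<open>
  Push-forward along a permutation of the vertices is the translate, so the equivalence of dimension
  vectors can be expressed by \<open>compatible\<close> and combined with the rules for compositions.
\<close>

lemma compatible_translation_iff:
  assumes bij: "bij_betw \<tau> V V" and supp: "support e \<subseteq> V" "support e' \<subseteq> V"
  shows "compatible \<tau> e e' \<longleftrightarrow> (\<forall>x\<in>V. e' (\<tau> x) = e x)"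
proof -
  have sum: "(\<Sum>y | e y \<noteq> 0 \<and> \<tau> y = \<tau> x. e y) = e x" if x: "x \<in> V" for x
  proof -
    have "y = x" if "e y \<noteq> 0" "\<tau> y = \<tau> x" for y
    proof -
      have "y \<in> V" using that(1) supp(1) by (auto simp: support_def)
      with bij x that(2) show ?thesis unfolding bij_betw_def by (meson inj_onD)
    qed
    hence "(e y \<noteq> 0 \<and> \<tau> y = \<tau> x) = (y = x \<and> e x \<noteq> 0)" for y by metis
    hence "{y. e y \<noteq> 0 \<and> \<tau> y = \<tau> x} = {y. y = x \<and> e x \<noteq> 0}" by (rule Collect_cong)
    also have "\<dots> = (if e x \<noteq> 0 then {x} else {})" by auto
    finally show ?thesis by simp
  qed
  have out: "e' q = (\<Sum>y | e y \<noteq> 0 \<and> \<tau> y = q. e y)" if q: "q \<notin> V" for q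
  proof -
    have "{y. e y \<noteq> 0 \<and> \<tau> y = q} = {}"
      using bij q supp(1) by (auto simp: bij_betw_def support_def)
    hence "(\<Sum>y | e y \<noteq> 0 \<and> \<tau> y = q. e y) = 0" by (metis sum.empty)
    moreover have "e' q = 0" using q supp(2) by (auto simp: support_def)
    ultimately show ?thesis by simp
  qed
  show ?thesis
  proof
    assume "compatible \<tau> e e'"
    with sum show "\<forall>x\<in>V. e' (\<tau> x) = e x" by (simp add: compatible_def)
  next
    assume *: "\<forall>x\<in>V. e' (\<tau> x) = e x"
    show "compatible \<tau> e e'"
      unfolding compatible_def
    proof
      fix q
      show "e' q = (\<Sum>y | e y \<noteq> 0 \<and> \<tau> y = q. e y)"
      proof (cases "q \<in> V")
        case True
        then obtain x where "x \<in> V" "q = \<tau> x" using bij unfolding bij_betw_def by blast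
        with * sum show ?thesis by simp
      qed (rule out)
    qed
  qed
qed

definition cov_translation ::
  "(('a, 'a) cov \<Rightarrow>\<^sub>0 int) \<Rightarrow> ('v, 'a) cov \<Rightarrow> ('v, 'a) cov" where
  "cov_translation w y = cov_lift (cov_base y) (w + cov_coord y)"

lemma cov_translations_eq:
  "cov_translations Q k = cov_translation ` carrier (free_Abelian_group (arcs (iterated_cover Q k)))"
  unfolding cov_translations_def cov_translation_def[abs_def] by blast

lemma cov_translation_lift [simp]: "cov_translation w (cov_lift x z) = cov_lift x (w + z)"
  by (simp add: cov_translation_def)

lemma cov_translation_bij:
  assumes "w \<in> carrier (free_Abelian_group (arcs (iterated_cover Q k)))"
  shows "bij_betw (cov_translation w) (verts (iterated_cover Q (Suc k))) (verts (iterated_cover Q (Suc k)))"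
proof -
  let ?V = "verts (iterated_cover Q (Suc k))"
  have in_V: "cov_translation u y \<in> ?V" and inv: "cov_translation (- u) (cov_translation u y) = y"
    if "u \<in> carrier (free_Abelian_group (arcs (iterated_cover Q k)))" "y \<in> ?V" for u y
  proof -
    from that(2) obtain x z where y: "y = cov_lift x z" "x \<in> verts (iterated_cover Q k)"
      "z \<in> carrier (free_Abelian_group (arcs (iterated_cover Q k)))"
      unfolding iterated_cover.simps verts_abelian_cover by blast
    show "cov_translation u y \<in> ?V"
      unfolding iterated_cover.simps verts_abelian_cover y(1) cov_translation_lift
      using y(2) add_carrier[OF that(1) y(3)] by blast
    show "cov_translation (- u) (cov_translation u y) = y" by (simp add: y(1))
  qed
  show ?thesis
    by (rule bij_betw_byWitness[where f' = "cov_translation (- w)"])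
      (use in_V[OF assms] in_V[OF uminus_carrier[OF assms]] inv[OF assms]
        inv[OF uminus_carrier[OF assms]] in auto)
qed

lemma universal_translation_bij:
  assumes "v \<in> carrier (word_group (arcs Q))"
  shows "bij_betw (\<lambda>(q, w). (q, v \<otimes>\<^bsub>word_group (arcs Q)\<^esub> w)) (verts (universal_cover Q)) (verts (universal_cover Q))"
proof -
  interpret Group.group "word_group (arcs Q)" by (rule group_word_group)
  show ?thesis
    by (rule bij_betw_byWitness[where f' = "\<lambda>(q, w). (q, inv\<^bsub>word_group (arcs Q)\<^esub> v \<otimes>\<^bsub>word_group (arcs Q)\<^esub> w)"])
      (use assms in \<open>auto simp: universal_cover_def m_assoc[symmetric]\<close>)
qed

lemma equiv_universal_translations:
  "equiv A (dim_equiv (verts (universal_cover Q)) (universal_translations Q) A)"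
proof (rule equiv_dim_equiv)
  interpret Group.group "word_group (arcs Q)" by (rule group_word_group)
  let ?W = "word_group (arcs Q)" and ?V = "verts (universal_cover Q)"
  let ?\<tau> = "\<lambda>v (q :: 'a, w). (q, v \<otimes>\<^bsub>?W\<^esub> w)"
  have Tr: "\<tau> \<in> universal_translations Q \<longleftrightarrow> (\<exists>v\<in>carrier ?W. \<tau> = ?\<tau> v)" for \<tau>
    unfolding universal_translations_def by blast
  show "\<exists>\<tau>\<in>universal_translations Q. \<forall>x\<in>?V. \<tau> x = x"
  proof (rule bexI[of _ "?\<tau> \<one>\<^bsub>?W\<^esub>"])
    show "\<forall>x\<in>?V. ?\<tau> \<one>\<^bsub>?W\<^esub> x = x" by (auto simp: universal_cover_def)
    show "?\<tau> \<one>\<^bsub>?W\<^esub> \<in> universal_translations Q" unfolding Tr using one_closed by blast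
  qed
  show "\<tau> x \<in> ?V" if "\<tau> \<in> universal_translations Q" "x \<in> ?V" for \<tau> x
  proof -
    from that(1) obtain v where "v \<in> carrier ?W" "\<tau> = ?\<tau> v" unfolding Tr by blast
    with bij_betw_apply[OF universal_translation_bij that(2)] show ?thesis by blast
  qed
  show "\<exists>\<tau>'\<in>universal_translations Q. \<forall>x\<in>?V. \<tau> (\<tau>' x) = x" if t: "\<tau> \<in> universal_translations Q" for \<tau>
  proof -
    from t obtain v where v: "v \<in> carrier ?W" "\<tau> = ?\<tau> v" unfolding Tr by blast
    show ?thesis
    proof (rule bexI[of _ "?\<tau> (inv\<^bsub>?W\<^esub> v)"])
      show "\<forall>x\<in>?V. \<tau> (?\<tau> (inv\<^bsub>?W\<^esub> v) x) = x"
        using v by (auto simp: universal_cover_def m_assoc[symmetric])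
      show "?\<tau> (inv\<^bsub>?W\<^esub> v) \<in> universal_translations Q" unfolding Tr using v(1) by blast
    qed
  qed
  show "\<exists>\<sigma>\<in>universal_translations Q. \<forall>x\<in>?V. \<sigma> x = \<tau>' (\<tau> x)"
    if t: "\<tau> \<in> universal_translations Q" "\<tau>' \<in> universal_translations Q" for \<tau> \<tau>'
  proof -
    from t obtain v v' where v: "v \<in> carrier ?W" "\<tau> = ?\<tau> v" "v' \<in> carrier ?W" "\<tau>' = ?\<tau> v'"
      unfolding Tr by blast
    show ?thesis
    proof (rule bexI[of _ "?\<tau> (v' \<otimes>\<^bsub>?W\<^esub> v)"])
      show "\<forall>x\<in>?V. ?\<tau> (v' \<otimes>\<^bsub>?W\<^esub> v) x = \<tau>' (\<tau> x)"
        using v by (auto simp: universal_cover_def m_assoc)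
      show "?\<tau> (v' \<otimes>\<^bsub>?W\<^esub> v) \<in> universal_translations Q" unfolding Tr using v(1,3) by blast
    qed
  qed
qed

lemma universal_dimsD:
  assumes "e \<in> universal_dims Q d"
  shows "e \<in> dim_vectors (universal_cover Q)" "compatible fst e d"
  using class_reps_subset[OF equiv_universal_translations] assms unfolding universal_dims_def by blast+

lemma compatible_empty_support:
  assumes "support e = {}" "compatible f e e'"
  shows "e' = (\<lambda>_. 0)"
proof
  fix q
  have "{x. e x \<noteq> 0 \<and> f x = q} = {}" using assms(1) by (auto simp: support_def)
  thus "e' q = 0" using assms(2) unfolding compatible_def by (metis sum.empty)
qed

section \<open>Comparison of dimension vectors\<close>

text \<open>
  Two maps \<open>f\<close>, \<open>f'\<close> of a connected labelled graph to the same iterated covering, whose push-forwards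
  are both chosen representatives, coincide. By induction they agree after projection to the previous
  level, so they differ by a translation. Then the push-forwards are equivalent, hence equal as
  representatives, and the translation preserves a finite nonempty set of vertices. As the free abelian
  group is torsion-free, the translation is trivial.
\<close>

lemma iterated_lift_unique:
  fixes Q :: "('v, 'a) quiver"
  assumes d: "d \<in> dim_vectors Q" and fin: "finite (support \<epsilon>)" and con: "connected_on (support \<epsilon>) E"
  shows "e \<in> iterated_dims Q d k \<Longrightarrow> e' \<in> iterated_dims Q d k \<Longrightarrow>
    compatible f \<epsilon> e \<Longrightarrow> compatible f' \<epsilon> e' \<Longrightarrow>
    (\<And>x a y. restrict_to (support \<epsilon>) E x a y \<Longrightarrow> arrow_rel (iterated_cover Q k) (f x) a (f y)) \<Longrightarrow>
    (\<And>x a y. restrict_to (support \<epsilon>) E x a y \<Longrightarrow> arrow_rel (iterated_cover Q k) (f' x) a (f' y)) \<Longrightarrow>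
    (\<And>x. x \<in> support \<epsilon> \<Longrightarrow> fst (f x) = fst (f' x)) \<Longrightarrow>
    e = e' \<and> (\<forall>x\<in>support \<epsilon>. f x = f' x)"
proof (induction k arbitrary: e e' f f')
  case 0
  have "f x = f' x" if x: "x \<in> support \<epsilon>" for x
  proof -
    have "f x \<in> support e" "f' x \<in> support e'"
      using compatible_support[OF fin] 0(3,4) x by auto
    with 0(1,2) have "snd (f x) = []" "snd (f' x) = []" by (auto simp: support_def split: if_splits)
    with 0(7)[OF x] show ?thesis by (simp add: prod_eq_iff)
  qed
  with 0(1,2) show ?case by simp
next
  case (Suc k)
  let ?G = "iterated_cover Q k" and ?G' = "iterated_cover Q (Suc k)" and ?E = "restrict_to (support \<epsilon>) E"
  let ?V = "verts ?G'" and ?F = "carrier (free_Abelian_group (arcs ?G))"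
  let ?A = "{e \<in> dim_vectors ?G'. \<exists>e'\<in>iterated_dims Q d k. compatible cov_base e e'}"
  note dims = iterated_dims_SucD[OF Suc.prems(1)] iterated_dims_SucD[OF Suc.prems(2)]
  obtain e1 where e1: "e1 \<in> iterated_dims Q d k" "compatible cov_base e e1" using dims(1) by blast
  obtain e1' where e1': "e1' \<in> iterated_dims Q d k" "compatible cov_base e' e1'" using dims(2) by blast
  have supp: "support e = f ` support \<epsilon>" "support e' = f' ` support \<epsilon>"
    using compatible_support[OF fin] Suc.prems(3,4) by auto
  have V: "support e \<subseteq> ?V" "support e' \<subseteq> ?V" using dims by (auto simp: in_dim_vectors)
  have base: "cov_base (f x) = cov_base (f' x)" if "x \<in> support \<epsilon>" for x
  proof -
    have "e1 = e1' \<and> (\<forall>x\<in>support \<epsilon>. (cov_base \<circ> f) x = (cov_base \<circ> f') x)"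
    proof (rule Suc.IH[OF e1(1) e1'(1)])
      show "compatible (cov_base \<circ> f) \<epsilon> e1" by (rule compatible_comp[OF fin Suc.prems(3) e1(2)])
      show "compatible (cov_base \<circ> f') \<epsilon> e1'" by (rule compatible_comp[OF fin Suc.prems(4) e1'(2)])
    next
      fix x a y assume "?E x a y"
      from Suc.prems(5)[OF this] show "arrow_rel ?G ((cov_base \<circ> f) x) a ((cov_base \<circ> f) y)"
        unfolding arrow_rel_Suc by auto
    next
      fix x a y assume "?E x a y"
      from Suc.prems(6)[OF this] show "arrow_rel ?G ((cov_base \<circ> f') x) a ((cov_base \<circ> f') y)"
        unfolding arrow_rel_Suc by auto
    qed (use Suc.prems(7) in simp)
    with that show ?thesis by simp
  qed
  have V_lift: "y = cov_lift (cov_base y) (cov_coord y)" "cov_coord y \<in> ?F" if "y \<in> ?V" for y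
    using that unfolding iterated_cover.simps verts_abelian_cover by auto
  show ?case
  proof (cases "support \<epsilon> = {}")
    case True
    with compatible_empty_support[OF True Suc.prems(3)] compatible_empty_support[OF True Suc.prems(4)]
    show ?thesis by simp
  next
    case False
    then obtain x0 where x0: "x0 \<in> support \<epsilon>" by blast
    define w where "w = cov_coord (f' x0) - cov_coord (f x0)"
    have fV: "f x \<in> ?V" "f' x \<in> ?V" if "x \<in> support \<epsilon>" for x using that V supp by auto
    have w: "w \<in> ?F"
      using add_carrier[OF V_lift(2)[OF fV(2)[OF x0]] uminus_carrier[OF V_lift(2)[OF fV(1)[OF x0]]]]
      by (simp add: w_def)
    have coord: "cov_coord (f' x) = w + cov_coord (f x)" if x: "x \<in> support \<epsilon>" for x
    proof -
      obtain u where u: "path ?E x0 u x" using con x0 x unfolding connected_on_def by blast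
      have "(cov_coord (f' x0) = w + cov_coord (f x0)) \<longleftrightarrow> (cov_coord (f' x) = w + cov_coord (f x))"
      proof (rule path_invariant[OF _ u, where P = "\<lambda>x. cov_coord (f' x) = w + cov_coord (f x)"])
        fix x a y assume E: "?E x a y"
        hence "x \<in> support \<epsilon>" by (simp add: restrict_to_def)
        hence b: "cov_base (f x) = cov_base (f' x)" by (rule base)
        have "cov_coord (f y) = cov_coord (f x) + Poly_Mapping.single (a, snd (cov_base (f x))) 1"
          using Suc.prems(5)[OF E] unfolding arrow_rel_Suc by auto
        moreover have "cov_coord (f' y) = cov_coord (f' x) + Poly_Mapping.single (a, snd (cov_base (f x))) 1"
          using Suc.prems(6)[OF E] unfolding arrow_rel_Suc b by auto
        ultimately show "(cov_coord (f' x) = w + cov_coord (f x)) \<longleftrightarrow> (cov_coord (f' y) = w + cov_coord (f y))"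
          by (simp flip: add.assoc)
      qed
      thus ?thesis by (simp add: w_def)
    qed
    have f': "f' x = cov_translation w (f x)" if "x \<in> support \<epsilon>" for x
      unfolding cov_translation_def using coord[OF that] base[OF that] V_lift(1)[OF fV(2)[OF that]] by simp
    have bij: "bij_betw (cov_translation w) ?V ?V" by (rule cov_translation_bij[OF w])
    have "compatible (cov_translation w \<circ> f) \<epsilon> e'"
      by (rule compatible_cong[OF Suc.prems(4)]) (simp add: f')
    hence "compatible (cov_translation w) e e'"
      by (rule compatible_factor[OF fin Suc.prems(3)])
    hence "\<forall>y\<in>?V. e' (cov_translation w y) = e y"
      using compatible_translation_iff[OF bij V] by blast
    moreover have "cov_translation w \<in> cov_translations Q k" using w by (simp add: cov_translations_eq)
    moreover have "e \<in> ?A" "e' \<in> ?A" using dims by simp_all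
    ultimately have "(e, e') \<in> dim_equiv ?V (cov_translations Q k)
 ?A"
      unfolding dim_equiv_iff by blast
    hence ee': "e = e'"
      by (rule class_reps_unique[OF equiv_cov_translations, rotated 2])
        (use Suc.prems(1,2) in simp_all)
    \<comment> \<open>Summing a coordinate over the support, which the translation permutes, gives \<open>card ?S * w = 0\<close>.\<close>
    have "w = 0"
    proof (rule poly_mapping_eqI)
      fix i
      let ?S = "support e" and ?h = "\<lambda>y :: ('v, 'a) cov. Poly_Mapping.lookup (cov_coord y) i"
      have finS: "finite ?S" using fin supp by simp
      have "cov_translation w ` ?S = ?S"
        using supp f' ee' by (auto simp: image_image)
      moreover have "inj_on (cov_translation w) ?S"
        using bij V(1) unfolding bij_betw_def by (blast intro: inj_on_subset)
      ultimately have "(\<Sum>y\<in>?S. ?h y) = (\<Sum>y\<in>?S. ?h (cov_translation w y))"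
        using sum.reindex[of "cov_translation w" ?S ?h] by simp
      also have "\<dots> = of_nat (card ?S) * Poly_Mapping.lookup w i + (\<Sum>y\<in>?S. ?h y)"
        by (simp add: cov_translation_def lookup_add sum.distrib)
      finally have "card ?S = 0 \<or> Poly_Mapping.lookup w i = 0" by simp
      with finS x0 supp show "Poly_Mapping.lookup w i = Poly_Mapping.lookup 0 i" by auto
    qed
    have "f x = f' x" if "x \<in> support \<epsilon>" for x
      using f'[OF that] V_lift(1)[OF fV(1)[OF that]] by (simp add: \<open>w = 0\<close> cov_translation_def)
    with ee' show ?thesis by blast
  qed
qed

text \<open>
  The support in the universal covering is a tree and is lifted level by level; the coordinate at the
  next level is a potential with values in the free abelian group. After each lift it is translated so that
  its push-forward becomes the chosen representative. For small \<open>k\<close> the lift need not be injective.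
\<close>

lemma universal_to_iterated:
  fixes Q :: "('v, 'a) quiver"
  assumes d: "d \<in> dim_vectors Q" and \<epsilon>: "\<epsilon> \<in> dim_vectors (universal_cover Q)" "compatible fst \<epsilon> d"
    and con: "connected_on (support \<epsilon>) (arrow_rel (universal_cover Q))"
  shows "\<exists>e\<in>iterated_dims Q d k. \<exists>f. compatible f \<epsilon> e \<and> (\<forall>x\<in>support \<epsilon>. fst (f x) = fst x) \<and>
    (\<forall>x a y. restrict_to (support \<epsilon>) (arrow_rel (universal_cover Q)) x a y \<longrightarrow>
       arrow_rel (iterated_cover Q k) (f x) a (f y))"
proof -
  have fin: "finite (support \<epsilon>)" using \<epsilon> by (simp add: in_dim_vectors)
  show ?thesis
  proof (induction k)
    case 0
    have "compatible (\<lambda>x. (fst x, [] :: 'a label list)) \<epsilon> (\<lambda>x. if snd x = [] then d (fst x) else 0)"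
      unfolding compatible_def
    proof
      fix q :: "('v, 'a) cov"
      show "(if snd q = [] then d (fst q) else 0) = (\<Sum>x | \<epsilon> x \<noteq> 0 \<and> (fst x, []) = q. \<epsilon> x)"
      proof (cases "snd q = []")
        case True
        hence "{x. \<epsilon> x \<noteq> 0 \<and> (fst x, []) = q} = {x. \<epsilon> x \<noteq> 0 \<and> fst x = fst q}"
          by (auto simp: prod_eq_iff)
        with True \<epsilon>(2) show ?thesis by (simp add: compatible_def)
      next
        case False
        hence "{x. \<epsilon> x \<noteq> 0 \<and> (fst x, []) = q} = {}" by auto
        hence "(\<Sum>x | \<epsilon> x \<noteq> 0 \<and> (fst x, []) = q. \<epsilon> x) = 0" by (metis sum.empty)
        with False show ?thesis by simp
      qed
    qed
    moreover have "arrow_rel (iterated_cover Q 0) (fst x, []) a (fst y, [])"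
      if "restrict_to (support \<epsilon>) (arrow_rel (universal_cover Q)) x a y" for x a y
      using that unfolding arrow_rel_0 restrict_to_def arrow_rel_universal_cover by auto
    ultimately show ?case by (intro bexI exI[of _ "\<lambda>x. (fst x, [])"]) auto
  next
    case (Suc k)
    let ?E = "arrow_rel (universal_cover Q)" and ?S = "support \<epsilon>"
    let ?G = "iterated_cover Q k" and ?G' = "iterated_cover Q (Suc k)"
    let ?V = "verts ?G'" and ?F = "carrier (free_Abelian_group (arcs ?G))"
    from Suc obtain e f where e: "e \<in> iterated_dims Q d k" and comp: "compatible f \<epsilon> e"
      and fst: "\<forall>x\<in>?S. fst (f x) = fst x"
      and hom: "\<And>x a y. restrict_to ?S ?E x a y \<Longrightarrow> arrow_rel ?G (f x) a (f y)"
      by blast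
    \<comment> \<open>The change of the coordinate along the lift of the edge \<open>a\<close> starting at \<open>f x\<close>.\<close>
    define T where "T x a (y :: 'v \<times> 'a word set) z = z + Poly_Mapping.single (a, snd (f x)) 1"
      for x y and a :: 'a and z :: "('a, 'a) cov \<Rightarrow>\<^sub>0 int"
    have "bij_betw (T x a y) ?F ?F" if "restrict_to ?S ?E x a y" for x a y
    proof -
      have "(a, snd (f x)) \<in> arcs ?G" using hom[OF that] by (simp add: arrow_rel_iterated_cover)
      hence s: "Poly_Mapping.single (a, snd (f x)) 1 \<in> ?F" by (rule single_carrier)
      show ?thesis
        by (rule bij_betw_byWitness[where f' = "\<lambda>z. z + - Poly_Mapping.single (a, snd (f x)) 1"])
          (use add_carrier[OF _ s] add_carrier[OF _ uminus_carrier[OF s]] in \<open>auto simp: T_def\<close>)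
    qed
    moreover have "is_forest (restrict_to ?S ?E)"
      by (rule forest_restrict[OF forest_universal_cover])
    ultimately obtain c where c: "\<And>x. c x \<in> ?F"
      "\<And>x a y. restrict_to ?S ?E x a y \<Longrightarrow> c y = T x a y (c x)"
      using forest_potential[OF deterministic_universal_cover con, of T ?F 0] zero_carrier by metis
    define f' where "f' x = cov_lift (f x) (c x)" for x
    obtain e' where e': "compatible f' \<epsilon> e'" using ex_compatible by blast
    have supp_e: "support e = f ` ?S" and supp_e': "support e' = f' ` ?S"
      using compatible_support[OF fin] comp e' by auto
    have eV: "support e \<subseteq> verts ?G" using iterated_dims_in_dim_vectors[OF d e] by (simp add: in_dim_vectors)
    have V: "f' ` ?S \<subseteq> ?V"
    proof
      fix y assume "y \<in> f' ` ?S"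
      then obtain x where x: "y = cov_lift (f x) (c x)" "f x \<in> verts ?G"
        using eV supp_e unfolding f'_def by blast
      thus "y \<in> ?V" unfolding iterated_cover.simps verts_abelian_cover using c(1) by blast
    qed
    let ?A = "{e \<in> dim_vectors ?G'. \<exists>e'\<in>iterated_dims Q d k. compatible cov_base e e'}"
    have "compatible (cov_base \<circ> f') \<epsilon> e"
      by (rule compatible_cong[OF comp]) (simp add: f'_def)
    hence "compatible cov_base e' e" by (rule compatible_factor[OF fin e'])
    moreover have "e' \<in> dim_vectors ?G'" using V fin supp_e' by (simp add: in_dim_vectors)
    ultimately have "e' \<in> ?A" using e by blast
    from class_reps_ex[OF equiv_cov_translations[where Q = Q and k = k] this]
    obtain e2 where e2': "e2 \<in> class_reps ?V (cov_translations Q k) ?A"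
      and e2: "(e', e2) \<in> dim_equiv ?V (cov_translations Q k) ?A" by (rule bexE)
    then obtain w where w: "w \<in> ?F" "\<forall>x\<in>?V. e2 (cov_translation w x) = e' x" "e2 \<in> ?A"
      unfolding dim_equiv_iff cov_translations_eq by (elim conjE bexE imageE) simp
    have "support e2 \<subseteq> ?V" "support e' \<subseteq> ?V" using w(3) V supp_e' by (auto simp: in_dim_vectors)
    with w(2) have "compatible (cov_translation w) e' e2"
      using compatible_translation_iff[OF cov_translation_bij[OF w(1)]] by blast
    hence "compatible (cov_translation w \<circ> f') \<epsilon> e2" by (rule compatible_comp[OF fin e'])
    moreover have "\<forall>x\<in>?S. fst ((cov_translation w \<circ> f') x) = fst x"
      using fst by (simp add: f'_def)
    moreover have "arrow_rel ?G' ((cov_translation w \<circ> f') x) a ((cov_translation w \<circ> f') y)"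
      if E: "restrict_to ?S ?E x a y" for x a y
      unfolding arrow_rel_Suc
      using hom[OF E] add_carrier[OF w(1) c(1)[of x]] c(2)[OF E]
      by (intro exI[of _ "f x"] exI[of _ "f y"] exI[of _ "w + c x"]) (simp add: f'_def T_def add.assoc)
    moreover have "e2 \<in> iterated_dims Q d (Suc k)" using e2' by simp
    ultimately show ?case by blast
  qed
qed

lemma fst_verts_iterated_cover: "x \<in> verts (iterated_cover Q k) \<Longrightarrow> fst x \<in> verts Q"
proof (induction k arbitrary: x)
  case (Suc k)
  then obtain y z where "x = cov_lift y z" "y \<in> verts (iterated_cover Q k)"
    unfolding iterated_cover.simps verts_abelian_cover by blast
  with Suc.IH show ?case by simp
qed auto

text \<open>
  The second coordinate of the lift is a potential with values in the free group: along an edge it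
  is multiplied by the class of the label. The lift is an isomorphism of supports because the universal
  covering quiver is a forest.
\<close>

lemma iterated_to_universal:
  fixes Q :: "('v, 'a) quiver"
  assumes d: "d \<in> dim_vectors Q" and e: "e \<in> iterated_dims Q d k"
    and con: "connected_on (support e) (arrow_rel (iterated_cover Q k))"
    and tree: "is_forest (restrict_to (support e) (arrow_rel (iterated_cover Q k)))"
  shows "\<exists>\<epsilon>\<in>universal_dims Q d. \<exists>f. support_corr (arrow_rel (iterated_cover Q k)) e (arrow_rel (universal_cover Q)) \<epsilon> f"
proof -
  interpret Group.group "word_group (arcs Q)" by (rule group_word_group)
  let ?G = "iterated_cover Q k" and ?U = "universal_cover Q" and ?W = "word_group (arcs Q)"
  let ?E = "restrict_to (support e) (arrow_rel ?G)" and ?V = "verts (universal_cover Q)"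
  have eV: "finite (support e)" "support e \<subseteq> verts ?G"
    using iterated_dims_in_dim_vectors[OF d e] by (auto simp: in_dim_vectors)
  have over: "a \<in> arcs Q \<and> fst x = tail Q a \<and> fst y = head Q a" if "?E x a y" for x a y
    using that iterated_cover_over_Q[of "(a, snd x)" Q k]
    unfolding restrict_to_def arrow_rel_iterated_cover by (metis fst_conv)
  define T where "T x a (y :: ('v, 'a) cov) v = v \<otimes>\<^bsub>?W\<^esub> word_class (arcs Q) [(a, True)]"
    for x :: "('v, 'a) cov" and a y v
  have "bij_betw (T x a y) (carrier ?W) (carrier ?W)" if "?E x a y" for x a y
  proof -
    have l: "word_class (arcs Q) [(a, True)] \<in> carrier ?W" by (rule letter_carrier) (use over[OF that] in simp)
    show ?thesis
      by (rule bij_betw_byWitness[where f' = "\<lambda>v. v \<otimes>\<^bsub>?W\<^esub> inv\<^bsub>?W\<^esub> word_class (arcs Q) [(a, True)]"])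
        (use l in \<open>auto simp: T_def m_assoc\<close>)
  qed
  then obtain c where c: "\<And>x. c x \<in> carrier ?W" "\<And>x a y. ?E x a y \<Longrightarrow> c y = T x a y (c x)"
    using forest_potential[OF deterministic_iterated_cover con tree, of T "carrier ?W" "\<one>\<^bsub>?W\<^esub>"] one_closed
    by metis
  define f where "f x = (fst x, c x)" for x
  obtain e' where e': "compatible f e e'" using ex_compatible by blast
  have supp: "support e' = f ` support e" by (rule compatible_support[OF eV(1) e'])
  have V: "support e' \<subseteq> ?V"
  proof
    fix y assume "y \<in> support e'"
    then obtain x where x: "x \<in> support e" "y = (fst x, c x)" unfolding supp f_def by blast
    with eV(2) have "fst x \<in> verts Q" using fst_verts_iterated_cover by blast
    with x(2) c(1) show "y \<in> ?V" by (simp add: universal_cover_def)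
  qed
  let ?A = "{e \<in> dim_vectors ?U. compatible fst e d}"
  have "compatible (fst \<circ> f) e d"
    by (rule compatible_cong[OF iterated_dims_compatible[OF d e]]) (simp add: f_def)
  hence "compatible fst e' d" by (rule compatible_factor[OF eV(1) e'])
  hence "e' \<in> ?A" using V eV(1) supp by (simp add: in_dim_vectors)
  from class_reps_ex[OF equiv_universal_translations[where Q = Q] this]
  obtain \<epsilon> where \<epsilon>: "\<epsilon> \<in> universal_dims Q d" "(e', \<epsilon>) \<in> dim_equiv ?V (universal_translations Q) ?A"
    unfolding universal_dims_def by (rule bexE)
  then obtain \<tau> where "\<tau> \<in> universal_translations Q" and t2: "\<forall>x\<in>?V. \<epsilon> (\<tau> x) = e' x"
    unfolding dim_equiv_iff by blast
  then obtain v where v: "v \<in> carrier ?W" "\<tau> = (\<lambda>(q, w). (q, v \<otimes>\<^bsub>?W\<^esub> w))"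
    unfolding universal_translations_def by blast
  have \<epsilon>V: "support \<epsilon> \<subseteq> ?V" using universal_dimsD(1)[OF \<epsilon>(1)] by (simp add: in_dim_vectors)
  have "compatible \<tau> e' \<epsilon>"
    using compatible_translation_iff[OF universal_translation_bij[OF v(1)] V \<epsilon>V] t2 v(2) by simp
  hence comp: "compatible (\<tau> \<circ> f) e \<epsilon>" by (rule compatible_comp[OF eV(1) e'])
  have "support_corr (arrow_rel ?G) e (arrow_rel ?U) \<epsilon> (\<tau> \<circ> f)"
  proof (rule support_corr_of_hom[OF eV(1) deterministic_iterated_cover con deterministic_universal_cover _ comp])
    show "is_forest (restrict_to (support \<epsilon>) (arrow_rel ?U))"
      by (rule forest_restrict[OF forest_universal_cover])
    fix x a y assume E: "?E x a y"
    show "arrow_rel ?U ((\<tau> \<circ> f) x) a ((\<tau> \<circ> f) y)"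
      using over[OF E] c(2)[OF E] c(1)[of x] v(1) letter_carrier[of a "arcs Q" True]
      by (simp add: arrow_rel_universal_cover f_def v(2) T_def m_assoc)
  qed (simp add: f_def v(2))
  with \<epsilon>(1) show ?thesis by blast
qed

text \<open>
  An isomorphism between connected supports over \<open>Q\<close> is the restriction of a translation, since left
  multiplication commutes with the right multiplications along the edges.
\<close>

lemma universal_dims_unique:
  fixes Q :: "('v, 'a) quiver"
  assumes \<epsilon>: "\<epsilon> \<in> universal_dims Q d" "\<epsilon>' \<in> universal_dims Q d"
    and con: "connected_on (support \<epsilon>) (arrow_rel (universal_cover Q))"
    and corr: "support_corr (arrow_rel (universal_cover Q)) \<epsilon> (arrow_rel (universal_cover Q)) \<epsilon>' f"
  shows "\<epsilon> = \<epsilon>'"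
proof (cases "support \<epsilon> = {}")
  case True
  moreover have "support \<epsilon>' = {}" using corr True by (simp add: support_corr_def bij_betw_def)
  ultimately show ?thesis by (auto simp: support_def)
next
  case False
  interpret Group.group "word_group (arcs Q)" by (rule group_word_group)
  let ?E = "arrow_rel (universal_cover Q)" and ?W = "word_group (arcs Q)" and ?V = "verts (universal_cover Q)"
  obtain x0 where x0: "x0 \<in> support \<epsilon>" using False by blast
  have V: "support \<epsilon> \<subseteq> ?V" "support \<epsilon>' \<subseteq> ?V"
    using universal_dimsD(1)[OF \<epsilon>(1)] universal_dimsD(1)[OF \<epsilon>(2)] by (auto simp: in_dim_vectors)
  have snd_V: "snd x \<in> carrier ?W" if "x \<in> ?V" for x using that by (auto simp: universal_cover_def)
  have W: "snd x \<in> carrier ?W" "snd (f x) \<in> carrier ?W" if "x \<in> support \<epsilon>" for x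
    using that V corr snd_V unfolding support_corr_def by (blast, meson bij_betw_apply subsetD)
  define v where "v = snd (f x0) \<otimes>\<^bsub>?W\<^esub> inv\<^bsub>?W\<^esub> (snd x0)"
  have v: "v \<in> carrier ?W" using W[OF x0] by (simp add: v_def)
  let ?\<tau> = "\<lambda>(q :: 'v, w). (q, v \<otimes>\<^bsub>?W\<^esub> w)"
  have "snd (f x) = v \<otimes>\<^bsub>?W\<^esub> snd x" if x: "x \<in> support \<epsilon>" for x
  proof -
    obtain u where u: "path (restrict_to (support \<epsilon>) ?E) x0 u x" using con x0 x unfolding connected_on_def by blast
    have "(snd (f x0) = v \<otimes>\<^bsub>?W\<^esub> snd x0) \<longleftrightarrow> (snd (f x) = v \<otimes>\<^bsub>?W\<^esub> snd x)"
    proof (rule path_invariant[OF _ u, where P = "\<lambda>x. snd (f x) = v \<otimes>\<^bsub>?W\<^esub> snd x"])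
      fix x a y assume E: "restrict_to (support \<epsilon>) ?E x a y"
      hence xy: "x \<in> support \<epsilon>" "y \<in> support \<epsilon>" "?E x a y" by (auto simp: restrict_to_def)
      with corr have "?E (f x) a (f y)" unfolding support_corr_def by blast
      with xy have *: "a \<in> arcs Q" "snd y = snd x \<otimes>\<^bsub>?W\<^esub> word_class (arcs Q) [(a, True)]"
        "snd (f y) = snd (f x) \<otimes>\<^bsub>?W\<^esub> word_class (arcs Q) [(a, True)]"
        by (auto simp: arrow_rel_universal_cover)
      note l = letter_carrier[OF *(1), of True]
      have "v \<otimes>\<^bsub>?W\<^esub> snd y = v \<otimes>\<^bsub>?W\<^esub> snd x \<otimes>\<^bsub>?W\<^esub> word_class (arcs Q) [(a, True)]"
        using v l W[OF xy(1)] by (simp add: *(2) m_assoc)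
      thus "(snd (f x) = v \<otimes>\<^bsub>?W\<^esub> snd x) \<longleftrightarrow> (snd (f y) = v \<otimes>\<^bsub>?W\<^esub> snd y)"
        unfolding *(3) using right_cancel[OF l W(2)[OF xy(1)] m_closed[OF v W(1)[OF xy(1)]]] by simp
    qed
    moreover have "snd (f x0) = v \<otimes>\<^bsub>?W\<^esub> snd x0" using W[OF x0] by (simp add: v_def m_assoc)
    ultimately show ?thesis by blast
  qed
  hence "f x = ?\<tau> x" if "x \<in> support \<epsilon>" for x
    using corr that by (simp add: support_corr_def prod_eq_iff case_prod_beta)
  with compatible_cong[OF support_corr_compatible[OF corr]] have "compatible ?\<tau> \<epsilon> \<epsilon>'" by blast
  with compatible_translation_iff[OF universal_translation_bij[OF v] V]
  have "\<forall>x\<in>?V. \<epsilon>' (?\<tau> x) = \<epsilon> x" by blast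
  moreover have "?\<tau> \<in> universal_translations Q" using v unfolding universal_translations_def by blast
  ultimately have "(\<epsilon>, \<epsilon>') \<in> dim_equiv ?V (universal_translations Q) {e \<in> dim_vectors (universal_cover Q). compatible fst e d}"
    unfolding dim_equiv_iff using universal_dimsD[OF \<epsilon>(1)] universal_dimsD[OF \<epsilon>(2)] by blast
  with \<epsilon> show ?thesis
    unfolding universal_dims_def by (intro class_reps_unique[OF equiv_universal_translations])
qed

section \<open>Iterated fixed points and the universal covering quiver\<close>

lemma arcs_determined_iterated_cover: "arcs_determined (iterated_cover Q k)"
  unfolding arcs_determined_def using iterated_cover_arcs_inj by blast

lemma arcs_determined_universal_cover: "arcs_determined (universal_cover Q)"
  unfolding arcs_determined_def using universal_cover_arcs_inj by blast

lemma stable_moduli_nonempty_connected: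
  assumes "e \<in> dim_vectors G" "points (stable_moduli G \<Theta> e) \<noteq> {}"
  shows "connected_on (support e) (arrow_rel G)"
proof -
  from assms(2) obtain X where "X \<in> reps G e" "stable G \<Theta> e X" by (auto simp: topspace_stable_moduli)
  with stable_support_connected assms(1) show ?thesis by (auto simp: in_dim_vectors)
qed

text \<open>
  Components with nonempty moduli space have connected support, which is a tree by the choice of \<open>k\<close>.
  Each such dimension vector on one side has a unique partner on the other side with isomorphic
  support, and partners have isomorphic moduli spaces.
\<close>

lemma cover_moduli_iso_universal_moduli:
  assumes wf: "wf_digraph Q" and d: "d \<in> dim_vectors Q" and k: "k > sum d (support d)"
  shows "cover_moduli Q \<Theta> d k \<cong>\<^sub>f universal_moduli Q \<Theta> d"
proof -
  let ?G = "iterated_cover Q k" and ?U = "universal_cover Q"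
  let ?M = "stable_moduli ?G (\<Theta> \<circ> fst)" and ?N = "stable_moduli ?U (\<Theta> \<circ> fst)"
  let ?corr = "support_corr (arrow_rel ?G)"
  define NM NN where "NM e \<longleftrightarrow> points (?M e) \<noteq> {}" and "NN \<epsilon> \<longleftrightarrow> points (?N \<epsilon>) \<noteq> {}"
    for e \<epsilon>
  let ?I = "{e \<in> iterated_dims Q d k. NM e}" and ?J = "{\<epsilon> \<in> universal_dims Q d. NN \<epsilon>}"
  have I: "e \<in> dim_vectors ?G" if "e \<in> iterated_dims Q d k" for e
    by (rule iterated_dims_in_dim_vectors[OF d that])
  have iso: "\<exists>\<Phi> \<Psi>. inverse_homs (?M e) (?N \<epsilon>) \<Phi> \<Psi>"
    if "e \<in> iterated_dims Q d k" "\<epsilon> \<in> universal_dims Q d" "?corr e (arrow_rel ?U) \<epsilon> f" for e \<epsilon> f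
    by (rule support_corr_moduli[OF wf_iterated_cover[OF wf] wf_universal_cover[OF wf]
          arcs_determined_iterated_cover arcs_determined_universal_cover _ _ that(3)])
      (use I[OF that(1)] universal_dimsD(1)[OF that(2)] in \<open>auto simp: in_dim_vectors\<close>)
  have nonempty: "NM e \<longleftrightarrow> NN \<epsilon>"
    if "e \<in> iterated_dims Q d k" "\<epsilon> \<in> universal_dims Q d" "?corr e (arrow_rel ?U) \<epsilon> f" for e \<epsilon> f
  proof -
    from iso[OF that]
    obtain \<Phi> \<Psi> where "fspace_hom (?M e) (?N \<epsilon>) \<Phi>" "fspace_hom (?N \<epsilon>) (?M e) \<Psi>"
      unfolding inverse_homs_def by (elim exE conjE)
    from fspace_hom_nonempty[OF this(1)] fspace_hom_nonempty[OF this(2)] show ?thesis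
      unfolding NM_def NN_def by (rule iffI)
  qed
  have conM: "connected_on (support e) (arrow_rel ?G)" if "e \<in> iterated_dims Q d k" "NM e" for e
    by (rule stable_moduli_nonempty_connected[OF I[OF that(1)] that(2)[unfolded NM_def]])
  have ex: "\<exists>\<epsilon>. \<epsilon> \<in> ?J \<and> (\<exists>f. ?corr e (arrow_rel ?U) \<epsilon> f)" if e: "e \<in> ?I" for e
  proof -
    from e have e': "e \<in> iterated_dims Q d k" "NM e" by blast+
    from iterated_to_universal[OF d e'(1) conM[OF e'] support_forest[OF d e'(1) k]]
    obtain \<epsilon> f where "\<epsilon> \<in> universal_dims Q d" "?corr e (arrow_rel ?U) \<epsilon> f" by blast
    with nonempty[OF e'(1) this] e'(2) show ?thesis by blast
  qed
  define \<sigma> where "\<sigma> e = (SOME \<epsilon>. \<epsilon> \<in> ?J \<and> (\<exists>f. ?corr e (arrow_rel ?U) \<epsilon> f))" for e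
  have \<sigma>: "\<sigma> e \<in> ?J \<and> (\<exists>f. ?corr e (arrow_rel ?U) (\<sigma> e) f)" if "e \<in> ?I" for e
    unfolding \<sigma>_def by (rule someI_ex[OF ex[OF that]])
  have "bij_betw \<sigma> ?I ?J"
    unfolding bij_betw_def
  proof
    show "inj_on \<sigma> ?I"
    proof (rule inj_onI)
      fix e e' assume e: "e \<in> ?I" "e' \<in> ?I" "\<sigma> e = \<sigma> e'"
      obtain f f' where "?corr e (arrow_rel ?U) (\<sigma> e) f" "?corr e' (arrow_rel ?U) (\<sigma> e) f'"
        using \<sigma>[OF e(1)] \<sigma>[OF e(2)] e(3) by auto
      then obtain g where g: "?corr e (arrow_rel ?G) e' g"
        using support_corr_trans support_corr_sym by blast
      have e': "e \<in> iterated_dims Q d k" "e' \<in> iterated_dims Q d k" using e by blast+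
      have con: "connected_on (support e) (arrow_rel ?G)" using conM e by blast
      have fin: "finite (support e)" using I[OF e'(1)] by (simp add: in_dim_vectors)
      have "?corr e (arrow_rel ?G) e id" by (simp add: support_corr_def)
      hence "compatible id e e" by (rule support_corr_compatible)
      hence "e = e' \<and> (\<forall>x\<in>support e. id x = g x)"
        by (rule iterated_lift_unique[OF d fin con e' _ support_corr_compatible[OF g]])
          (use g in \<open>auto simp: support_corr_def restrict_to_def\<close>)
      thus "e = e'" ..
    qed
    show "\<sigma> ` ?I = ?J"
    proof
      show "\<sigma> ` ?I \<subseteq> ?J" using \<sigma> by blast
      show "?J \<subseteq> \<sigma> ` ?I"
      proof
        fix \<epsilon> assume "\<epsilon> \<in> ?J"
        hence \<epsilon>: "\<epsilon> \<in> universal_dims Q d" "NN \<epsilon>" by blast+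
        note \<epsilon>D = universal_dimsD[OF \<epsilon>(1)]
        have con: "connected_on (support \<epsilon>) (arrow_rel ?U)"
          by (rule stable_moduli_nonempty_connected[OF \<epsilon>D(1) \<epsilon>(2)[unfolded NN_def]])
        from universal_to_iterated[OF d \<epsilon>D con, of k]
        obtain e f where e: "e \<in> iterated_dims Q d k" and f: "compatible f \<epsilon> e" "\<forall>x\<in>support \<epsilon>. fst (f x) = fst x"
          "\<And>x a y. restrict_to (support \<epsilon>) (arrow_rel ?U) x a y \<Longrightarrow> arrow_rel ?G (f x) a (f y)" by blast
        have "support_corr (arrow_rel ?U) \<epsilon> (arrow_rel ?G) e f"
          by (rule support_corr_of_hom[OF _ deterministic_universal_cover con deterministic_iterated_cover
                support_forest[OF d e k] f(1,3)])
            (use \<epsilon>D(1) f(2) in \<open>auto simp: in_dim_vectors\<close>)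
        then obtain g where g: "?corr e (arrow_rel ?U) \<epsilon> g" "support_corr (arrow_rel ?U) \<epsilon> (arrow_rel ?G) e f"
          using support_corr_sym by blast
        have eI: "e \<in> ?I" using e nonempty[OF e \<epsilon>(1) g(1)] \<epsilon>(2) by blast
        from \<sigma>[OF eI] obtain h where "\<sigma> e \<in> universal_dims Q d" "?corr e (arrow_rel ?U) (\<sigma> e) h" by blast
        with support_corr_trans[OF g(2)] universal_dims_unique[OF \<epsilon>(1) _ con] have "\<epsilon> = \<sigma> e" by blast
        with eI show "\<epsilon> \<in> \<sigma> ` ?I" by blast
      qed
    qed
  qed
  thus ?thesis
    unfolding cover_moduli_def universal_moduli_def NM_def NN_def
  proof (rule sum_fspace_iso)
    fix e assume e: "e \<in> iterated_dims Q d k" "points (?M e) \<noteq> {}"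
    hence "e \<in> ?I" by (simp add: NM_def)
    from \<sigma>[OF this] obtain f where "\<sigma> e \<in> universal_dims Q d" "?corr e (arrow_rel ?U) (\<sigma> e) f"
      by blast
    from iso[OF e(1) this]
    show "\<exists>\<Phi> \<Psi>. inverse_homs (?M e) (?N (\<sigma> e)) \<Phi> \<Psi>" .
  qed (rule fsheaf_stable_moduli)+
qed

lemma cover_moduli_torus_fixed:
  assumes wf: "wf_digraph Q" and d: "d \<in> dim_vectors Q" and k: "k > sum d (support d)"
    and em: "(e, m) \<in> points (cover_moduli Q \<Theta> d k)"
    and t: "t \<in> torus (iterated_cover Q k)"
  shows "torus_act (iterated_cover Q k) t ` m = m"
proof -
  from em have e: "e \<in> iterated_dims Q d k"
    and m: "m \<in> points (stable_moduli (iterated_cover Q k) (\<Theta> \<circ> fst) e)"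
    by (auto simp: cover_moduli_def sum_fspace_def)
  from m obtain X where X: "X \<in> reps (iterated_cover Q k) e" "m = orbit (iterated_cover Q k) e X"
    by (auto simp: topspace_stable_moduli)
  have con: "connected_on (support e) (arrow_rel (iterated_cover Q k))"
    using m by (intro stable_moduli_nonempty_connected[OF iterated_dims_in_dim_vectors[OF d e]])
      (rule ex_in_conv[THEN iffD1, OF exI])
  show ?thesis
    unfolding X(2)
    by (rule torus_act_fixes_orbit[OF wf_iterated_cover[OF wf] deterministic_iterated_cover
          iterated_cover_arcs_inj con support_forest[OF d e k] X(1) t])
qed

lemma fsheaf_cover_moduli: "fsheaf (cover_moduli Q \<Theta> d k)"
  unfolding cover_moduli_def by (intro fsheaf_sum_fspace fsheaf_stable_moduli)

theorem theorem3p13: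
  fixes Q :: "('v, 'a) pre_digraph" and \<Theta> :: "'v \<Rightarrow> int" and d :: "'v \<Rightarrow> nat"
  assumes "fin_digraph Q"
    and "Digraph_Component.connected Q"
    and "\<nexists>p. pre_digraph.cycle Q p"
    and "d \<in> dim_vectors Q"
  shows "\<exists>n. \<forall>n'\<ge>n. iterated_fixed Q \<Theta> d n' \<cong>\<^sub>f universal_moduli Q \<Theta> d"
\<comment> \<open>The \<open>(k+1)\<close>-fold fixed point space is a subspace of the moduli of the \<open>k\<close>-fold
  covering, and \<open>k\<close> has to exceed the total dimension.\<close>
proof (rule exI[of _ "sum d (support d) + 2"], intro allI impI)
  fix n' assume n': "n' \<ge> sum d (support d) + 2"
  define k where "k = n' - 1"
  have k: "n' = Suc k" "k > sum d (support d)" unfolding k_def using n' by linarith+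
  have wf: "wf_digraph Q" using assms(1) by (simp add: fin_digraph_def)
  let ?X = "cover_moduli Q \<Theta> d k"
  have "{(e, m) \<in> points ?X. \<forall>t\<in>torus (iterated_cover Q k). torus_act (iterated_cover Q k) t ` m = m} =
      points ?X"
  proof (intro subset_antisym subsetI)
    fix p assume "p \<in> points ?X"
    moreover obtain e m where "p = (e, m)" by fastforce
    ultimately show "p \<in> {(e, m) \<in> points ?X.
        \<forall>t\<in>torus (iterated_cover Q k). torus_act (iterated_cover Q k) t ` m = m}"
      using cover_moduli_torus_fixed[OF wf assms(4) k(2)] by simp
  qed (simp split: prod.splits)
  hence "iterated_fixed Q \<Theta> d n' = sub_fspace ?X (points ?X)" by (simp only: k(1) iterated_fixed.simps)
  also have "\<dots> \<cong>\<^sub>f ?X" by (rule sub_fspace_topspace_iso[OF fsheaf_cover_moduli])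
  finally show "iterated_fixed Q \<Theta> d n' \<cong>\<^sub>f universal_moduli Q \<Theta> d"
    by (rule fspace_iso_trans[OF _ cover_moduli_iso_universal_moduli[OF wf assms(4) k(2)]])
qed

end
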